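(* Let $(\mathcal M,g)$ be a smooth $d$-dimensional Riemannian manifold, let $\mathcal U\subset\mathcal M$ be a compact strongly convex neighborhood, sufficiently small that logarithm maps and squared distances between its points are smooth, and let $\kappa\ge0$ with $|\operatorname{Sec}|\le\kappa$ on $\mathcal U$. Let constants $c_1,c_2,\Gamma,L_v,L_u>0$ and $C_H>0$ be given (uniform over $\mathcal U$ and over the replanning steps). Then there exist $\rho^*>0$, $\Delta t^*>0$ and $C_7>0$ such that the following holds at each replanning step $k$ of the tangent-space LQR scheme (described in the context) with sampling step $\Delta t$. Let $\bar q$ be the target at this step, $\Psi(x)=\frac12\operatorname{dist}_g(x,\bar q)^2$, $r_k=\operatorname{Log}_{x_k}(\bar q)$, $\eta_j^k=\operatorname{Log}_{x_k}(q_j)$, $\sigma_k^{\mathrm{tar}}=\max_j\|\eta_j^k\|_{x_k}$ and $\rho_k=\max\{\|r_k\|_{x_k},\sigma_k^{\mathrm{tar}}\}$. Suppose that $\bar q\in\mathcal U$, that the trajectory generated by the tangent-space LQR remains in $\mathcal U$, that the Hessian of $\Psi$ is bounded by $C_H$ in operator norm on $\mathcal U$, and that (i) (alignment) $\langle r_k,v_k\rangle_{x_k}\ge c_1\|r_k\|_{x_k}^2-c_2\kappa\rho_k^3$; (ii) (target spread) $\sigma_k^{\mathrm{tar}}\le\Gamma\|r_k\|_{x_k}$; (iii) (local boundedness) along the LQR closed-loop segment, $\|v(t)\|_{x(t)}\le L_v\rho_k$ and $\|u(t)\|_{x(t)}\le L_u\rho_k$ for all $t\in[t_k,t_k+\Delta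 t]$. If $\rho_k\le\rho^*$ and $0<\Delta t\le\Delta t^*$, then, for the next state $x_{k+1}=\operatorname{Exp}_{x_k}\!\left(\Delta t\,v_k+\tfrac12\Delta t^2u_k\right)$, $$\Psi(x_{k+1})-\Psi(x_k)\le -C_7\,\Delta t\,\|r_k\|_{x_k}^2 .$$ Thus, under these hypotheses, the tangent-space LQR yields local descent whenever its closed-loop velocity satisfies the gain-dependent alignment condition (i).
   Context: $\operatorname{dist}_g$ is the Riemannian distance, $\operatorname{Exp}_x$ the exponential map, $\operatorname{Log}_x$ its local inverse (for $q$ in a strongly convex neighborhood containing $x$, $\operatorname{Log}_x(q)$ is the initial velocity of the minimizing geodesic on $[0,1]$ from $x$ to $q$), $\nabla$ the Levi-Civita connection, $\operatorname{Sec}$ the sectional curvature. A neighborhood is strongly convex if any two of its points are joined by a unique minimizing geodesic of $\mathcal M$, lying in the neighborhood. $\mathcal P_{x_k\to x}$ denotes parallel transport from $T_{x_k}\mathcal M$ to $T_x\mathcal M$ along the radial geodesic $s\mapsto\operatorname{Exp}_{x_k}(s\operatorname{Log}_{x_k}(x))$, $s\in[0,1]$. Dynamics: the agent has configuration $x(t)\in\mathcal M$, velocity $v(t)\in T_{x(t)}\mathcal M$ and control $u(t)\in T_{x(t)}\mathcal M$ with $\dot x=v$, $\nabla_{\dot x}v=u$. Tangent-space LQR scheme: at replanning step $k$ (time $t_k$) the agent is at $x_k\in\mathcal M$ with velocity $v_k\in T_{x_k}\mathcal M$. Given a finite nonempty family of target samples $q_j\in\mathcal M$ (in the local neighborhood)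 with weights $\pi_j\ge0$, $\alpha=\sum_j\pi_j>0$, set $\eta_j^k=\operatorname{Log}_{x_k}(q_j)$ and $\eta_{\mathrm{lin}}^k=\frac1\alpha\sum_j\pi_j\eta_j^k$. Identify $T_{x_k}\mathcal M$ with $\mathbb R^d$ by an orthonormal basis and let $y_k=[(-\eta_{\mathrm{lin}}^k)^\top,v_k^\top]^\top$. For a horizon $T\ge1$ and terminal weight $w_f\ge0$, let $$A_d=\begin{bmatrix}I&\Delta t\,I\\0&I\end{bmatrix},\quad B_d=\begin{bmatrix}\tfrac12\Delta t^2I\\ \Delta t\,I\end{bmatrix},\quad \bar Q=\Delta t\,\mathrm{diag}(\alpha I,0),\quad \bar R=\Delta t\,I,\quad P_T=\mathrm{diag}(w_f\alpha I,0),$$ and for $m=T-1,\dots,0$ let $S_m=\bar R+B_d^\top P_{m+1}B_d$, $K_m=S_m^{-1}B_d^\top P_{m+1}A_d$, $P_m=\bar Q+A_d^\top P_{m+1}A_d-A_d^\top P_{m+1}B_dS_m^{-1}B_d^\top P_{m+1}A_d$. The control is $u_k=-K_0y_k\in T_{x_k}\mathcal M$. The closed-loop segment on $[t_k,t_k+\Delta t]$ is the solution of the dynamics above with $x(t_k)=x_k$, $v(t_k)=v_k$ and $u(t)=\mathcal P_{x_k\to x(t)}u_k$. The state is advanced to the next replanning step by the numerical update (a local approximation of the intrinsic dynamics over the sampling interval) $$x_{k+1}=\operatorname{Exp}_{x_k}\!\left(\Delta t\,v_k+\tfrac12\Delta t^2u_k\right),\qquad v_{k+1}=\mathcal P_{x_k\to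 x_{k+1}}(v_k+\Delta t\,u_k).$$ The trajectory generated by the tangent-space LQR comprises the closed-loop segments $x(t)$ and the states $x_k$, $x_{k+1}$ at the replanning steps. In the receding-horizon implementation the target $\bar q$ is taken at step $k$ to be $\tilde q_R^k=\operatorname{Exp}_{x_k}(\eta_{\mathrm{lin}}^k)$; it is held fixed during the step. *)

theory Defs
  imports "HOL-Analysis.Analysis"
begin

section \<open>Smooth maps between Euclidean spaces\<close>

text \<open>Only used on open sets. Derivatives in all directions are required to be
  \<open>k\<close> times differentiable again.\<close>

fun Ck_on :: "nat \<Rightarrow> ('a::euclidean_space) set \<Rightarrow> ('a \<Rightarrow> 'b::real_normed_vector) \<Rightarrow> bool" where
  "Ck_on 0 S f \<longleftrightarrow> continuous_on S f"
| "Ck_on (Suc k) S f \<longleftrightarrow>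
     (\<forall>y\<in>S. f differentiable (at y)) \<and>
     (\<forall>h. Ck_on k S (\<lambda>y. frechet_derivative f (at y) h))"

definition smooth_on :: "('a::euclidean_space) set \<Rightarrow> ('a \<Rightarrow> 'b::real_normed_vector) \<Rightarrow> bool" where
  "smooth_on S f \<longleftrightarrow> (\<forall>k. Ck_on k S f)"

definition pd :: "'d::finite \<Rightarrow> (real^'d \<Rightarrow> 'b::real_normed_vector) \<Rightarrow> real^'d \<Rightarrow> 'b" where
  "pd i f y = frechet_derivative f (at y) (axis i 1)"

section \<open>Riemannian manifolds\<close>

text \<open>The points of the manifold are the elements of the type \<open>'m\<close>, the dimension is
  \<open>d = CARD('d)\<close>. A chart is a pair of its domain and its coordinate map; the values of the
  coordinate map outside the domain are irrelevant. The metric is given by its coordinate matrices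
  \<open>(g\<^sub>i\<^sub>j(y))\<close>, one field for each chart, as functions of the coordinates \<open>y\<close>.\<close>

type_synonym ('m, 'd) chart = "'m set \<times> ('m \<Rightarrow> real^'d)"

record ('m, 'd) riemannian =
  atlas :: "('m, 'd) chart set"
  metric :: "('m, 'd) chart \<Rightarrow> real^'d \<Rightarrow> real^'d^'d"

abbreviation chart_inv :: "('m, 'd::finite) chart \<Rightarrow> real^'d \<Rightarrow> 'm" where
  "chart_inv c \<equiv> inv_into (fst c) (snd c)"

definition smooth_atlas :: "('m::topological_space, 'd::finite) chart set \<Rightarrow> bool" where
  "smooth_atlas A \<longleftrightarrow>
     (\<Union>c\<in>A. fst c) = UNIV \<and>
     (\<forall>c\<in>A. open (fst c) \<and> open (snd c ` fst c) \<and>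
        homeomorphism (fst c) (snd c ` fst c) (snd c) (chart_inv c)) \<and>
     (\<forall>c\<in>A. \<forall>c'\<in>A. smooth_on (snd c ` (fst c \<inter> fst c')) (snd c' \<circ> chart_inv c))"

definition riemannian_manifold ::
  "('m::{t2_space,second_countable_topology}, 'd::finite) riemannian \<Rightarrow> bool" where
  "riemannian_manifold M \<longleftrightarrow>
     smooth_atlas (atlas M) \<and>
     (\<forall>c\<in>atlas M. smooth_on (snd c ` fst c) (metric M c) \<and>
        (\<forall>y\<in>snd c ` fst c. transpose (metric M c y) = metric M c y \<and>
           (\<forall>\<xi>. \<xi> \<noteq> 0 \<longrightarrow> \<xi> \<bullet> (metric M c y *v \<xi>) > 0))) \<and>
     (\<forall>c\<in>atlas M. \<forall>c'\<in>atlas M. \<forall>p\<in>fst c \<inter> fst c'. \<forall>\<xi> \<eta>.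
        \<xi> \<bullet> (metric M c (snd c p) *v \<eta>) =
          (let J = frechet_derivative (snd c' \<circ> chart_inv c) (at (snd c p))
           in J \<xi> \<bullet> (metric M c' (snd c' p) *v J \<eta>)))"

text \<open>A tangent vector at \<open>x\<close> is represented by its components in one preferred chart around \<open>x\<close>,
  so that every \<open>T\<^sub>xM\<close> is a copy of \<open>real^'d\<close>; \<open>tcoord M c x \<xi>\<close> are the components of \<open>\<xi> \<in> T\<^sub>xM\<close>
  in another chart \<open>c\<close> around \<open>x\<close>. No identification of tangent spaces at different points is
  implied.\<close>

definition chart_at :: "('m, 'd::finite) riemannian \<Rightarrow> 'm \<Rightarrow> ('m, 'd) chart" where
  "chart_at M x = (SOME c. c \<in> atlas M \<and> x \<in> fst c)"

definition tcoord :: "('m, 'd::finite) riemannian \<Rightarrow> ('m, 'd) chart \<Rightarrow> 'm \<Rightarrow> real^'d \<Rightarrow> real^'d" where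
  "tcoord M c x =
     frechet_derivative (snd c \<circ> chart_inv (chart_at M x)) (at (snd (chart_at M x) x))"

definition ginner :: "('m, 'd::finite) riemannian \<Rightarrow> 'm \<Rightarrow> real^'d \<Rightarrow> real^'d \<Rightarrow> real" where
  "ginner M x \<xi> \<eta> = \<xi> \<bullet> (metric M (chart_at M x) (snd (chart_at M x) x) *v \<eta>)"

definition gnorm :: "('m, 'd::finite) riemannian \<Rightarrow> 'm \<Rightarrow> real^'d \<Rightarrow> real" where
  "gnorm M x \<xi> = sqrt (ginner M x \<xi> \<xi>)"

section \<open>Levi-Civita connection and curvature\<close>

text \<open>\<open>christoffel M c l i j y\<close> is \<open>\<Gamma>\<^sup>l\<^sub>i\<^sub>j\<close> of the Levi-Civita connection in the chart \<open>c\<close>.\<close>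

definition christoffel ::
  "('m, 'd::finite) riemannian \<Rightarrow> ('m, 'd) chart \<Rightarrow> 'd \<Rightarrow> 'd \<Rightarrow> 'd \<Rightarrow> real^'d \<Rightarrow> real" where
  "christoffel M c l i j y =
     (let g = (\<lambda>a b z. metric M c z $ a $ b)
      in (1/2) * (\<Sum>m\<in>UNIV. matrix_inv (metric M c y) $ l $ m *
            (pd i (g j m) y + pd j (g i m) y - pd m (g i j) y)))"

definition has_velocity ::
  "('m::t2_space, 'd::finite) riemannian \<Rightarrow> real set \<Rightarrow> (real \<Rightarrow> 'm) \<Rightarrow> real \<Rightarrow> real^'d \<Rightarrow> bool" where
  "has_velocity M I \<gamma> t \<xi> \<longleftrightarrow>
     continuous (at t within I) \<gamma> \<and>
     ((snd (chart_at M (\<gamma> t)) \<circ> \<gamma>) has_vector_derivative \<xi>) (at t within I)"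

text \<open>\<open>A = (\<nabla>\<^sub>\<gamma>\<^sub>' V)(t)\<close> for a vector field \<open>V\<close> along \<open>\<gamma>\<close>, that is \<open>V s \<in> T\<^bsub>\<gamma>(s)\<^esub>M\<close>. Near \<open>t\<close> the
  components of \<open>V\<close> have to be taken in one fixed chart, namely the preferred one at \<open>\<gamma> t\<close>.\<close>

definition has_covariant_derivative ::
  "('m::t2_space, 'd::finite) riemannian \<Rightarrow> real set \<Rightarrow> (real \<Rightarrow> 'm) \<Rightarrow> (real \<Rightarrow> real^'d) \<Rightarrow>
   real \<Rightarrow> real^'d \<Rightarrow> bool" where
  "has_covariant_derivative M I \<gamma> V t A \<longleftrightarrow>
     (let c = chart_at M (\<gamma> t)
      in \<exists>\<xi> D. has_velocity M I \<gamma> t \<xi> \<and>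
           ((\<lambda>s. tcoord M c (\<gamma> s) (V s)) has_vector_derivative D) (at t within I) \<and>
           A = D + (\<chi> l. \<Sum>i\<in>UNIV. \<Sum>j\<in>UNIV.
                      christoffel M c l i j (snd c (\<gamma> t)) * \<xi> $ i * V t $ j))"

text \<open>With \<open>R(\<xi>,\<eta>)\<zeta> = \<nabla>\<^sub>\<xi>\<nabla>\<^sub>\<eta>\<zeta> - \<nabla>\<^sub>\<eta>\<nabla>\<^sub>\<xi>\<zeta> - \<nabla>\<^bsub>[\<xi>,\<eta>]\<^esub>\<zeta>\<close>, \<open>riemann_comp M c l i j k\<close> is the \<open>l\<close>-th component
  of \<open>R(\<partial>\<^sub>i,\<partial>\<^sub>j)\<partial>\<^sub>k\<close>.\<close>

definition riemann_comp ::
  "('m, 'd::finite) riemannian \<Rightarrow> ('m, 'd) chart \<Rightarrow> 'd \<Rightarrow> 'd \<Rightarrow> 'd \<Rightarrow> 'd \<Rightarrow> real^'d \<Rightarrow> real" where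
  "riemann_comp M c l i j k y =
     (let G = christoffel M c
      in pd i (G l j k) y - pd j (G l i k) y +
         (\<Sum>m\<in>UNIV. G l i m y * G m j k y - G l j m y * G m i k y))"

definition curvature ::
  "('m, 'd::finite) riemannian \<Rightarrow> 'm \<Rightarrow> real^'d \<Rightarrow> real^'d \<Rightarrow> real^'d \<Rightarrow> real^'d" where
  "curvature M x \<xi> \<eta> \<zeta> =
     (let c = chart_at M x
      in \<chi> l. \<Sum>i\<in>UNIV. \<Sum>j\<in>UNIV. \<Sum>k\<in>UNIV.
           riemann_comp M c l i j k (snd c x) * \<xi> $ i * \<eta> $ j * \<zeta> $ k)"

definition sectional :: "('m, 'd::finite) riemannian \<Rightarrow> 'm \<Rightarrow> real^'d \<Rightarrow> real^'d \<Rightarrow> real" where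
  "sectional M x \<xi> \<eta> =
     ginner M x (curvature M x \<xi> \<eta> \<eta>) \<xi> /
       (ginner M x \<xi> \<xi> * ginner M x \<eta> \<eta> - (ginner M x \<xi> \<eta>)\<^sup>2)"

definition sectional_bounded :: "('m, 'd::finite) riemannian \<Rightarrow> 'm set \<Rightarrow> real \<Rightarrow> bool" where
  "sectional_bounded M U \<kappa> \<longleftrightarrow>
     (\<forall>x\<in>U. \<forall>\<xi> \<eta>. \<xi> \<noteq> \<eta> \<and> independent {\<xi>, \<eta>} \<longrightarrow> \<bar>sectional M x \<xi> \<eta>\<bar> \<le> \<kappa>)"

text \<open>Riemannian Hessian \<open>\<nabla>df\<close> as a bilinear form on \<open>T\<^sub>xM\<close>.\<close>

definition hessian ::
  "('m, 'd::finite) riemannian \<Rightarrow> ('m \<Rightarrow> real) \<Rightarrow> 'm \<Rightarrow> real^'d \<Rightarrow> real^'d \<Rightarrow> real" where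
  "hessian M f x \<xi> \<eta> =
     (let c = chart_at M x; F = f \<circ> chart_inv c; y = snd c x
      in \<Sum>i\<in>UNIV. \<Sum>j\<in>UNIV.
           (pd i (pd j F) y - (\<Sum>l\<in>UNIV. christoffel M c l i j y * pd l F y)) * \<xi> $ i * \<eta> $ j)"

definition hessian_bounded ::
  "('m, 'd::finite) riemannian \<Rightarrow> ('m \<Rightarrow> real) \<Rightarrow> 'm set \<Rightarrow> real \<Rightarrow> bool" where
  "hessian_bounded M f U C \<longleftrightarrow>
     (\<forall>x\<in>U. \<forall>\<xi> \<eta>. \<bar>hessian M f x \<xi> \<eta>\<bar> \<le> C * gnorm M x \<xi> * gnorm M x \<eta>)"

section \<open>Length, distance, geodesics\<close>

definition C1_curve ::
  "('m::t2_space, 'd::finite) riemannian \<Rightarrow> real \<Rightarrow> real \<Rightarrow> (real \<Rightarrow> 'm) \<Rightarrow> bool" where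
  "C1_curve M a b \<gamma> \<longleftrightarrow>
     continuous_on {a..b} \<gamma> \<and>
     (\<forall>c\<in>atlas M. \<exists>D.
        (\<forall>t\<in>{a..b}. \<gamma> t \<in> fst c \<longrightarrow>
           ((snd c \<circ> \<gamma>) has_vector_derivative D t) (at t within {a..b})) \<and>
        continuous_on {t\<in>{a..b}. \<gamma> t \<in> fst c} D)"

definition piecewise_C1_curve ::
  "('m::t2_space, 'd::finite) riemannian \<Rightarrow> (real \<Rightarrow> 'm) \<Rightarrow> bool" where
  "piecewise_C1_curve M \<gamma> \<longleftrightarrow>
     (\<exists>S. finite S \<and> {0, 1} \<subseteq> S \<and> S \<subseteq> {0..1} \<and>
        (\<forall>a\<in>S. \<forall>b\<in>S. a < b \<and> S \<inter> {a<..<b} = {} \<longrightarrow> C1_curve M a b \<gamma>))"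

text \<open>At the finitely many corners the integrand is an unspecified number, which does not affect
  the integral.\<close>

definition curve_length :: "('m::t2_space, 'd::finite) riemannian \<Rightarrow> (real \<Rightarrow> 'm) \<Rightarrow> real" where
  "curve_length M \<gamma> =
     integral {0..1} (\<lambda>t. gnorm M (\<gamma> t)
       (vector_derivative (snd (chart_at M (\<gamma> t)) \<circ> \<gamma>) (at t within {0..1})))"

text \<open>Meaningful for points in the same connected component (otherwise it is an infimum over
  the empty set).\<close>

definition rdist :: "('m::t2_space, 'd::finite) riemannian \<Rightarrow> 'm \<Rightarrow> 'm \<Rightarrow> real" where
  "rdist M x y = Inf {curve_length M \<gamma> | \<gamma>. piecewise_C1_curve M \<gamma> \<and> \<gamma> 0 = x \<and> \<gamma> 1 = y}"

definition geodesic :: "('m::t2_space, 'd::finite) riemannian \<Rightarrow> (real \<Rightarrow> 'm) \<Rightarrow> bool" where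
  "geodesic M \<gamma> \<longleftrightarrow>
     (\<exists>V. \<forall>t\<in>{0..1}. has_velocity M {0..1} \<gamma> t (V t) \<and>
        has_covariant_derivative M {0..1} \<gamma> V t 0)"

definition minimizing_geodesic ::
  "('m::t2_space, 'd::finite) riemannian \<Rightarrow> (real \<Rightarrow> 'm) \<Rightarrow> 'm \<Rightarrow> 'm \<Rightarrow> bool" where
  "minimizing_geodesic M \<gamma> x y \<longleftrightarrow>
     geodesic M \<gamma> \<and> \<gamma> 0 = x \<and> \<gamma> 1 = y \<and> curve_length M \<gamma> = rdist M x y"

definition strongly_convex :: "('m::t2_space, 'd::finite) riemannian \<Rightarrow> 'm set \<Rightarrow> bool" where
  "strongly_convex M U \<longleftrightarrow>
     (\<forall>x\<in>U. \<forall>y\<in>U. \<exists>\<gamma>. minimizing_geodesic M \<gamma> x y \<and> \<gamma> ` {0..1} \<subseteq> U \<and>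
        (\<forall>\<gamma>'. minimizing_geodesic M \<gamma>' x y \<longrightarrow> (\<forall>s\<in>{0..1}. \<gamma>' s = \<gamma> s)))"

text \<open>The manifold need not be complete, so the exponential map is only defined on
  \<open>{\<xi>. Exp_defined M x \<xi>}\<close>. The objects selected in \<open>Exp\<close> and \<open>parallel_transport_along\<close> are unique
  (uniqueness for ordinary differential equations); the one selected in \<open>Log\<close> is unique for
  points of a strongly convex set.\<close>

definition geodesic_from ::
  "('m::t2_space, 'd::finite) riemannian \<Rightarrow> 'm \<Rightarrow> real^'d \<Rightarrow> (real \<Rightarrow> 'm) \<Rightarrow> bool" where
  "geodesic_from M x \<xi> \<gamma> \<longleftrightarrow> geodesic M \<gamma> \<and> \<gamma> 0 = x \<and> has_velocity M {0..1} \<gamma> 0 \<xi>"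

definition Exp_defined :: "('m::t2_space, 'd::finite) riemannian \<Rightarrow> 'm \<Rightarrow> real^'d \<Rightarrow> bool" where
  "Exp_defined M x \<xi> \<longleftrightarrow> (\<exists>\<gamma>. geodesic_from M x \<xi> \<gamma>)"

definition Exp :: "('m::t2_space, 'd::finite) riemannian \<Rightarrow> 'm \<Rightarrow> real^'d \<Rightarrow> 'm" where
  "Exp M x \<xi> = (SOME y. \<exists>\<gamma>. geodesic_from M x \<xi> \<gamma> \<and> \<gamma> 1 = y)"

definition Log :: "('m::t2_space, 'd::finite) riemannian \<Rightarrow> 'm \<Rightarrow> 'm \<Rightarrow> real^'d" where
  "Log M x q = (SOME \<xi>. \<exists>\<gamma>. minimizing_geodesic M \<gamma> x q \<and> has_velocity M {0..1} \<gamma> 0 \<xi>)"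

definition parallel_transport_along ::
  "('m::t2_space, 'd::finite) riemannian \<Rightarrow> (real \<Rightarrow> 'm) \<Rightarrow> real^'d \<Rightarrow> real^'d" where
  "parallel_transport_along M \<gamma> \<xi> =
     (SOME \<eta>. \<exists>V. V 0 = \<xi> \<and> V 1 = \<eta> \<and>
        (\<forall>s\<in>{0..1}. has_covariant_derivative M {0..1} \<gamma> V s 0))"

definition parallel_transport ::
  "('m::t2_space, 'd::finite) riemannian \<Rightarrow> 'm \<Rightarrow> 'm \<Rightarrow> real^'d \<Rightarrow> real^'d" where
  "parallel_transport M x y = parallel_transport_along M (\<lambda>s. Exp M x (s *\<^sub>R Log M x y))"

text \<open>Smoothness of \<open>dist\<^sup>2\<close> and of \<open>(x, q) \<mapsto> Log\<^sub>x(q)\<close> near the points of \<open>U \<times> U\<close>, in all pairs of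
  charts. For compact \<open>U\<close>, neighbourhoods of the form \<open>W \<times> W\<close> are no restriction.\<close>

definition Log_dist_smooth :: "('m::t2_space, 'd::finite) riemannian \<Rightarrow> 'm set \<Rightarrow> bool" where
  "Log_dist_smooth M U \<longleftrightarrow>
     (\<exists>W. open W \<and> U \<subseteq> W \<and>
        (\<forall>c\<in>atlas M. \<forall>c'\<in>atlas M.
           let D = (snd c ` (fst c \<inter> W)) \<times> (snd c' ` (fst c' \<inter> W))
           in smooth_on D (\<lambda>(y, z). (rdist M (chart_inv c y) (chart_inv c' z))\<^sup>2) \<and>
              smooth_on D (\<lambda>(y, z).
                tcoord M c (chart_inv c y) (Log M (chart_inv c y) (chart_inv c' z)))))"

section \<open>Finite-horizon LQR for the double integrator on \<open>\<real>\<^sup>d\<close>\<close>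

definition vstack :: "'a^'d \<Rightarrow> 'a^'d \<Rightarrow> 'a^('d + 'd)" where
  "vstack a b = (\<chi> i. case i of Inl l \<Rightarrow> a $ l | Inr l \<Rightarrow> b $ l)"

definition block :: "real^'d^'d \<Rightarrow> real^'d^'d \<Rightarrow> real^'d^'d \<Rightarrow> real^'d^'d \<Rightarrow> real^('d + 'd)^('d + 'd)"
  where
  "block A B C D =
     (\<chi> i. case i of Inl l \<Rightarrow> vstack (A $ l) (B $ l) | Inr l \<Rightarrow> vstack (C $ l) (D $ l))"

definition A_d :: "real \<Rightarrow> real^('d::finite + 'd)^('d + 'd)" where
  "A_d \<Delta>t = block (mat 1) (\<Delta>t *\<^sub>R mat 1) 0 (mat 1)"

definition B_d :: "real \<Rightarrow> real^('d::finite)^('d + 'd)" where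
  "B_d \<Delta>t = vstack ((\<Delta>t\<^sup>2 / 2) *\<^sub>R mat 1) (\<Delta>t *\<^sub>R mat 1)"

definition Q_bar :: "real \<Rightarrow> real \<Rightarrow> real^('d::finite + 'd)^('d + 'd)" where
  "Q_bar \<Delta>t \<alpha> = \<Delta>t *\<^sub>R block (\<alpha> *\<^sub>R mat 1) 0 0 0"

definition R_bar :: "real \<Rightarrow> real^('d::finite)^'d" where
  "R_bar \<Delta>t = \<Delta>t *\<^sub>R mat 1"

definition P_final :: "real \<Rightarrow> real \<Rightarrow> real^('d::finite + 'd)^('d + 'd)" where
  "P_final \<alpha> w\<^sub>f = block ((w\<^sub>f * \<alpha>) *\<^sub>R mat 1) 0 0 0"

definition lqr_S :: "real \<Rightarrow> real^('d::finite + 'd)^('d + 'd) \<Rightarrow> real^'d^'d" where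
  "lqr_S \<Delta>t P = R_bar \<Delta>t + transpose (B_d \<Delta>t) ** P ** B_d \<Delta>t"

definition riccati ::
  "real \<Rightarrow> real \<Rightarrow> real^('d::finite + 'd)^('d + 'd) \<Rightarrow> real^('d + 'd)^('d + 'd)" where
  "riccati \<Delta>t \<alpha> P =
     Q_bar \<Delta>t \<alpha> + transpose (A_d \<Delta>t) ** P ** A_d \<Delta>t
     - transpose (A_d \<Delta>t) ** P ** B_d \<Delta>t ** matrix_inv (lqr_S \<Delta>t P)
         ** transpose (B_d \<Delta>t) ** P ** A_d \<Delta>t"

text \<open>\<open>P\<^sub>m\<close> arises from \<open>P\<^sub>T\<close> by \<open>T - m\<close> backward Riccati steps.\<close>

definition lqr_P ::
  "real \<Rightarrow> real \<Rightarrow> real \<Rightarrow> nat \<Rightarrow> nat \<Rightarrow> real^('d::finite + 'd)^('d + 'd)" where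
  "lqr_P \<Delta>t \<alpha> w\<^sub>f T m = (riccati \<Delta>t \<alpha> ^^ (T - m)) (P_final \<alpha> w\<^sub>f)"

definition lqr_K :: "real \<Rightarrow> real \<Rightarrow> real \<Rightarrow> nat \<Rightarrow> nat \<Rightarrow> real^('d::finite + 'd)^'d" where
  "lqr_K \<Delta>t \<alpha> w\<^sub>f T m =
     (let P = lqr_P \<Delta>t \<alpha> w\<^sub>f T (Suc m)
      in matrix_inv (lqr_S \<Delta>t P) ** transpose (B_d \<Delta>t) ** P ** A_d \<Delta>t)"

section \<open>The tangent-space LQR scheme\<close>

definition orthonormal_frame ::
  "('m, 'd::finite) riemannian \<Rightarrow> 'm \<Rightarrow> ('d \<Rightarrow> real^'d) \<Rightarrow> bool" where
  "orthonormal_frame M x e \<longleftrightarrow> (\<forall>i j. ginner M x (e i) (e j) = (if i = j then 1 else 0))"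

definition frame_coords ::
  "('m, 'd::finite) riemannian \<Rightarrow> 'm \<Rightarrow> ('d \<Rightarrow> real^'d) \<Rightarrow> real^'d \<Rightarrow> real^'d" where
  "frame_coords M x e \<xi> = (\<chi> i. ginner M x \<xi> (e i))"

definition frame_vec :: "('d::finite \<Rightarrow> real^'d) \<Rightarrow> real^'d \<Rightarrow> real^'d" where
  "frame_vec e a = (\<Sum>i\<in>UNIV. (a $ i) *\<^sub>R e i)"

definition eta_lin ::
  "('m::t2_space, 'd::finite) riemannian \<Rightarrow> nat \<Rightarrow> (nat \<Rightarrow> 'm) \<Rightarrow> (nat \<Rightarrow> real) \<Rightarrow> 'm \<Rightarrow> real^'d" where
  "eta_lin M n q \<pi> x = (1 / (\<Sum>j<n. \<pi> j)) *\<^sub>R (\<Sum>j<n. \<pi> j *\<^sub>R Log M x (q j))"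

definition lqr_control ::
  "('m::t2_space, 'd::finite) riemannian \<Rightarrow> real \<Rightarrow> nat \<Rightarrow> real \<Rightarrow>
   nat \<Rightarrow> (nat \<Rightarrow> 'm) \<Rightarrow> (nat \<Rightarrow> real) \<Rightarrow> ('d \<Rightarrow> real^'d) \<Rightarrow> 'm \<Rightarrow> real^'d \<Rightarrow> real^'d" where
  "lqr_control M \<Delta>t T w\<^sub>f n q \<pi> e x v =
     (let \<alpha> = (\<Sum>j<n. \<pi> j);
          y = vstack (- frame_coords M x e (eta_lin M n q \<pi> x)) (frame_coords M x e v)
      in frame_vec e (- (lqr_K \<Delta>t \<alpha> w\<^sub>f T 0 *v y)))"

text \<open>The motion \<open>X\<close> with velocity \<open>V\<close> is the closed-loop segment on \<open>[t, t + \<Delta>t]\<close> which starts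
  in \<open>(x, v)\<close>, driven by the parallel transport of the control \<open>u \<in> T\<^sub>xM\<close>.\<close>

definition closed_loop_segment ::
  "('m::t2_space, 'd::finite) riemannian \<Rightarrow> real \<Rightarrow> real \<Rightarrow> 'm \<Rightarrow> real^'d \<Rightarrow> real^'d \<Rightarrow>
   (real \<Rightarrow> 'm) \<Rightarrow> (real \<Rightarrow> real^'d) \<Rightarrow> bool" where
  "closed_loop_segment M \<Delta>t t x v u X V \<longleftrightarrow>
     X t = x \<and> V t = v \<and>
     (\<forall>s\<in>{t..t + \<Delta>t}.
        has_velocity M {t..t + \<Delta>t} X s (V s) \<and>
        has_covariant_derivative M {t..t + \<Delta>t} X V s (parallel_transport M x (X s) u))"

text \<open>\<open>N\<close> replanning steps \<open>k = 0, \<dots>, N - 1\<close> of the scheme, with states \<open>(x k, v k)\<close> at the times \<open>t k\<close>,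
  controls \<open>u k\<close> and closed-loop segments \<open>(X k, V k)\<close>. At step \<open>k\<close> there are \<open>n k\<close> target samples
  \<open>q k j\<close> with weights \<open>\<pi> k j\<close>, \<open>j < n k\<close>, and \<open>e k\<close> is the orthonormal basis of the tangent space at
  \<open>x k\<close>.\<close>

definition tangent_lqr_run ::
  "('m::t2_space, 'd::finite) riemannian \<Rightarrow> real \<Rightarrow> nat \<Rightarrow> real \<Rightarrow> nat \<Rightarrow>
   (nat \<Rightarrow> nat) \<Rightarrow> (nat \<Rightarrow> nat \<Rightarrow> 'm) \<Rightarrow> (nat \<Rightarrow> nat \<Rightarrow> real) \<Rightarrow> (nat \<Rightarrow> 'd \<Rightarrow> real^'d) \<Rightarrow>
   (nat \<Rightarrow> real) \<Rightarrow> (nat \<Rightarrow> 'm) \<Rightarrow> (nat \<Rightarrow> real^'d) \<Rightarrow> (nat \<Rightarrow> real^'d) \<Rightarrow>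
   (nat \<Rightarrow> real \<Rightarrow> 'm) \<Rightarrow> (nat \<Rightarrow> real \<Rightarrow> real^'d) \<Rightarrow> bool" where
  "tangent_lqr_run M \<Delta>t T w\<^sub>f N n q \<pi> e t x v u X V \<longleftrightarrow>
     \<Delta>t > 0 \<and> T \<ge> 1 \<and> w\<^sub>f \<ge> 0 \<and>
     (\<forall>k<N.
        n k \<ge> 1 \<and> (\<forall>j<n k. \<pi> k j \<ge> 0) \<and> (\<Sum>j<n k. \<pi> k j) > 0 \<and>
        orthonormal_frame M (x k) (e k) \<and>
        u k = lqr_control M \<Delta>t T w\<^sub>f (n k) (q k) (\<pi> k) (e k) (x k) (v k) \<and>
        closed_loop_segment M \<Delta>t (t k) (x k) (v k) (u k) (X k) (V k) \<and>
        t (Suc k) = t k + \<Delta>t \<and>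
        (let w = \<Delta>t *\<^sub>R v k + (\<Delta>t\<^sup>2 / 2) *\<^sub>R u k
         in Exp_defined M (x k) w \<and> x (Suc k) = Exp M (x k) w) \<and>
        v (Suc k) = parallel_transport M (x k) (x (Suc k)) (v k + \<Delta>t *\<^sub>R u k))"

definition run_in ::
  "'m set \<Rightarrow> real \<Rightarrow> nat \<Rightarrow> (nat \<Rightarrow> nat) \<Rightarrow> (nat \<Rightarrow> nat \<Rightarrow> 'm) \<Rightarrow> (nat \<Rightarrow> real) \<Rightarrow> (nat \<Rightarrow> 'm) \<Rightarrow>
   (nat \<Rightarrow> real \<Rightarrow> 'm) \<Rightarrow> bool" where
  "run_in U \<Delta>t N n q t x X \<longleftrightarrow>
     (\<forall>k<N. x k \<in> U \<and> x (Suc k) \<in> U \<and> (\<forall>s\<in>{t k..t k + \<Delta>t}. X k s \<in> U) \<and>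
        (\<forall>j<n k. q k j \<in> U))"

end

theory Submission
  imports Defs
begin

text \<open>Let \<open>F(y, z) = dist(y, z)\<^sup>2\<close>, which is smooth near the points of \<open>U \<times> U\<close>. For \<open>x, q \<in> U\<close> put
  \<open>r = Log\<^sub>x(q)\<close>. Going along the minimizing geodesic shows that the differential of
  \<open>dist(-, q)\<^sup>2 / 2\<close> at \<open>x\<close> is at most \<open>-|r|\<^sup>2\<close> on \<open>r\<close>; going along a chart segment and then along that
  geodesic shows that it has norm at most \<open>|r|\<close>. Hence it is \<open>-\<langle>r, -\<rangle>\<close>. Geodesics with small initial
  velocity \<open>w\<close> stay in a chart, so the geodesic equation and bounds for \<open>F\<close> and for the metric on compact sets
  give, uniformly in \<open>x, q \<in> U\<close>, the estimate
  \<open>dist(Exp\<^sub>x w, q)\<^sup>2 \<le> dist(x, q)\<^sup>2 - 2 \<langle>r, w\<rangle> + K |w|\<^sup>2\<close>. As the geodesic may leave \<open>U\<close>,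
  \<open>K\<close> is taken from the compactness of \<open>U \<times> U\<close>. For \<open>w = \<Delta>t v + \<Delta>t\<^sup>2 u / 2\<close> the term
  \<open>\<Delta>t \<langle>r, v\<rangle> \<ge> c\<^sub>1 \<Delta>t |r|\<^sup>2 - \<dots>\<close> dominates, since the local bounds at the initial time give
  \<open>|v|, |u| = O(|r|)\<close>.\<close>

section \<open>Smooth maps\<close>

text \<open>The definitions attach a preferred chart to every point, so a moving curve is described
  in a chart that changes with time, whereas a Taylor estimate needs one fixed chart. The bridge is
  the transformation law of the Christoffel symbols, which is derived from the invariance of the
  metric through the Koszul formula. The differential of the squared distance is found by comparison
  with explicit curves: tails of the geodesic, and a coordinate segment joined to it.
  \<open>Exp\<close>, \<open>Log\<close> and parallel transport are values of a choice operator, so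
  the estimates are stated for every geodesic with the given initial data and hold for the selected
  one. The bound on the control concerns transported vectors; at the initial time the transport goes
  from \<open>x k\<close> to itself, hence the lemmas on \<open>Log M x x\<close> and
  \<open>Exp M x 0\<close>. Of the gain \<open>c\<^sub>1\<close>, one quarter pays for the cubic
  alignment error and one quarter for the terms of second order in the step, which leaves
  \<open>C\<^sub>7 = c\<^sub>1 / 2\<close>.\<close>

lemma smooth_on_derivative:
  assumes "smooth_on S f" "y \<in> S"
  shows "(f has_derivative frechet_derivative f (at y)) (at y)"
proof -
  have "Ck_on (Suc 0) S f" using assms(1) unfolding smooth_on_def by blast
  then show ?thesis using assms(2) frechet_derivative_works by auto
qed

lemma smooth_on_frechet:
  assumes "smooth_on S f"
  shows "smooth_on S (\<lambda>y. frechet_derivative f (at y) h)"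
  using assms unfolding smooth_on_def by (metis Ck_on.simps(2))

lemma smooth_on_continuous: "smooth_on S f \<Longrightarrow> continuous_on S f"
  unfolding smooth_on_def by (metis Ck_on.simps(1))

text \<open>The second differential, taken along \<open>h\<close> and then along \<open>k\<close>.
  \<open>Ck_on\<close> speaks of derivatives in fixed directions only, so linearity in
  \<open>h\<close> and symmetry have to be proved.\<close>

definition D2 :: "('a::euclidean_space \<Rightarrow> 'b::real_normed_vector) \<Rightarrow> 'a \<Rightarrow> 'a \<Rightarrow> 'a \<Rightarrow> 'b" where
  "D2 f y h k = frechet_derivative (\<lambda>z. frechet_derivative f (at z) h) (at y) k"

lemma smooth_on_D2:
  assumes "smooth_on S f" "y \<in> S"
  shows "((\<lambda>z. frechet_derivative f (at z) h) has_derivative D2 f y h) (at y)"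
  unfolding D2_def using smooth_on_derivative[OF smooth_on_frechet[OF assms(1)] assms(2)] .

text \<open>Smoothness is a statement about fixed directions. Expanding over the finite basis is how
  it is used for moving directions and for bounds uniform in the direction.\<close>

lemma frechet_basis_expansion:
  fixes f :: "'a::euclidean_space \<Rightarrow> 'b::real_normed_vector"
  assumes "smooth_on S f" "y \<in> S"
  shows "frechet_derivative f (at y) h = (\<Sum>b\<in>Basis. (h \<bullet> b) *\<^sub>R frechet_derivative f (at y) b)"
proof -
  interpret linear "frechet_derivative f (at y)"
    using smooth_on_derivative[OF assms] has_derivative_linear by blast
  show ?thesis
    by (subst euclidean_representation[of h, symmetric]) (simp add: sum scale)
qed

text \<open>Obtained by differentiating the basis expansion of the first derivative, which holds on
  the whole open set \<open>S\<close> and not only at \<open>y\<close>.\<close>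

lemma D2_basis_expansion:
  fixes f :: "'a::euclidean_space \<Rightarrow> 'b::real_normed_vector"
  assumes "smooth_on S f" "open S" "y \<in> S"
  shows "D2 f y h k = (\<Sum>b\<in>Basis. (h \<bullet> b) *\<^sub>R D2 f y b k)"
proof -
  have "((\<lambda>z. \<Sum>b\<in>Basis. (h \<bullet> b) *\<^sub>R frechet_derivative f (at z) b)
      has_derivative (\<lambda>k. \<Sum>b\<in>Basis. (h \<bullet> b) *\<^sub>R D2 f y b k)) (at y)"
    by (intro has_derivative_sum has_derivative_scaleR_right smooth_on_D2[OF assms(1,3)])
  then have "((\<lambda>z. frechet_derivative f (at z) h)
      has_derivative (\<lambda>k. \<Sum>b\<in>Basis. (h \<bullet> b) *\<^sub>R D2 f y b k)) (at y)"
    by (rule has_derivative_transform_within_open[OF _ assms(2,3)])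
       (simp add: frechet_basis_expansion[OF assms(1), symmetric])
  from has_derivative_unique[OF this smooth_on_D2[OF assms(1,3)]] show ?thesis
    by (simp add: fun_eq_iff)
qed

text \<open>Product rule for a differential at a moving point in a moving direction. With a chart
  change as \<open>f\<close> it transforms covariant derivatives; with the squared distance it gives
  the second derivative along a geodesic.\<close>

lemma has_vector_derivative_frechet:
  fixes f :: "'a::euclidean_space \<Rightarrow> 'b::real_normed_vector"
  assumes f: "smooth_on S f" "open S" and y: "\<sigma> t \<in> S"
    and \<sigma>: "(\<sigma> has_vector_derivative a) (at t within I)"
    and W: "(W has_vector_derivative D) (at t within I)" and tI: "t \<in> I"
  shows "((\<lambda>s. frechet_derivative f (at (\<sigma> s)) (W s)) has_vector_derivative
           (D2 f (\<sigma> t) (W t) a + frechet_derivative f (at (\<sigma> t)) D)) (at t within I)"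
proof -
  have c: "(\<sigma> \<longlongrightarrow> \<sigma> t) (at t within I)"
    using has_vector_derivative_continuous[OF \<sigma>] by (simp add: continuous_within)
  have ev: "\<forall>\<^sub>F s in at t within I. \<sigma> s \<in> S"
    using topological_tendstoD[OF c f(2) y] .
  have d: "((\<lambda>s. frechet_derivative f (at (\<sigma> s)) b) has_vector_derivative D2 f (\<sigma> t) b a)
      (at t within I)" for b
    using vector_derivative_diff_chain_within
      [OF \<sigma>, of "\<lambda>z. frechet_derivative f (at z) b" "D2 f (\<sigma> t) b"]
      smooth_on_D2[OF f(1) y, of b] has_derivative_at_withinI by (fastforce simp: o_def)
  have i: "((\<lambda>s. W s \<bullet> b) has_vector_derivative (D \<bullet> b)) (at t within I)" for b
    by (rule bounded_linear.has_vector_derivative[OF bounded_linear_inner_left W])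
  have "((\<lambda>s. \<Sum>b\<in>Basis. (W s \<bullet> b) *\<^sub>R frechet_derivative f (at (\<sigma> s)) b) has_vector_derivative
      (\<Sum>b\<in>Basis. (W t \<bullet> b) *\<^sub>R D2 f (\<sigma> t) b a + (D \<bullet> b) *\<^sub>R frechet_derivative f (at (\<sigma> t)) b))
      (at t within I)"
    using i d by (intro has_vector_derivative_sum has_vector_derivative_scaleR)
        (auto simp: has_real_derivative_iff_has_vector_derivative)
  moreover have "(\<Sum>b\<in>Basis. (W t \<bullet> b) *\<^sub>R D2 f (\<sigma> t) b a + (D \<bullet> b) *\<^sub>R frechet_derivative f (at (\<sigma> t)) b)
     = D2 f (\<sigma> t) (W t) a + frechet_derivative f (at (\<sigma> t)) D"
    by (simp add: sum.distrib D2_basis_expansion[OF f y, of "W t"]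
        frechet_basis_expansion[OF f(1) y, of D])
  ultimately have *: "((\<lambda>s. \<Sum>b\<in>Basis. (W s \<bullet> b) *\<^sub>R frechet_derivative f (at (\<sigma> s)) b)
      has_vector_derivative (D2 f (\<sigma> t) (W t) a + frechet_derivative f (at (\<sigma> t)) D)) (at t within I)"
    by simp
  have ev2: "\<forall>\<^sub>F s in at t within I. (\<Sum>b\<in>Basis. (W s \<bullet> b) *\<^sub>R frechet_derivative f (at (\<sigma> s)) b)
      = frechet_derivative f (at (\<sigma> s)) (W s)"
    using ev by eventually_elim (simp add: frechet_basis_expansion[OF f(1), symmetric])
  show ?thesis
    using * unfolding has_vector_derivative_def
    by (rule has_derivative_transform_eventually[OF _ ev2])
       (auto simp: frechet_basis_expansion[OF f(1) y, symmetric] tI)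
qed

text \<open>The finitely many maps belonging to basis directions are continuous, hence bounded on
  \<open>C\<close>; the basis expansions make these bounds homogeneous in the directions.\<close>

lemma smooth_on_bound_compact:
  fixes f :: "'a::euclidean_space \<Rightarrow> 'b::real_normed_vector"
  assumes f: "smooth_on S f" "open S" and C: "compact C" "C \<subseteq> S"
  obtains K where "K \<ge> 0"
    "\<And>y h. y \<in> C \<Longrightarrow> norm (frechet_derivative f (at y) h) \<le> K * norm h"
    "\<And>y h k. y \<in> C \<Longrightarrow> norm (D2 f y h k) \<le> K * norm h * norm k"
proof -
  have bd: "\<exists>B. \<forall>y\<in>C. norm (g y) \<le> B" if "smooth_on S g" for g :: "'a \<Rightarrow> 'b"
  proof -
    have "compact (g ` C)"
      using smooth_on_continuous[OF that] C by (meson compact_continuous_image continuous_on_subset)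
    then show ?thesis by (meson bounded_iff compact_imp_bounded imageI)
  qed
  have "\<forall>b. \<exists>B. \<forall>y\<in>C. norm (frechet_derivative f (at y) b) \<le> B"
    using bd[OF smooth_on_frechet[OF f(1)]] by blast
  then obtain B1 where B1: "\<And>b y. y \<in> C \<Longrightarrow> norm (frechet_derivative f (at y) b) \<le> B1 b"
    by metis
  have "\<forall>b b'. \<exists>B. \<forall>y\<in>C. norm (D2 f y b b') \<le> B"
    using bd[OF smooth_on_frechet[OF smooth_on_frechet[OF f(1)]]] unfolding D2_def by blast
  then obtain B2 where B2: "\<And>b b' y. y \<in> C \<Longrightarrow> norm (D2 f y b b') \<le> B2 b b'"
    by metis
  \<comment> \<open>Adding all bounds gives one constant for both orders of differentiation.\<close>
  define K where "K = (\<Sum>b\<in>Basis. \<bar>B1 b\<bar>) + (\<Sum>b\<in>Basis. \<Sum>b'\<in>Basis. \<bar>B2 b b'\<bar>)"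
  have K0: "K \<ge> 0" unfolding K_def by (intro add_nonneg_nonneg sum_nonneg) auto
  have K1: "norm (frechet_derivative f (at y) h) \<le> K * norm h" if "y \<in> C" for y h
  proof -
    have "norm (frechet_derivative f (at y) h) \<le>
        (\<Sum>b\<in>Basis. norm ((h \<bullet> b) *\<^sub>R frechet_derivative f (at y) b))"
      using frechet_basis_expansion[OF f(1), of y h] that C by (metis norm_sum subsetD)
    also have "\<dots> \<le> (\<Sum>b\<in>Basis. norm h * \<bar>B1 b\<bar>)"
      using B1[OF that] by (intro sum_mono) (auto intro!: mult_mono simp: Basis_le_norm intro: order_trans[OF _ abs_ge_self])
    also have "\<dots> = (\<Sum>b\<in>Basis. \<bar>B1 b\<bar>) * norm h" by (simp add: sum_distrib_left mult.commute)
    also have "\<dots> \<le> K * norm h" unfolding K_def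
      by (intro mult_right_mono) (auto intro!: sum_nonneg)
    finally show ?thesis .
  qed
  have K2: "norm (D2 f y h k) \<le> K * norm h * norm k" if y: "y \<in> C" for y h k
  proof -
    have yS: "y \<in> S" using y C by auto
    have e: "D2 f y h k = (\<Sum>b\<in>Basis. \<Sum>b'\<in>Basis. (h \<bullet> b) *\<^sub>R (k \<bullet> b') *\<^sub>R D2 f y b b')"
      by (subst D2_basis_expansion[OF f yS])
         (simp add: D2_def frechet_basis_expansion[OF smooth_on_frechet[OF f(1)] yS, of _ k] scaleR_sum_right)
    have "norm (D2 f y h k) \<le> (\<Sum>b\<in>Basis. \<Sum>b'\<in>Basis. norm ((h \<bullet> b) *\<^sub>R (k \<bullet> b') *\<^sub>R D2 f y b b'))"
      unfolding e by (intro order_trans[OF norm_sum] sum_mono norm_sum)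
    also have "\<dots> \<le> (\<Sum>b\<in>Basis. \<Sum>b'\<in>(Basis::'a set). norm h * (norm k * \<bar>B2 b b'\<bar>))"
      unfolding norm_scaleR using B2[OF y]
      by (intro sum_mono mult_mono) (auto simp: Basis_le_norm intro: order_trans[OF _ abs_ge_self])
    also have "\<dots> = (\<Sum>b\<in>Basis. \<Sum>b'\<in>(Basis::'a set). \<bar>B2 b b'\<bar>) * norm h * norm k"
      by (simp add: sum_distrib_left sum_distrib_right mult_ac)
    also have "\<dots> \<le> K * norm h * norm k" unfolding K_def
      by (intro mult_right_mono) (auto intro!: sum_nonneg)
    finally show ?thesis .
  qed
  show ?thesis using that K0 K1 K2 by blast
qed

section \<open>Symmetry of second derivatives\<close>

text \<open>The mixed second difference over the parallelogram with sides \<open>s h\<close> and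
  \<open>s k\<close>. The mean value theorem along \<open>h\<close> trades it for a difference of
  derivatives in the direction \<open>h\<close>, and then differentiability of
  \<open>\<lambda>z. f' z h\<close> at the single point \<open>y\<close> is enough.\<close>

lemma second_difference_estimate:
  fixes f :: "'a::real_normed_vector \<Rightarrow> real"
  assumes S: "open S" "y \<in> S"
    and f: "\<And>z. z \<in> S \<Longrightarrow> (f has_derivative f' z) (at z)"
    and H: "((\<lambda>z. f' z h) has_derivative H) (at y)" and e: "e > 0"
  shows "\<forall>\<^sub>F s in at_right 0.
    \<bar>f (y + s *\<^sub>R h + s *\<^sub>R k) - f (y + s *\<^sub>R h) - f (y + s *\<^sub>R k) + f y - s\<^sup>2 * H k\<bar> \<le> e * s\<^sup>2"
proof -
  \<comment> \<open>Two remainders of relative size \<open>e / N\<close> at distance at most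
    \<open>s * (norm h + norm k)\<close> add up to at most \<open>e * s\<close>; the 1 keeps
    \<open>N\<close> positive.\<close>
  define N where "N = 2 * (norm h + norm k) + 1"
  have N: "N > 0" unfolding N_def by (simp add: add_nonneg_pos)
  obtain d where d: "d > 0" and dH: "\<And>z. norm (z - y) < d \<Longrightarrow>
      \<bar>f' z h - f' y h - H (z - y)\<bar> \<le> e / N * norm (z - y)"
    using H e N unfolding has_derivative_at_alt
    by (metis divide_pos_pos real_norm_def)
  obtain d' where d': "d' > 0" "ball y d' \<subseteq> S" using S open_contains_ball by blast
  have linH: "linear H" using H has_derivative_linear by blast
  have "\<forall>\<^sub>F s in at_right 0. 0 < s \<and> s < min d d' / N"
    using d d' N by (auto simp: eventually_at_right_field intro!: exI[of _ "min d d' / N"])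
  then show ?thesis
  proof eventually_elim
    case (elim s)
    then have s: "s > 0" "s * N < d" "s * N < d'"
      using N by (auto simp: pos_less_divide_eq)
    define \<phi> where "\<phi> \<tau> = f (y + \<tau> *\<^sub>R h + s *\<^sub>R k) - f (y + \<tau> *\<^sub>R h)" for \<tau>
    have small: "norm (\<tau> *\<^sub>R h + \<mu> *\<^sub>R k) \<le> s * (norm h + norm k)"
      if "0 \<le> \<tau>" "\<tau> \<le> s" "0 \<le> \<mu>" "\<mu> \<le> s" for \<tau> \<mu>
      using that by (intro order_trans[OF norm_triangle_ineq])
        (simp add: distrib_left add_mono mult_right_mono)
    have small': "norm (\<tau> *\<^sub>R h + \<mu> *\<^sub>R k) < min d d'"
      if "0 \<le> \<tau>" "\<tau> \<le> s" "0 \<le> \<mu>" "\<mu> \<le> s" for \<tau> \<mu>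
    proof -
      have "s * (norm h + norm k) < s * N" using s(1) unfolding N_def
        by (intro mult_strict_left_mono) (auto simp: add_nonneg_pos)
      then show ?thesis using small[OF that] s by linarith
    qed
    have inS: "y + \<tau> *\<^sub>R h + \<mu> *\<^sub>R k \<in> S"
      if "0 \<le> \<tau>" "\<tau> \<le> s" "0 \<le> \<mu>" "\<mu> \<le> s" for \<tau> \<mu>
    proof -
      have "y + (\<tau> *\<^sub>R h + \<mu> *\<^sub>R k) \<in> ball y d'"
        using small'[OF that] unfolding mem_ball dist_norm by (simp only: norm_minus_commute[of y])
          simp
      then show ?thesis using d'(2) by (auto simp: add.assoc)
    qed
    have der: "((\<lambda>\<tau>. f (y + \<tau> *\<^sub>R h + \<mu> *\<^sub>R k)) has_real_derivative f' (y + \<tau> *\<^sub>R h + \<mu> *\<^sub>R k) h) (at \<tau>)"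
      if "0 \<le> \<tau>" "\<tau> \<le> s" "0 \<le> \<mu>" "\<mu> \<le> s" for \<tau> \<mu>
    proof -
      have "((\<lambda>\<tau>. f (y + \<tau> *\<^sub>R h + \<mu> *\<^sub>R k)) has_derivative
          (\<lambda>x. f' (y + \<tau> *\<^sub>R h + \<mu> *\<^sub>R k) (x *\<^sub>R h))) (at \<tau>)"
        by (rule has_derivative_compose[of "\<lambda>\<tau>. y + \<tau> *\<^sub>R h + \<mu> *\<^sub>R k", OF _ f[OF inS[OF that]]])
           (auto intro!: derivative_eq_intros)
      moreover have "linear (f' (y + \<tau> *\<^sub>R h + \<mu> *\<^sub>R k))"
        using f[OF inS[OF that]] has_derivative_linear by blast
      ultimately show ?thesis
        by (simp add: has_field_derivative_def linear_cmul mult_commute_abs)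
    qed
    \<comment> \<open>\<open>\<phi> s - \<phi> 0\<close> is the second difference. The term
      \<open>0 *\<^sub>R k\<close> is kept so that both derivatives have the form of
      \<open>der\<close>.\<close>
    have "\<exists>\<theta>>0. \<theta> < s \<and> \<phi> s - \<phi> 0 =
        (s - 0) * (f' (y + \<theta> *\<^sub>R h + s *\<^sub>R k) h - f' (y + \<theta> *\<^sub>R h + 0 *\<^sub>R k) h)"
    proof (rule MVT2[OF s(1)])
      fix \<tau> assume "0 \<le> \<tau>" "\<tau> \<le> s"
      then show "DERIV \<phi> \<tau> :> f' (y + \<tau> *\<^sub>R h + s *\<^sub>R k) h - f' (y + \<tau> *\<^sub>R h + 0 *\<^sub>R k) h"
        unfolding \<phi>_def using der[of \<tau> s] der[of \<tau> 0] s(1)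
        by (auto intro!: derivative_eq_intros)
    qed
    then obtain \<theta> where \<theta>: "0 < \<theta>" "\<theta> < s"
      and eq: "\<phi> s - \<phi> 0 = s * (f' (y + \<theta> *\<^sub>R h + s *\<^sub>R k) h - f' (y + \<theta> *\<^sub>R h + 0 *\<^sub>R k) h)"
      by auto
    have b1: "\<bar>f' (y + \<theta> *\<^sub>R h + s *\<^sub>R k) h - f' y h - H (\<theta> *\<^sub>R h + s *\<^sub>R k)\<bar> \<le>
        e / N * (s * (norm h + norm k))"
    proof -
      have "\<bar>f' (y + \<theta> *\<^sub>R h + s *\<^sub>R k) h - f' y h - H (\<theta> *\<^sub>R h + s *\<^sub>R k)\<bar> \<le>
        e / N * norm (\<theta> *\<^sub>R h + s *\<^sub>R k)"
        using dH[of "y + \<theta> *\<^sub>R h + s *\<^sub>R k"] small'[of \<theta> s] \<theta> s by (simp add: add.assoc)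
      also have "\<dots> \<le> e / N * (s * (norm h + norm k))"
        using small[of \<theta> s] \<theta> s e N by (intro mult_left_mono) auto
      finally show ?thesis .
    qed
    have b2: "\<bar>f' (y + \<theta> *\<^sub>R h + 0 *\<^sub>R k) h - f' y h - H (\<theta> *\<^sub>R h)\<bar> \<le>
        e / N * (s * (norm h + norm k))"
    proof -
      have "\<bar>f' (y + \<theta> *\<^sub>R h + 0 *\<^sub>R k) h - f' y h - H (\<theta> *\<^sub>R h)\<bar> \<le> e / N * norm (\<theta> *\<^sub>R h + 0 *\<^sub>R k)"
        using dH[of "y + \<theta> *\<^sub>R h"] small'[of \<theta> 0] \<theta> s by (simp add: add.assoc)
      also have "\<dots> \<le> e / N * (s * (norm h + norm k))"
        using small[of \<theta> 0] \<theta> s e N by (intro mult_left_mono) auto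
      finally show ?thesis .
    qed
    have Hs: "H (\<theta> *\<^sub>R h + s *\<^sub>R k) = H (\<theta> *\<^sub>R h) + s * H k"
      using linH by (simp add: linear_add linear_cmul)
    have "\<bar>f' (y + \<theta> *\<^sub>R h + s *\<^sub>R k) h - f' (y + \<theta> *\<^sub>R h + 0 *\<^sub>R k) h - s * H k\<bar>
        \<le> 2 * (e / N * (s * (norm h + norm k)))"
      using b1 b2 Hs by linarith
    also have "\<dots> = e * s * ((2 * (norm h + norm k)) / N)" by simp
    also have "\<dots> \<le> e * s * 1"
      using e s N unfolding N_def by (intro mult_left_mono) (auto simp: add_nonneg_pos)
    finally have "s * \<bar>f' (y + \<theta> *\<^sub>R h + s *\<^sub>R k) h - f' (y + \<theta> *\<^sub>R h + 0 *\<^sub>R k) h - s * H k\<bar> \<le> s * (e * s)"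
      using s by simp
    moreover have "\<phi> s - \<phi> 0 - s\<^sup>2 * H k =
        s * (f' (y + \<theta> *\<^sub>R h + s *\<^sub>R k) h - f' (y + \<theta> *\<^sub>R h + 0 *\<^sub>R k) h - s * H k)"
      unfolding eq by (simp add: algebra_simps power2_eq_square)
    ultimately have "\<bar>\<phi> s - \<phi> 0 - s\<^sup>2 * H k\<bar> \<le> e * s\<^sup>2"
      using s by (simp only: abs_mult) (simp add: power2_eq_square mult_ac)
    then show ?case unfolding \<phi>_def by (simp add: algebra_simps)
  qed
qed

text \<open>The second difference is unchanged when \<open>h\<close> and \<open>k\<close> are
  exchanged, so after division by the square of \<open>s\<close> it tends to both values.\<close>

lemma symmetric_second_derivative_real:
  fixes f :: "'a::real_normed_vector \<Rightarrow> real"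
  assumes S: "open S" "y \<in> S"
    and f: "\<And>z. z \<in> S \<Longrightarrow> (f has_derivative f' z) (at z)"
    and H: "((\<lambda>z. f' z h) has_derivative H) (at y)"
    and K: "((\<lambda>z. f' z k) has_derivative K) (at y)"
  shows "H k = K h"
proof (rule ccontr)
  assume "H k \<noteq> K h"
  \<comment> \<open>A third of the gap: the two errors together account for at most two thirds of
    it.\<close>
  define e where "e = \<bar>H k - K h\<bar> / 3"
  have e: "e > 0" unfolding e_def using \<open>H k \<noteq> K h\<close> by simp
  have "\<forall>\<^sub>F s::real in at_right 0. 0 < s"
    by (simp add: eventually_at_right_less)
  moreover have "\<forall>\<^sub>F s in at_right 0.
      \<bar>f (y + s *\<^sub>R h + s *\<^sub>R k) - f (y + s *\<^sub>R h) - f (y + s *\<^sub>R k) + f y - s\<^sup>2 * H k\<bar> \<le> e * s\<^sup>2"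
    by (rule second_difference_estimate[where S = S and f' = f']) (use S f H e in auto)
  moreover have "\<forall>\<^sub>F s in at_right 0.
      \<bar>f (y + s *\<^sub>R k + s *\<^sub>R h) - f (y + s *\<^sub>R k) - f (y + s *\<^sub>R h) + f y - s\<^sup>2 * K h\<bar> \<le> e * s\<^sup>2"
    by (rule second_difference_estimate[where S = S and f' = f']) (use S f K e in auto)
  ultimately have "\<forall>\<^sub>F s::real in at_right 0. False"
  proof eventually_elim
    case (elim s)
    let ?X = "f (y + s *\<^sub>R h + s *\<^sub>R k) - f (y + s *\<^sub>R h) - f (y + s *\<^sub>R k) + f y"
    have sw: "f (y + s *\<^sub>R k + s *\<^sub>R h) = f (y + s *\<^sub>R h + s *\<^sub>R k)" by (simp add: add_ac)
    have "\<bar>?X - s\<^sup>2 * H k\<bar> \<le> e * s\<^sup>2" "\<bar>?X - s\<^sup>2 * K h\<bar> \<le> e * s\<^sup>2"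
      using elim(2,3) unfolding sw by linarith+
    then have "\<bar>s\<^sup>2 * H k - s\<^sup>2 * K h\<bar> \<le> 2 * e * s\<^sup>2" by linarith
    then have "s\<^sup>2 * \<bar>H k - K h\<bar> \<le> s\<^sup>2 * (2 * e)"
      unfolding right_diff_distrib[symmetric] abs_mult by (simp add: mult_ac)
    then have "\<bar>H k - K h\<bar> \<le> 2 * e" using elim(1) by simp
    moreover have "\<bar>H k - K h\<bar> = 3 * e" by (simp add: e_def)
    ultimately show ?case using e by simp
  qed
  then show False by simp
qed

text \<open>Reduced to real functions by inner products with basis vectors. For chart changes this
  symmetry yields the transformation law of the Christoffel symbols.\<close>

lemma D2_symmetric:
  fixes f :: "'a::euclidean_space \<Rightarrow> 'b::euclidean_space"
  assumes f: "smooth_on S f" "open S" "y \<in> S"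
  shows "D2 f y h k = D2 f y k h"
proof (rule euclidean_eqI)
  fix b :: 'b
  show "D2 f y h k \<bullet> b = D2 f y k h \<bullet> b"
    by (rule symmetric_second_derivative_real[OF f(2,3), of "\<lambda>z. f z \<bullet> b"
          "\<lambda>z h. frechet_derivative f (at z) h \<bullet> b"])
       (intro has_derivative_inner_left smooth_on_derivative[OF f(1)] smooth_on_D2[OF f(1,3)]; assumption)+
qed

section \<open>Charts, metric and Christoffel symbols\<close>

lemma bounded_bilinear_matrix_vector_mult:
  "bounded_bilinear ((*v) :: real^'a::finite^'b::finite \<Rightarrow> real^'a \<Rightarrow> real^'b)"
proof -
  have "bilinear ((*v) :: real^'a^'b \<Rightarrow> real^'a \<Rightarrow> real^'b)"
    unfolding bilinear_def
    by (auto intro!: linearI simp: matrix_vector_right_distrib matrix_vector_mult_add_rdistrib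
        scaleR_matrix_vector_assoc matrix_vector_mult_scaleR)
  then show ?thesis by (simp add: bilinear_conv_bounded_bilinear)
qed

lemma has_vector_derivative_chain:
  assumes "(\<sigma> has_vector_derivative a) (at t within I)" "(f has_derivative f') (at (\<sigma> t))"
  shows "((\<lambda>s. f (\<sigma> s)) has_vector_derivative f' a) (at t within I)"
  using vector_derivative_diff_chain_within[OF assms(1) has_derivative_at_withinI[OF assms(2)]]
  unfolding o_def .

lemma sum_rotate:
  "(\<Sum>j\<in>A. \<Sum>m\<in>B. \<Sum>i\<in>C. f i j m) = (\<Sum>i\<in>C. \<Sum>j\<in>A. \<Sum>m\<in>B. f i j m)"
proof -
  have "(\<Sum>j\<in>A. \<Sum>m\<in>B. \<Sum>i\<in>C. f i j m) = (\<Sum>j\<in>A. \<Sum>i\<in>C. \<Sum>m\<in>B. f i j m)"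
    by (rule sum.cong[OF refl], rule sum.swap)
  also have "\<dots> = (\<Sum>i\<in>C. \<Sum>j\<in>A. \<Sum>m\<in>B. f i j m)" by (rule sum.swap)
  finally show ?thesis .
qed

locale riemann_mfd =
  fixes M :: "('m::{t2_space,second_countable_topology}, 'd::finite) riemannian"
  assumes manifold: "riemannian_manifold M"
begin

text \<open>The metric, its derivative (\<open>DG\<close>, along the first vector) and the
  Christoffel symbols (\<open>Chr\<close>) as multilinear maps in the coordinates of a chart, which
  keeps most calculations free of indices.\<close>

definition G :: "('m, 'd) chart \<Rightarrow> real^'d \<Rightarrow> real^'d \<Rightarrow> real^'d \<Rightarrow> real" where
  "G c y \<xi> \<eta> = \<xi> \<bullet> (metric M c y *v \<eta>)"

definition DG :: "('m, 'd) chart \<Rightarrow> real^'d \<Rightarrow> real^'d \<Rightarrow> real^'d \<Rightarrow> real^'d \<Rightarrow> real" where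
  "DG c y \<zeta> \<xi> \<eta> = \<xi> \<bullet> (frechet_derivative (metric M c) (at y) \<zeta> *v \<eta>)"

definition Chr :: "('m, 'd) chart \<Rightarrow> real^'d \<Rightarrow> real^'d \<Rightarrow> real^'d \<Rightarrow> real^'d" where
  "Chr c y \<xi> \<eta> = (\<chi> l. \<Sum>i\<in>UNIV. \<Sum>j\<in>UNIV. christoffel M c l i j y * \<xi> $ i * \<eta> $ j)"

abbreviation trans :: "('m, 'd) chart \<Rightarrow> ('m, 'd) chart \<Rightarrow> real^'d \<Rightarrow> real^'d" where
  "trans c c' \<equiv> snd c' \<circ> chart_inv c"

text \<open>The differential of a chart change, indexed by the point of the manifold and not by its
  coordinates, so that the cocycle rule has the same base point everywhere.\<close>

definition Jac :: "('m, 'd) chart \<Rightarrow> ('m, 'd) chart \<Rightarrow> 'm \<Rightarrow> real^'d \<Rightarrow> real^'d" where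
  "Jac c c' p = frechet_derivative (trans c c') (at (snd c p))"

lemma atlas: "smooth_atlas (atlas M)"
  using manifold unfolding riemannian_manifold_def by blast

lemma chart_homeomorphism:
  "c \<in> atlas M \<Longrightarrow> homeomorphism (fst c) (snd c ` fst c) (snd c) (chart_inv c)"
  and chart_open: "c \<in> atlas M \<Longrightarrow> open (fst c)"
  and chart_image_open: "c \<in> atlas M \<Longrightarrow> open (snd c ` fst c)"
  and trans_smooth: "c \<in> atlas M \<Longrightarrow> c' \<in> atlas M \<Longrightarrow>
    smooth_on (snd c ` (fst c \<inter> fst c')) (trans c c')"
  and ex_chart: "\<exists>c\<in>atlas M. x \<in> fst c"
  using atlas unfolding smooth_atlas_def by blast+

lemma chart_at: "chart_at M x \<in> atlas M" "x \<in> fst (chart_at M x)"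
proof -
  have "\<exists>c. c \<in> atlas M \<and> x \<in> fst c" using ex_chart by blast
  from someI_ex[OF this] show "chart_at M x \<in> atlas M" "x \<in> fst (chart_at M x)"
    unfolding chart_at_def by auto
qed

lemma chart_inv_left: "c \<in> atlas M \<Longrightarrow> p \<in> fst c \<Longrightarrow> chart_inv c (snd c p) = p"
  and chart_inv_right: "c \<in> atlas M \<Longrightarrow> y \<in> snd c ` fst c \<Longrightarrow> snd c (chart_inv c y) = y"
  and chart_inv_mem: "c \<in> atlas M \<Longrightarrow> y \<in> snd c ` fst c \<Longrightarrow> chart_inv c y \<in> fst c"
  and chart_continuous: "c \<in> atlas M \<Longrightarrow> continuous_on (fst c) (snd c)"
  and chart_inv_continuous: "c \<in> atlas M \<Longrightarrow> continuous_on (snd c ` fst c) (chart_inv c)"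
  using chart_homeomorphism[of c] unfolding homeomorphism_def by auto

lemma chart_open_image:
  assumes "c \<in> atlas M" "open W"
  shows "open (snd c ` (fst c \<inter> W))"
proof -
  have "openin (top_of_set (snd c ` fst c)) (snd c ` (fst c \<inter> W))"
    by (rule homeomorphism_imp_open_map[OF chart_homeomorphism[OF assms(1)]])
       (simp add: assms openin_open_Int)
  then show ?thesis using chart_image_open[OF assms(1)] openin_open_trans by blast
qed

lemma trans_derivative:
  assumes "c \<in> atlas M" "c' \<in> atlas M" "p \<in> fst c" "p \<in> fst c'"
  shows "(trans c c' has_derivative Jac c c' p) (at (snd c p))"
  unfolding Jac_def using smooth_on_derivative[OF trans_smooth[OF assms(1,2)]] assms by blast

lemma Jac_linear:
  assumes "c \<in> atlas M" "c' \<in> atlas M" "p \<in> fst c" "p \<in> fst c'"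
  shows "linear (Jac c c' p)"
  using trans_derivative[OF assms] has_derivative_linear by blast

lemma Jac_chain:
  assumes "c \<in> atlas M" "c' \<in> atlas M" "c'' \<in> atlas M" "p \<in> fst c" "p \<in> fst c'" "p \<in> fst c''"
  shows "Jac c' c'' p (Jac c c' p \<xi>) = Jac c c'' p \<xi>"
proof -
  have e: "trans c c' (snd c p) = snd c' p" using chart_inv_left assms by simp
  have "(trans c' c'' \<circ> trans c c' has_derivative Jac c' c'' p \<circ> Jac c c' p) (at (snd c p))"
    using diff_chain_at[OF trans_derivative[OF assms(1,2,4,5)], of "trans c' c''" "Jac c' c'' p"]
      trans_derivative[OF assms(2,3,5,6)] unfolding e by blast
  then have "(trans c c'' has_derivative Jac c' c'' p \<circ> Jac c c' p) (at (snd c p))"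
    by (rule has_derivative_transform_within_open
          [OF _ chart_open_image[OF assms(1) chart_open[OF assms(2)]]])
       (use assms in \<open>auto simp: chart_inv_left\<close>)
  from has_derivative_unique[OF this trans_derivative[OF assms(1,3,4,6)]] show ?thesis
    by (metis comp_apply)
qed

lemma Jac_self:
  assumes "c \<in> atlas M" "p \<in> fst c"
  shows "Jac c c p \<xi> = \<xi>"
proof -
  have "(id has_derivative Jac c c p) (at (snd c p))"
    by (rule has_derivative_transform_within_open
          [OF trans_derivative[OF assms(1,1,2,2)] chart_image_open[OF assms(1)]])
       (use assms in \<open>auto simp: chart_inv_left\<close>)
  from has_derivative_unique[OF this has_derivative_id] show ?thesis by (simp add: fun_eq_iff)
qed

lemma Jac_inverse:
  assumes "c \<in> atlas M" "c' \<in> atlas M" "p \<in> fst c" "p \<in> fst c'"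
  shows "Jac c' c p (Jac c c' p \<xi>) = \<xi>"
  using Jac_chain[OF assms(1,2,1,3,4,3)] Jac_self assms by simp

lemma tcoord_Jac: "tcoord M c x = Jac (chart_at M x) c x"
  unfolding tcoord_def Jac_def ..

lemma tcoord_self: "tcoord M (chart_at M x) x \<xi> = \<xi>"
  unfolding tcoord_Jac using Jac_self chart_at by blast

lemma tcoord_linear: "c \<in> atlas M \<Longrightarrow> x \<in> fst c \<Longrightarrow> linear (tcoord M c x)"
  unfolding tcoord_Jac using Jac_linear chart_at by blast

lemma Jac_tcoord:
  "c \<in> atlas M \<Longrightarrow> c' \<in> atlas M \<Longrightarrow> x \<in> fst c \<Longrightarrow> x \<in> fst c' \<Longrightarrow>
    Jac c c' x (tcoord M c x \<xi>) = tcoord M c' x \<xi>"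
  unfolding tcoord_Jac using Jac_chain chart_at by blast

lemma metric_smooth: "c \<in> atlas M \<Longrightarrow> smooth_on (snd c ` fst c) (metric M c)"
  and metric_symmetric: "c \<in> atlas M \<Longrightarrow> y \<in> snd c ` fst c \<Longrightarrow> transpose (metric M c y) = metric M c y"
  and G_pos: "c \<in> atlas M \<Longrightarrow> y \<in> snd c ` fst c \<Longrightarrow> \<xi> \<noteq> 0 \<Longrightarrow> G c y \<xi> \<xi> > 0"
  and G_trans: "c \<in> atlas M \<Longrightarrow> c' \<in> atlas M \<Longrightarrow> p \<in> fst c \<Longrightarrow> p \<in> fst c' \<Longrightarrow>
    G c (snd c p) \<xi> \<eta> = G c' (snd c' p) (Jac c c' p \<xi>) (Jac c c' p \<eta>)"
  using manifold unfolding riemannian_manifold_def G_def Jac_def Let_def by blast+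

lemma G_add: "G c y (\<xi> + \<xi>') \<eta> = G c y \<xi> \<eta> + G c y \<xi>' \<eta>"
  and G_add_right: "G c y \<eta> (\<xi> + \<xi>') = G c y \<eta> \<xi> + G c y \<eta> \<xi>'"
  and G_diff: "G c y (\<xi> - \<xi>') \<eta> = G c y \<xi> \<eta> - G c y \<xi>' \<eta>"
  and G_scale: "G c y (a *\<^sub>R \<xi>) \<eta> = a * G c y \<xi> \<eta>"
  and G_scale_right: "G c y \<xi> (a *\<^sub>R \<eta>) = a * G c y \<xi> \<eta>"
  and G_minus: "G c y (- \<xi>) \<eta> = - G c y \<xi> \<eta>"
  and G_zero: "G c y 0 \<eta> = 0"
  unfolding G_def by (simp_all add: inner_simps matrix_vector_right_distrib matrix_vector_mult_scaleR)

lemma G_sym: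
  assumes "c \<in> atlas M" "y \<in> snd c ` fst c"
  shows "G c y \<xi> \<eta> = G c y \<eta> \<xi>"
  unfolding G_def using metric_symmetric[OF assms]
  by (metis dot_lmul_matrix inner_commute transpose_matrix_vector)

lemma G_nonneg: "c \<in> atlas M \<Longrightarrow> y \<in> snd c ` fst c \<Longrightarrow> G c y \<xi> \<xi> \<ge> 0"
  using G_pos[of c y \<xi>] by (cases "\<xi> = 0") (auto simp: G_zero)

lemma ginner_G: "ginner M x \<xi> \<eta> = G (chart_at M x) (snd (chart_at M x) x) \<xi> \<eta>"
  unfolding ginner_def G_def ..

lemma ginner_chart:
  assumes "c \<in> atlas M" "x \<in> fst c"
  shows "ginner M x \<xi> \<eta> = G c (snd c x) (tcoord M c x \<xi>) (tcoord M c x \<eta>)"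
  unfolding ginner_G tcoord_Jac using G_trans[OF chart_at(1) assms(1) chart_at(2) assms(2)] .

lemma ginner_pos: "\<xi> \<noteq> 0 \<Longrightarrow> ginner M x \<xi> \<xi> > 0"
  and ginner_nonneg: "ginner M x \<xi> \<xi> \<ge> 0"
  and ginner_sym: "ginner M x \<xi> \<eta> = ginner M x \<eta> \<xi>"
  unfolding ginner_G
  by (simp_all add: G_pos G_nonneg chart_at) (rule G_sym[OF chart_at(1)], simp add: chart_at)

lemma ginner_add: "ginner M x (\<xi> + \<xi>') \<eta> = ginner M x \<xi> \<eta> + ginner M x \<xi>' \<eta>"
  and ginner_add_right: "ginner M x \<eta> (\<xi> + \<xi>') = ginner M x \<eta> \<xi> + ginner M x \<eta> \<xi>'"
  and ginner_diff: "ginner M x (\<xi> - \<xi>') \<eta> = ginner M x \<xi> \<eta> - ginner M x \<xi>' \<eta>"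
  and ginner_scale: "ginner M x (a *\<^sub>R \<xi>) \<eta> = a * ginner M x \<xi> \<eta>"
  and ginner_scale_right: "ginner M x \<xi> (a *\<^sub>R \<eta>) = a * ginner M x \<xi> \<eta>"
  unfolding ginner_G by (simp_all add: G_add G_add_right G_diff G_scale G_scale_right)

lemma gnorm_nonneg: "gnorm M x \<xi> \<ge> 0"
  and gnorm_sq: "(gnorm M x \<xi>)\<^sup>2 = ginner M x \<xi> \<xi>"
  and gnorm_eq_0: "gnorm M x \<xi> = 0 \<longleftrightarrow> \<xi> = 0"
  and gnorm_scale: "gnorm M x (a *\<^sub>R \<xi>) = \<bar>a\<bar> * gnorm M x \<xi>"
proof -
  show "gnorm M x \<xi> \<ge> 0" "(gnorm M x \<xi>)\<^sup>2 = ginner M x \<xi> \<xi>"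
    unfolding gnorm_def using ginner_nonneg by auto
  show "gnorm M x \<xi> = 0 \<longleftrightarrow> \<xi> = 0"
    unfolding gnorm_def using ginner_pos[of \<xi> x]
    by (cases "\<xi> = 0") (simp_all add: ginner_G[of _ 0] G_zero)
  show "gnorm M x (a *\<^sub>R \<xi>) = \<bar>a\<bar> * gnorm M x \<xi>"
    unfolding gnorm_def
    by (simp add: ginner_scale ginner_scale_right real_sqrt_mult flip: mult.assoc)
qed

lemma has_vector_derivative_G:
  assumes c: "c \<in> atlas M" and y: "\<sigma> t \<in> snd c ` fst c" and t: "t \<in> I"
    and d: "(\<sigma> has_vector_derivative a) (at t within I)"
    and dU: "(U has_vector_derivative U') (at t within I)"
    and dV: "(V has_vector_derivative V') (at t within I)"
  shows "((\<lambda>s. G c (\<sigma> s) (U s) (V s)) has_vector_derivative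
     (DG c (\<sigma> t) a (U t) (V t) + G c (\<sigma> t) U' (V t) + G c (\<sigma> t) (U t) V')) (at t within I)"
proof -
  have m: "((\<lambda>s. metric M c (\<sigma> s)) has_vector_derivative frechet_derivative (metric M c) (at (\<sigma> t)) a)
      (at t within I)"
    by (rule has_vector_derivative_chain[OF d smooth_on_derivative[OF metric_smooth[OF c] y]])
  have mv: "((\<lambda>s. metric M c (\<sigma> s) *v V s) has_vector_derivative
      (metric M c (\<sigma> t) *v V' + frechet_derivative (metric M c) (at (\<sigma> t)) a *v V t)) (at t within I)"
    by (rule bounded_bilinear.has_vector_derivative[OF bounded_bilinear_matrix_vector_mult m dV])
  show ?thesis
    unfolding G_def DG_def
    by (rule has_vector_derivative_eq_rhs[OF bounded_bilinear.has_vector_derivative[OF bounded_bilinear_inner dU mv]])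
       (simp add: inner_simps)
qed

section \<open>Koszul formula and transformation law of the Christoffel symbols\<close>

text \<open>The index form serves the comparison with the definition of
  \<open>christoffel\<close>.\<close>

lemma DG_expand:
  assumes c: "c \<in> atlas M" and y: "y \<in> snd c ` fst c"
  shows "DG c y \<zeta> \<xi> \<eta> = (\<Sum>i\<in>UNIV. \<Sum>j\<in>UNIV. \<Sum>m\<in>UNIV.
     frechet_derivative (metric M c) (at y) (axis i 1) $ j $ m * \<zeta> $ i * \<xi> $ j * \<eta> $ m)"
proof -
  interpret linear "frechet_derivative (metric M c) (at y)"
    using smooth_on_derivative[OF metric_smooth[OF c] y] has_derivative_linear by blast
  have "frechet_derivative (metric M c) (at y) \<zeta> =
      (\<Sum>i\<in>UNIV. \<zeta> $ i *\<^sub>R frechet_derivative (metric M c) (at y) (axis i 1))"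
    by (subst basis_expansion[of \<zeta>, symmetric, unfolded scalar_mult_eq_scaleR]) (simp add: sum scale)
  then have "DG c y \<zeta> \<xi> \<eta> = (\<Sum>j\<in>UNIV. \<Sum>m\<in>UNIV. \<Sum>i\<in>UNIV.
     frechet_derivative (metric M c) (at y) (axis i 1) $ j $ m * \<zeta> $ i * \<xi> $ j * \<eta> $ m)"
    unfolding DG_def inner_vec_def matrix_vector_mult_def
    by (simp add: sum_distrib_left sum_distrib_right mult_ac)
  also have "\<dots> = (\<Sum>i\<in>UNIV. \<Sum>j\<in>UNIV. \<Sum>m\<in>UNIV.
     frechet_derivative (metric M c) (at y) (axis i 1) $ j $ m * \<zeta> $ i * \<xi> $ j * \<eta> $ m)"
    by (rule sum_rotate)
  finally show ?thesis .
qed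

lemma pd_metric:
  assumes c: "c \<in> atlas M" and y: "y \<in> snd c ` fst c"
  shows "pd i (\<lambda>z. metric M c z $ a $ b) y =
    frechet_derivative (metric M c) (at y) (axis i 1) $ a $ b"
proof -
  have "((\<lambda>z. metric M c z $ a $ b) has_derivative
      (\<lambda>h. frechet_derivative (metric M c) (at y) h $ a $ b)) (at y)"
    by (intro bounded_linear.has_derivative[OF bounded_linear_vec_nth]
        smooth_on_derivative[OF metric_smooth[OF c] y])
  from frechet_derivative_at[OF this] show ?thesis unfolding pd_def by metis
qed

text \<open>Positive definiteness makes the kernel trivial, so the choice in
  \<open>matrix_inv\<close> has a candidate.\<close>

lemma metric_inverse:
  assumes c: "c \<in> atlas M" and y: "y \<in> snd c ` fst c"
  shows "metric M c y ** matrix_inv (metric M c y) = mat 1"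
proof -
  have "\<forall>x. metric M c y *v x = 0 \<longrightarrow> x = 0"
    using G_pos[OF c y] unfolding G_def by (metis inner_zero_right less_irrefl)
  then have "\<exists>B. B ** metric M c y = mat 1"
    using matrix_left_invertible_ker by blast
  then have "\<exists>B. metric M c y ** B = mat 1 \<and> B ** metric M c y = mat 1"
    using matrix_left_right_inverse by blast
  from someI_ex[OF this] show ?thesis unfolding matrix_inv_def by blast
qed

text \<open>Koszul formula with equal first arguments, where the first two of the three derivative
  terms coincide after renaming indices. By nondegeneracy it determines
  \<open>Chr c y \<xi> \<xi>\<close>; the transformation law, constant speed and the bound on
  compact sets all rest on it.\<close>

lemma Chr_koszul:
  assumes c: "c \<in> atlas M" and y: "y \<in> snd c ` fst c"
  shows "G c y (Chr c y \<xi> \<xi>) \<zeta> = DG c y \<xi> \<xi> \<zeta> - 1/2 * DG c y \<zeta> \<xi> \<xi>"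
proof -
  let ?D = "\<lambda>i. frechet_derivative (metric M c) (at y) (axis i 1)"
  let ?g = "metric M c y"
  \<comment> \<open>The Christoffel term with its index lowered by the metric.\<close>
  define b where "b = (\<chi> m. 1/2 * (\<Sum>i\<in>UNIV. \<Sum>j\<in>UNIV.
      (?D i $ j $ m + ?D j $ i $ m - ?D m $ i $ j) * \<xi> $ i * \<xi> $ j))"
  have "Chr c y \<xi> \<xi> = matrix_inv ?g *v b"
  proof (subst vec_eq_iff, rule allI)
    fix l
    have "Chr c y \<xi> \<xi> $ l = (\<Sum>i\<in>UNIV. \<Sum>j\<in>UNIV. \<Sum>m\<in>UNIV. matrix_inv ?g $ l $ m *
      (1/2 * ((?D i $ j $ m + ?D j $ i $ m - ?D m $ i $ j) * \<xi> $ i * \<xi> $ j)))"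
      unfolding Chr_def christoffel_def Let_def pd_metric[OF c y]
      by (simp add: sum_distrib_left sum_distrib_right mult_ac)
    also have "\<dots> = (\<Sum>m\<in>UNIV. \<Sum>i\<in>UNIV. \<Sum>j\<in>UNIV. matrix_inv ?g $ l $ m *
      (1/2 * ((?D i $ j $ m + ?D j $ i $ m - ?D m $ i $ j) * \<xi> $ i * \<xi> $ j)))"
      by (rule sum_rotate)
    also have "\<dots> = (matrix_inv ?g *v b) $ l"
      unfolding matrix_vector_mult_def b_def by (simp add: sum_distrib_left)
    finally show "Chr c y \<xi> \<xi> $ l = (matrix_inv ?g *v b) $ l" .
  qed
  then have "?g *v Chr c y \<xi> \<xi> = b"
    by (simp add: matrix_vector_mul_assoc metric_inverse[OF c y])
  then have "G c y (Chr c y \<xi> \<xi>) \<zeta> = \<zeta> \<bullet> b"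
    using G_sym[OF c y] unfolding G_def by metis
  also have "\<dots> = (\<Sum>m\<in>UNIV. \<Sum>i\<in>UNIV. \<Sum>j\<in>UNIV. 1/2 * (?D i $ j $ m * \<xi> $ i * \<xi> $ j * \<zeta> $ m))
     + (\<Sum>m\<in>UNIV. \<Sum>i\<in>UNIV. \<Sum>j\<in>UNIV. 1/2 * (?D j $ i $ m * \<xi> $ j * \<xi> $ i * \<zeta> $ m))
     - (\<Sum>m\<in>UNIV. \<Sum>i\<in>UNIV. \<Sum>j\<in>UNIV. 1/2 * (?D m $ i $ j * \<zeta> $ m * \<xi> $ i * \<xi> $ j))"
    unfolding inner_vec_def b_def
    by (simp add: sum_distrib_left sum.distrib[symmetric] sum_subtractf[symmetric] algebra_simps)
  also have "(\<Sum>m\<in>UNIV. \<Sum>i\<in>UNIV. \<Sum>j\<in>UNIV. 1/2 * (?D j $ i $ m * \<xi> $ j * \<xi> $ i * \<zeta> $ m)) =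
     (\<Sum>m\<in>UNIV. \<Sum>i\<in>UNIV. \<Sum>j\<in>UNIV. 1/2 * (?D i $ j $ m * \<xi> $ i * \<xi> $ j * \<zeta> $ m))"
    by (rule sum.cong[OF refl], rule sum.swap)
  also have "(\<Sum>m\<in>UNIV. \<Sum>i\<in>UNIV. \<Sum>j\<in>UNIV. 1/2 * (?D i $ j $ m * \<xi> $ i * \<xi> $ j * \<zeta> $ m)) =
     (\<Sum>i\<in>UNIV. \<Sum>j\<in>UNIV. \<Sum>m\<in>UNIV. 1/2 * (?D i $ j $ m * \<xi> $ i * \<xi> $ j * \<zeta> $ m))"
    by (rule sum_rotate[symmetric])
  finally show ?thesis
    unfolding DG_expand[OF c y] by (simp add: sum_distrib_left)
qed

text \<open>Differentiates the invariance \<open>G_trans\<close> along the coordinate line through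
  \<open>p\<close> in the direction \<open>\<zeta>\<close>. The terms with \<open>D2\<close> arise
  because the Jacobian acting on \<open>a\<close> and \<open>b\<close> varies along the
  line.\<close>

lemma metric_derivative_trans:
  assumes c: "c \<in> atlas M" "c' \<in> atlas M" and p: "p \<in> fst c" "p \<in> fst c'"
  shows "DG c (snd c p) \<zeta> a b =
    DG c' (snd c' p) (Jac c c' p \<zeta>) (Jac c c' p a) (Jac c c' p b)
    + G c' (snd c' p) (D2 (trans c c') (snd c p) a \<zeta>) (Jac c c' p b)
    + G c' (snd c' p) (Jac c c' p a) (D2 (trans c c') (snd c p) b \<zeta>)"
proof -
  let ?S = "snd c ` (fst c \<inter> fst c')"
  define y where "y = snd c p"
  define l where "l s = y + s *\<^sub>R \<zeta>" for s :: real
  have S: "open ?S" using chart_open_image[OF c(1) chart_open[OF c(2)]] .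
  have yS: "y \<in> ?S" using p unfolding y_def by blast
  have l0: "l 0 = y" by (simp add: l_def)
  have dl: "(l has_vector_derivative \<zeta>) (at 0)"
    unfolding l_def by (auto intro!: derivative_eq_intros)
  have ty: "trans c c' y = snd c' p" unfolding y_def using chart_inv_left c p by simp
  have dt: "((\<lambda>s. trans c c' (l s)) has_vector_derivative Jac c c' p \<zeta>) (at 0)"
    using has_vector_derivative_chain[OF dl, of "trans c c'" "Jac c c' p"]
      trans_derivative[OF c p] unfolding l0 y_def by blast
  have dJ: "((\<lambda>s. frechet_derivative (trans c c') (at (l s)) v) has_vector_derivative
      D2 (trans c c') y v \<zeta>) (at 0)" for v
    using has_vector_derivative_frechet[OF trans_smooth[OF c] S _ dl, of "\<lambda>_. v" 0] l0 yS
      frechet_basis_expansion[OF trans_smooth[OF c] yS, of 0] by simp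
  have Jy: "frechet_derivative (trans c c') (at y) = Jac c c' p" unfolding Jac_def y_def ..
  have y: "y \<in> snd c ` fst c" using yS by auto
  have y': "snd c' p \<in> snd c' ` fst c'" using p by auto
  have 1: "((\<lambda>s. G c (l s) a b) has_vector_derivative DG c y \<zeta> a b) (at 0)"
    using has_vector_derivative_G[OF c(1) _ _ dl, of "\<lambda>_. a" 0 "\<lambda>_. b" 0] y l0
    by (simp add: G_zero G_scale_right[of c y a 0 0, simplified])
  have 2: "((\<lambda>s. G c' (trans c c' (l s)) (frechet_derivative (trans c c') (at (l s)) a)
        (frechet_derivative (trans c c') (at (l s)) b)) has_vector_derivative
      (DG c' (snd c' p) (Jac c c' p \<zeta>) (Jac c c' p a) (Jac c c' p b)
    + G c' (snd c' p) (D2 (trans c c') y a \<zeta>) (Jac c c' p b)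
    + G c' (snd c' p) (Jac c c' p a) (D2 (trans c c') y b \<zeta>))) (at 0)"
    using has_vector_derivative_G[OF c(2) _ _ dt dJ dJ, of a b] y' l0 ty Jy by simp
  have ev: "\<forall>\<^sub>F s in at 0. l s \<in> ?S"
    using dl S yS l0 has_vector_derivative_continuous[OF dl] topological_tendstoD
    by (metis continuous_within)
  have ev': "\<forall>\<^sub>F s in at 0. G c' (trans c c' (l s)) (frechet_derivative (trans c c') (at (l s)) a)
        (frechet_derivative (trans c c') (at (l s)) b) = G c (l s) a b"
    using ev
  proof eventually_elim
    case (elim s)
    then obtain q where q: "q \<in> fst c" "q \<in> fst c'" "l s = snd c q" by auto
    then show ?case using G_trans[OF c q(1,2)] c by (simp add: chart_inv_left Jac_def)
  qed
  have "((\<lambda>s. G c (l s) a b) has_vector_derivative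
      (DG c' (snd c' p) (Jac c c' p \<zeta>) (Jac c c' p a) (Jac c c' p b)
    + G c' (snd c' p) (D2 (trans c c') y a \<zeta>) (Jac c c' p b)
    + G c' (snd c' p) (Jac c c' p a) (D2 (trans c c') y b \<zeta>))) (at 0)"
    using 2 unfolding has_vector_derivative_def
    by (rule has_derivative_transform_eventually[OF _ ev'])
       (use G_trans[OF c p] in \<open>simp_all only: l0 ty Jy y_def[symmetric] UNIV_I\<close>)
  from vector_derivative_unique_at[OF 1 this] show ?thesis unfolding y_def .
qed

text \<open>Both sides are paired with a vector by means of the Koszul formula. By symmetry of
  \<open>D2\<close>, the terms pairing \<open>D2\<close> of \<open>\<xi>\<close> and
  \<open>\<zeta>\<close> with the image of \<open>\<xi>\<close> cancel, and only the inhomogeneous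
  term survives.\<close>

lemma Chr_trans:
  assumes c: "c \<in> atlas M" "c' \<in> atlas M" and p: "p \<in> fst c" "p \<in> fst c'"
  shows "Jac c c' p (Chr c (snd c p) \<xi> \<xi>) =
    Chr c' (snd c' p) (Jac c c' p \<xi>) (Jac c c' p \<xi>) + D2 (trans c c') (snd c p) \<xi> \<xi>"
proof -
  let ?J = "Jac c c' p" and ?D = "D2 (trans c c') (snd c p)" and ?G = "G c' (snd c' p)"
  \<comment> \<open>The defect of the identity is paired with itself; \<open>\<zeta>\<close> is its
    pullback to the chart \<open>c\<close>, where the Koszul formula can be applied.\<close>
  define u where "u = ?J (Chr c (snd c p) \<xi> \<xi>) - (Chr c' (snd c' p) (?J \<xi>) (?J \<xi>) + ?D \<xi> \<xi>)"
  define \<zeta> where "\<zeta> = Jac c' c p u"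
  have J\<zeta>: "?J \<zeta> = u" unfolding \<zeta>_def using Jac_inverse c p by blast
  have y: "snd c p \<in> snd c ` fst c" "snd c' p \<in> snd c' ` fst c'" using p by auto
  have S: "snd c p \<in> snd c ` (fst c \<inter> fst c')" using p by auto
  have D: "?D a b = ?D b a" for a b
    using D2_symmetric[OF trans_smooth[OF c] chart_open_image[OF c(1) chart_open[OF c(2)]] S] .
  have "?G (?J (Chr c (snd c p) \<xi> \<xi>)) u = G c (snd c p) (Chr c (snd c p) \<xi> \<xi>) \<zeta>"
    using G_trans[OF c p] J\<zeta> by simp
  also have "\<dots> = DG c (snd c p) \<xi> \<xi> \<zeta> - 1/2 * DG c (snd c p) \<zeta> \<xi> \<xi>"
    by (rule Chr_koszul[OF c(1) y(1)])
  also have "\<dots> = (DG c' (snd c' p) (?J \<xi>) (?J \<xi>) u - 1/2 * DG c' (snd c' p) u (?J \<xi>) (?J \<xi>))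
      + ?G (?D \<xi> \<xi>) u"
    unfolding metric_derivative_trans[OF c p] J\<zeta> D[of \<zeta> \<xi>]
    by (simp add: G_sym[OF c(2) y(2), of "?D \<xi> \<zeta>"] add_divide_distrib)
  also have "\<dots> = ?G (Chr c' (snd c' p) (?J \<xi>) (?J \<xi>) + ?D \<xi> \<xi>) u"
    by (simp add: Chr_koszul[OF c(2) y(2)] G_add)
  finally have "?G u u = 0" by (simp add: u_def G_diff)
  then have "u = 0" using G_pos[OF c(2) y(2), of u] by force
  then show ?thesis unfolding u_def by simp
qed

end

section \<open>Curves, geodesics and lengths\<close>

lemma has_vector_derivative_transform_eventually:
  assumes "(f has_vector_derivative D) (at t within I)" "t \<in> I"
    and "\<forall>\<^sub>F s in at t within I. f s = g s" "f t = g t"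
  shows "(g has_vector_derivative D) (at t within I)"
  using assms(1) unfolding has_vector_derivative_def
  by (rule has_derivative_transform_eventually[OF _ assms(3,4,2)])

lemma continuous_transform_eventually:
  assumes "continuous (at t within I) f"
    and "\<forall>\<^sub>F s in at t within I. f s = g s" "f t = g t"
  shows "continuous (at t within I) g"
  using assms(1) tendsto_cong[OF assms(2), of "g t"] unfolding continuous_within assms(3) by simp

lemma continuous_eventually_in_open:
  assumes "continuous (at t within I) \<gamma>" "open S" "\<gamma> t \<in> S"
  shows "\<forall>\<^sub>F s in at t within I. \<gamma> s \<in> S"
  by (rule topological_tendstoD[OF assms(1)[unfolded continuous_within] assms(2,3)])

text \<open>Derivatives in fixed directions are continuous; the basis expansion carries this over to
  a moving direction.\<close>

lemma continuous_frechet: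
  fixes f :: "'a::euclidean_space \<Rightarrow> 'b::real_normed_vector" and t :: real
  assumes f: "smooth_on S f" "open S" and y: "\<sigma> t \<in> S"
    and \<sigma>: "continuous (at t within I) \<sigma>" and W: "continuous (at t within I) W"
  shows "continuous (at t within I) (\<lambda>s. frechet_derivative f (at (\<sigma> s)) (W s))"
proof -
  have tb: "((\<lambda>s. frechet_derivative f (at (\<sigma> s)) b) \<longlongrightarrow> frechet_derivative f (at (\<sigma> t)) b) (at t within I)" for b
  proof (rule isCont_tendsto_compose[where g = "\<lambda>y. frechet_derivative f (at y) b"])
    show "isCont (\<lambda>y. frechet_derivative f (at y) b) (\<sigma> t)"
      using smooth_on_continuous[OF smooth_on_frechet[OF f(1), of b]] f(2) y
      by (simp add: continuous_on_eq_continuous_at)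
    show "(\<sigma> \<longlongrightarrow> \<sigma> t) (at t within I)" using \<sigma> by (simp add: continuous_within)
  qed
  have tw: "(W \<longlongrightarrow> W t) (at t within I)" using W by (simp add: continuous_within)
  have "continuous (at t within I)
      (\<lambda>s. \<Sum>b\<in>Basis. (W s \<bullet> b) *\<^sub>R frechet_derivative f (at (\<sigma> s)) b)"
    unfolding continuous_within by (intro tendsto_intros tb tw)
  moreover have "\<forall>\<^sub>F s in at t within I. (\<Sum>b\<in>Basis. (W s \<bullet> b) *\<^sub>R frechet_derivative f (at (\<sigma> s)) b)
      = frechet_derivative f (at (\<sigma> s)) (W s)"
    using continuous_eventually_in_open[OF \<sigma> f(2) y]
    by eventually_elim (simp add: frechet_basis_expansion[OF f(1), symmetric])
  ultimately show ?thesis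
    by (rule continuous_transform_eventually) (simp add: frechet_basis_expansion[OF f(1) y, symmetric])
qed

context riemann_mfd
begin

text \<open>\<open>has_velocity\<close> refers to the preferred chart at \<open>\<gamma> t\<close>;
  the chain rule for the chart change carries it to any chart around that point.
  \<open>velocity_of_chart\<close> is the way back, for curves built from coordinates.\<close>

lemma chart_velocity:
  assumes v: "has_velocity M I \<gamma> t \<xi>" and t: "t \<in> I" and c: "c \<in> atlas M" "\<gamma> t \<in> fst c"
  shows "((snd c \<circ> \<gamma>) has_vector_derivative tcoord M c (\<gamma> t) \<xi>) (at t within I)"
proof -
  let ?c = "chart_at M (\<gamma> t)"
  have ct: "continuous (at t within I) \<gamma>"
    and d: "((snd ?c \<circ> \<gamma>) has_vector_derivative \<xi>) (at t within I)"
    using v unfolding has_velocity_def by auto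
  have "((\<lambda>s. trans ?c c ((snd ?c \<circ> \<gamma>) s)) has_vector_derivative Jac ?c c (\<gamma> t) \<xi>) (at t within I)"
    by (rule has_vector_derivative_chain[OF d])
       (use trans_derivative[OF chart_at(1) c(1) chart_at(2) c(2)] in \<open>simp add: o_def\<close>)
  then show ?thesis unfolding tcoord_Jac
    by (rule has_vector_derivative_transform_eventually[OF _ t])
       (use continuous_eventually_in_open[OF ct chart_open[OF chart_at(1)] chart_at(2)] chart_at in
         \<open>auto elim!: eventually_mono simp: chart_inv_left\<close>)
qed

lemma velocity_of_chart:
  assumes ct: "continuous (at t within I) \<gamma>" and t: "t \<in> I" and c: "c \<in> atlas M" "\<gamma> t \<in> fst c"
    and d: "((snd c \<circ> \<gamma>) has_vector_derivative a) (at t within I)"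
  shows "has_velocity M I \<gamma> t (Jac c (chart_at M (\<gamma> t)) (\<gamma> t) a)"
proof -
  let ?c = "chart_at M (\<gamma> t)"
  have "((\<lambda>s. trans c ?c ((snd c \<circ> \<gamma>) s)) has_vector_derivative Jac c ?c (\<gamma> t) a) (at t within I)"
    by (rule has_vector_derivative_chain[OF d])
       (use trans_derivative[OF c(1) chart_at(1) c(2) chart_at(2)] in \<open>simp add: o_def\<close>)
  then have "((snd ?c \<circ> \<gamma>) has_vector_derivative Jac c ?c (\<gamma> t) a) (at t within I)"
    by (rule has_vector_derivative_transform_eventually[OF _ t])
       (use continuous_eventually_in_open[OF ct chart_open[OF c(1)] c(2)] c in
         \<open>auto elim!: eventually_mono simp: chart_inv_left\<close>)
  then show ?thesis unfolding has_velocity_def using ct by blast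
qed

lemma velocity_unique:
  assumes "has_velocity M {a..b} \<gamma> t \<xi>" "has_velocity M {a..b} \<gamma> t \<xi>'" "a < b" "t \<in> {a..b}"
  shows "\<xi> = \<xi>'"
  using assms vector_derivative_unique_within_closed_interval[of a b t]
  unfolding has_velocity_def by auto

text \<open>The covariant derivative of the velocity, seen in one chart instead of the preferred
  charts that change with time. The second derivative of the chart change produced by the product
  rule is exactly the inhomogeneous term of \<open>Chr_trans\<close>.\<close>

lemma chart_covariant_derivative:
  assumes v: "has_velocity M {a..b} \<gamma> t (V t)"
    and cov: "has_covariant_derivative M {a..b} \<gamma> V t A"
    and t: "a < b" "t \<in> {a..b}" and c: "c \<in> atlas M" "\<gamma> t \<in> fst c"
  shows "((\<lambda>s. tcoord M c (\<gamma> s) (V s)) has_vector_derivative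
      (tcoord M c (\<gamma> t) A
        - Chr c (snd c (\<gamma> t)) (tcoord M c (\<gamma> t) (V t)) (tcoord M c (\<gamma> t) (V t)))) (at t within {a..b})"
proof -
  let ?I = "{a..b}"
  let ?c = "chart_at M (\<gamma> t)"
  define y where "y = snd ?c (\<gamma> t)"
  have ct: "continuous (at t within ?I) \<gamma>"
    and d: "((snd ?c \<circ> \<gamma>) has_vector_derivative V t) (at t within ?I)"
    using v unfolding has_velocity_def by auto
  obtain D where D: "((\<lambda>s. tcoord M ?c (\<gamma> s) (V s)) has_vector_derivative D) (at t within ?I)"
    and A: "A = D + Chr ?c y (V t) (V t)"
    using cov velocity_unique[OF v _ t]
    unfolding has_covariant_derivative_def Let_def Chr_def y_def by blast
  let ?S = "snd ?c ` (fst ?c \<inter> fst c)"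
  have S: "open ?S" using chart_open_image[OF chart_at(1) chart_open[OF c(1)]] .
  have yS: "(snd ?c \<circ> \<gamma>) t \<in> ?S" using chart_at c by auto
  have "((\<lambda>s. frechet_derivative (trans ?c c) (at ((snd ?c \<circ> \<gamma>) s)) (tcoord M ?c (\<gamma> s) (V s)))
      has_vector_derivative
      (D2 (trans ?c c) ((snd ?c \<circ> \<gamma>) t) (tcoord M ?c (\<gamma> t) (V t)) (V t)
        + frechet_derivative (trans ?c c) (at ((snd ?c \<circ> \<gamma>) t)) D)) (at t within ?I)"
    by (rule has_vector_derivative_frechet[OF trans_smooth[OF chart_at(1) c(1)] S yS d D t(2)])
  then have "((\<lambda>s. tcoord M c (\<gamma> s) (V s)) has_vector_derivative
      (D2 (trans ?c c) ((snd ?c \<circ> \<gamma>) t) (tcoord M ?c (\<gamma> t) (V t)) (V t)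
        + frechet_derivative (trans ?c c) (at ((snd ?c \<circ> \<gamma>) t)) D)) (at t within ?I)"
  proof (rule has_vector_derivative_transform_eventually[OF _ t(2)])
    have e: "frechet_derivative (trans ?c c) (at ((snd ?c \<circ> \<gamma>) s)) (tcoord M ?c (\<gamma> s) (V s))
        = tcoord M c (\<gamma> s) (V s)" if "\<gamma> s \<in> fst ?c" "\<gamma> s \<in> fst c" for s
      using Jac_tcoord[OF chart_at(1) c(1) that] unfolding Jac_def by simp
    show "\<forall>\<^sub>F s in at t within ?I. frechet_derivative (trans ?c c) (at ((snd ?c \<circ> \<gamma>) s))
        (tcoord M ?c (\<gamma> s) (V s)) = tcoord M c (\<gamma> s) (V s)"
      using continuous_eventually_in_open[OF ct chart_open[OF chart_at(1)] chart_at(2)]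
        continuous_eventually_in_open[OF ct chart_open[OF c(1)] c(2)]
      by eventually_elim (rule e)
    show "frechet_derivative (trans ?c c) (at ((snd ?c \<circ> \<gamma>) t)) (tcoord M ?c (\<gamma> t) (V t))
        = tcoord M c (\<gamma> t) (V t)"
      using e chart_at c by blast
  qed
  moreover have "D2 (trans ?c c) ((snd ?c \<circ> \<gamma>) t) (tcoord M ?c (\<gamma> t) (V t)) (V t)
        + frechet_derivative (trans ?c c) (at ((snd ?c \<circ> \<gamma>) t)) D =
      tcoord M c (\<gamma> t) A
        - Chr c (snd c (\<gamma> t)) (tcoord M c (\<gamma> t) (V t)) (tcoord M c (\<gamma> t) (V t))"
  proof -
    have "Jac ?c c (\<gamma> t) A = Jac ?c c (\<gamma> t) D + Jac ?c c (\<gamma> t) (Chr ?c y (V t) (V t))"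
      unfolding A by (rule linear_add[OF Jac_linear[OF chart_at(1) c(1) chart_at(2) c(2)]])
    then show ?thesis
      unfolding y_def Chr_trans[OF chart_at(1) c(1) chart_at(2) c(2)]
      by (simp add: tcoord_self) (simp add: tcoord_Jac Jac_def)
  qed
  ultimately show ?thesis by simp
qed

section \<open>Geodesic equation in a fixed chart and constant speed\<close>

text \<open>Gives a name to the velocity field that \<open>geodesic\<close> hides under an
  existential quantifier; speed, initial velocity and geodesic equation all refer to it.\<close>

definition geodesic_with :: "(real \<Rightarrow> 'm) \<Rightarrow> (real \<Rightarrow> real^'d) \<Rightarrow> bool" where
  "geodesic_with \<gamma> V \<longleftrightarrow> (\<forall>t\<in>{0..1}. has_velocity M {0..1} \<gamma> t (V t) \<and>
     has_covariant_derivative M {0..1} \<gamma> V t 0)"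

lemma geodesic_iff: "geodesic M \<gamma> \<longleftrightarrow> (\<exists>V. geodesic_with \<gamma> V)"
  unfolding geodesic_def geodesic_with_def ..

lemma geodesic_equation:
  assumes g: "geodesic_with \<gamma> V" and t: "t \<in> {0..1}" and c: "c \<in> atlas M" "\<gamma> t \<in> fst c"
  shows "((snd c \<circ> \<gamma>) has_vector_derivative tcoord M c (\<gamma> t) (V t)) (at t within {0..1})"
    and "((\<lambda>s. tcoord M c (\<gamma> s) (V s)) has_vector_derivative
       - Chr c (snd c (\<gamma> t)) (tcoord M c (\<gamma> t) (V t)) (tcoord M c (\<gamma> t) (V t))) (at t within {0..1})"
proof -
  have v: "has_velocity M {0..1} \<gamma> t (V t)" and cv: "has_covariant_derivative M {0..1} \<gamma> V t 0"
    using g t unfolding geodesic_with_def by auto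
  show "((snd c \<circ> \<gamma>) has_vector_derivative tcoord M c (\<gamma> t) (V t)) (at t within {0..1})"
    by (rule chart_velocity[OF v t c])
  show "((\<lambda>s. tcoord M c (\<gamma> s) (V s)) has_vector_derivative
       - Chr c (snd c (\<gamma> t)) (tcoord M c (\<gamma> t) (V t)) (tcoord M c (\<gamma> t) (V t))) (at t within {0..1})"
    using chart_covariant_derivative[OF v cv _ t c] linear_0[OF tcoord_linear[OF c]] by simp
qed

lemma geodesic_continuous: "geodesic_with \<gamma> V \<Longrightarrow> t \<in> {0..1} \<Longrightarrow> continuous (at t within {0..1}) \<gamma>"
  unfolding geodesic_with_def has_velocity_def by blast

text \<open>The derivative is computed in the preferred chart at the time in question. The
  derivative of the metric cancels against the two acceleration terms by \<open>Chr_koszul\<close>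
  with all arguments equal to the velocity.\<close>

lemma geodesic_constant_speed:
  assumes g: "geodesic_with \<gamma> V" and t: "t \<in> {0..1}"
  shows "gnorm M (\<gamma> t) (V t) = gnorm M (\<gamma> 0) (V 0)"
proof -
  have d: "((\<lambda>s. ginner M (\<gamma> s) (V s) (V s)) has_vector_derivative 0) (at t within {0..1})"
    if t: "t \<in> {0..1}" for t
  proof -
    let ?c = "chart_at M (\<gamma> t)"
    let ?y = "snd ?c (\<gamma> t)"
    have y: "?y \<in> snd ?c ` fst ?c" using chart_at by blast
    note e = geodesic_equation[OF g t chart_at(1) chart_at(2), unfolded tcoord_self]
    have "((\<lambda>s. G ?c ((snd ?c \<circ> \<gamma>) s) (tcoord M ?c (\<gamma> s) (V s)) (tcoord M ?c (\<gamma> s) (V s)))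
        has_vector_derivative
        (DG ?c ?y (V t) (V t) (V t) + G ?c ?y (- Chr ?c ?y (V t) (V t)) (V t)
          + G ?c ?y (V t) (- Chr ?c ?y (V t) (V t)))) (at t within {0..1})"
      using has_vector_derivative_G[OF chart_at(1) _ t e(1) e(2) e(2)] y by (simp add: tcoord_self)
    moreover have "DG ?c ?y (V t) (V t) (V t) + G ?c ?y (- Chr ?c ?y (V t) (V t)) (V t)
          + G ?c ?y (V t) (- Chr ?c ?y (V t) (V t)) = 0"
      using Chr_koszul[OF chart_at(1) y, of "V t" "V t"]
      by (simp add: G_sym[OF chart_at(1) y, of "V t"] G_minus)
    ultimately have "((\<lambda>s. G ?c ((snd ?c \<circ> \<gamma>) s) (tcoord M ?c (\<gamma> s) (V s)) (tcoord M ?c (\<gamma> s) (V s)))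
        has_vector_derivative 0) (at t within {0..1})" by simp
    then show ?thesis
      by (rule has_vector_derivative_transform_eventually[OF _ t])
         (use continuous_eventually_in_open[OF geodesic_continuous[OF g t] chart_open[OF chart_at(1)] chart_at(2)]
            chart_at in \<open>auto elim!: eventually_mono simp: ginner_chart[OF chart_at(1)[of "\<gamma> t"]]\<close>)
  qed
  have "((\<lambda>s. ginner M (\<gamma> s) (V s) (V s)) has_derivative (\<lambda>h. 0)) (at t within {0..1})"
    if "t \<in> {0..1}" for t
    using d[OF that] unfolding has_vector_derivative_def by simp
  then obtain k where "\<forall>s\<in>{0..1}. ginner M (\<gamma> s) (V s) (V s) = k"
    using has_derivative_zero_constant[of "{0..1::real}" "\<lambda>s. ginner M (\<gamma> s) (V s) (V s)"] by auto
  then show ?thesis using t unfolding gnorm_def by simp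
qed

section \<open>Regularity of reparametrized and glued curves\<close>

text \<open>\<open>C1_curve\<close> demands a continuous velocity in every chart. One chart around
  each time suffices, because the Jacobian of the chart change is continuous.\<close>

lemma C1_curveI:
  assumes v: "\<And>t. t \<in> {a..b} \<Longrightarrow> has_velocity M {a..b} \<gamma> t (V t)"
    and W: "\<And>t. t \<in> {a..b} \<Longrightarrow> \<exists>c\<in>atlas M. \<gamma> t \<in> fst c \<and>
        continuous (at t within {a..b}) (\<lambda>s. tcoord M c (\<gamma> s) (V s))"
  shows "C1_curve M a b \<gamma>"
  unfolding C1_curve_def
proof (intro conjI ballI)
  let ?I = "{a..b}"
  show "continuous_on ?I \<gamma>"
    using v unfolding has_velocity_def continuous_on_eq_continuous_within by blast
  fix c' assume c': "c' \<in> atlas M"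
  have "continuous (at t within ?I) (\<lambda>s. tcoord M c' (\<gamma> s) (V s))"
    if t: "t \<in> ?I" and tc': "\<gamma> t \<in> fst c'" for t
  proof -
    obtain c where c: "c \<in> atlas M" "\<gamma> t \<in> fst c"
      and cW: "continuous (at t within ?I) (\<lambda>s. tcoord M c (\<gamma> s) (V s))" using W[OF t] by blast
    have ct: "continuous (at t within ?I) \<gamma>" using v[OF t] unfolding has_velocity_def by blast
    have cs: "continuous (at t within ?I) (snd c \<circ> \<gamma>)"
      using chart_velocity[OF v[OF t] t c] has_vector_derivative_continuous by blast
    have S: "open (snd c ` (fst c \<inter> fst c'))" using chart_open_image[OF c(1) chart_open[OF c']] .
    have yS: "(snd c \<circ> \<gamma>) t \<in> snd c ` (fst c \<inter> fst c')" using c tc' by auto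
    have e: "frechet_derivative (trans c c') (at ((snd c \<circ> \<gamma>) s)) (tcoord M c (\<gamma> s) (V s))
        = tcoord M c' (\<gamma> s) (V s)" if "\<gamma> s \<in> fst c" "\<gamma> s \<in> fst c'" for s
      using Jac_tcoord[OF c(1) c' that] unfolding Jac_def by simp
    have "\<forall>\<^sub>F s in at t within ?I. frechet_derivative (trans c c') (at ((snd c \<circ> \<gamma>) s))
        (tcoord M c (\<gamma> s) (V s)) = tcoord M c' (\<gamma> s) (V s)"
      using continuous_eventually_in_open[OF ct chart_open[OF c'] tc']
        continuous_eventually_in_open[OF ct chart_open[OF c(1)] c(2)]
      by eventually_elim (rule e)
    then show ?thesis
      by (rule continuous_transform_eventually[OF continuous_frechet[OF trans_smooth[OF c(1) c'] S yS cs cW]])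
         (rule e[OF c(2) tc'])
  qed
  then have "\<forall>t\<in>{t \<in> ?I. \<gamma> t \<in> fst c'}. continuous (at t within {t \<in> ?I. \<gamma> t \<in> fst c'})
      (\<lambda>s. tcoord M c' (\<gamma> s) (V s))"
    by (intro ballI, rule continuous_within_subset[of _ ?I]) auto
  then have "continuous_on {t \<in> ?I. \<gamma> t \<in> fst c'} (\<lambda>s. tcoord M c' (\<gamma> s) (V s))"
    unfolding continuous_on_eq_continuous_within .
  then show "\<exists>D. (\<forall>t\<in>?I. \<gamma> t \<in> fst c' \<longrightarrow>
           ((snd c' \<circ> \<gamma>) has_vector_derivative D t) (at t within ?I)) \<and>
        continuous_on {t \<in> ?I. \<gamma> t \<in> fst c'} D"
    by (intro exI[of _ "\<lambda>s. tcoord M c' (\<gamma> s) (V s)"] conjI ballI impI)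
       (use chart_velocity[OF v _ c'] in auto)
qed

text \<open>Glued curves are given by case distinctions; on each closed subinterval this replaces
  them by the piece. Derivatives within \<open>{a..b}\<close> see only the values there.\<close>

lemma C1_curve_cong:
  assumes "C1_curve M a b \<gamma>" "\<And>t. t \<in> {a..b} \<Longrightarrow> \<gamma>' t = \<gamma> t"
  shows "C1_curve M a b \<gamma>'"
  unfolding C1_curve_def
proof (intro conjI ballI)
  show "continuous_on {a..b} \<gamma>'"
    using assms continuous_on_cong[of "{a..b}" "{a..b}" \<gamma>' \<gamma>] unfolding C1_curve_def by simp
  fix c assume "c \<in> atlas M"
  then obtain D where D: "\<And>t. t \<in> {a..b} \<Longrightarrow> \<gamma> t \<in> fst c \<Longrightarrow>
           ((snd c \<circ> \<gamma>) has_vector_derivative D t) (at t within {a..b})"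
        "continuous_on {t\<in>{a..b}. \<gamma> t \<in> fst c} D"
    using assms(1) unfolding C1_curve_def by blast
  have "{t\<in>{a..b}. \<gamma>' t \<in> fst c} = {t\<in>{a..b}. \<gamma> t \<in> fst c}" using assms(2) by auto
  moreover have "((snd c \<circ> \<gamma>') has_vector_derivative D t) (at t within {a..b})"
    if "t \<in> {a..b}" "\<gamma>' t \<in> fst c" for t
    by (rule has_vector_derivative_transform[OF that(1) _ D(1)[OF that(1)]])
       (use that assms(2) in auto)
  ultimately show "\<exists>D. (\<forall>t\<in>{a..b}. \<gamma>' t \<in> fst c \<longrightarrow>
           ((snd c \<circ> \<gamma>') has_vector_derivative D t) (at t within {a..b})) \<and>
        continuous_on {t\<in>{a..b}. \<gamma>' t \<in> fst c} D"
    using D(2) by (intro exI[of _ D]) auto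
qed

lemma velocity_affine:
  assumes v: "has_velocity M J \<gamma> (p + q * \<tau>) \<xi>" and I: "(\<lambda>\<tau>. p + q * \<tau>) ` I \<subseteq> J"
  shows "has_velocity M I (\<lambda>\<tau>. \<gamma> (p + q * \<tau>)) \<tau> (q *\<^sub>R \<xi>)"
proof -
  have l: "((\<lambda>\<tau>. p + q * \<tau>) has_vector_derivative q) (at \<tau> within I)"
    by (auto intro!: derivative_eq_intros simp: has_vector_derivative_def)
  have "continuous (at (p + q * \<tau>) within J) \<gamma>" using v unfolding has_velocity_def by blast
  from continuous_within_compose[OF has_vector_derivative_continuous[OF l] continuous_within_subset[OF this I]]
  have "continuous (at \<tau> within I) (\<gamma> \<circ> (\<lambda>\<tau>. p + q * \<tau>))" .
  moreover have "((snd (chart_at M (\<gamma> (p + q * \<tau>))) \<circ> \<gamma>) \<circ> (\<lambda>\<tau>. p + q * \<tau>) has_vector_derivative q *\<^sub>R \<xi>)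
      (at \<tau> within I)"
  proof (rule vector_diff_chain_within[OF l])
    have "((snd (chart_at M (\<gamma> (p + q * \<tau>))) \<circ> \<gamma>) has_vector_derivative \<xi>) (at (p + q * \<tau>) within J)"
      using v unfolding has_velocity_def by blast
    from has_vector_derivative_within_subset[OF this I]
    show "((snd (chart_at M (\<gamma> (p + q * \<tau>))) \<circ> \<gamma>) has_vector_derivative \<xi>)
        (at (p + q * \<tau>) within (\<lambda>\<tau>. p + q * \<tau>) ` I)" .
  qed
  ultimately show ?thesis unfolding has_velocity_def by (simp add: o_def)
qed

text \<open>Reparametrized parts of geodesics are pieces of the competitors for the distance. The
  geodesic equation makes the components of the velocity differentiable, hence continuous.\<close>

lemma geodesic_affine_C1:
  assumes g: "geodesic_with \<gamma> V" and I: "(\<lambda>\<tau>. p + q * \<tau>) ` {a..b} \<subseteq> {0..1}"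
  shows "C1_curve M a b (\<lambda>\<tau>. \<gamma> (p + q * \<tau>))"
proof (rule C1_curveI)
  fix \<tau> assume \<tau>: "\<tau> \<in> {a..b}"
  have t: "p + q * \<tau> \<in> {0..1}" using bspec[OF image_subset_iff[THEN iffD1, OF I] \<tau>] .
  show v: "has_velocity M {a..b} (\<lambda>\<tau>. \<gamma> (p + q * \<tau>)) \<tau> (q *\<^sub>R V (p + q * \<tau>))"
    by (rule velocity_affine[OF _ I]) (use g t in \<open>auto simp: geodesic_with_def\<close>)
  let ?c = "chart_at M (\<gamma> (p + q * \<tau>))"
  have cl: "continuous (at \<tau> within {a..b}) (\<lambda>\<tau>. p + q * \<tau>)" by (intro continuous_intros)
  have "continuous (at (p + q * \<tau>) within {0..1}) (\<lambda>s. tcoord M ?c (\<gamma> s) (V s))"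
    by (rule has_vector_derivative_continuous[OF geodesic_equation(2)[OF g t chart_at(1) chart_at(2)]])
  from continuous_within_compose[OF cl continuous_within_subset[OF this I]]
  have "continuous (at \<tau> within {a..b}) ((\<lambda>s. tcoord M ?c (\<gamma> s) (V s)) \<circ> (\<lambda>\<tau>. p + q * \<tau>))" .
  then have "continuous (at \<tau> within {a..b}) (\<lambda>\<tau>. q *\<^sub>R tcoord M ?c (\<gamma> (p + q * \<tau>)) (V (p + q * \<tau>)))"
    by (intro continuous_intros) (simp add: o_def)
  then have "continuous (at \<tau> within {a..b}) (\<lambda>\<tau>. tcoord M ?c (\<gamma> (p + q * \<tau>)) (q *\<^sub>R V (p + q * \<tau>)))"
  proof (rule continuous_transform_eventually)
    have "continuous (at \<tau> within {a..b}) (\<lambda>\<tau>. \<gamma> (p + q * \<tau>))"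
      using v unfolding has_velocity_def by blast
    from continuous_eventually_in_open[OF this chart_open[OF chart_at(1)] chart_at(2)]
    show "\<forall>\<^sub>F \<tau> in at \<tau> within {a..b}. q *\<^sub>R tcoord M ?c (\<gamma> (p + q * \<tau>)) (V (p + q * \<tau>)) =
        tcoord M ?c (\<gamma> (p + q * \<tau>)) (q *\<^sub>R V (p + q * \<tau>))"
      by eventually_elim (simp add: linear_cmul[OF tcoord_linear[OF chart_at(1)]])
  qed (simp add: tcoord_self)
  then show "\<exists>c\<in>atlas M. \<gamma> (p + q * \<tau>) \<in> fst c \<and>
      continuous (at \<tau> within {a..b}) (\<lambda>\<tau>. tcoord M c (\<gamma> (p + q * \<tau>)) (q *\<^sub>R V (p + q * \<tau>)))"
    using chart_at by blast
qed

text \<open>Transfers a velocity from a piece on its own interval to the glued curve on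
  \<open>{0..1}\<close>. The open set \<open>S\<close> restricts this to interior times of the
  piece, which is enough for lengths.\<close>

lemma has_velocity_local:
  assumes v: "has_velocity M I \<gamma> t \<xi>" and S: "open S" "t \<in> S" "S \<subseteq> I" "S \<subseteq> J"
    and e: "\<And>s. s \<in> S \<Longrightarrow> \<gamma>' s = \<gamma> s"
  shows "has_velocity M J \<gamma>' t \<xi>"
proof -
  have int: "t \<in> interior I" "t \<in> interior J"
    using interior_maximal[OF S(3,1)] interior_maximal[OF S(4,1)] S(2) by auto
  note I = at_within_interior[OF int(1)] at_within_interior[OF int(2)]
  have et: "\<gamma> t = \<gamma>' t" using e[OF S(2)] by simp
  have ev: "\<forall>\<^sub>F s in at t. \<gamma> s = \<gamma>' s"
    using eventually_at_in_open'[OF S(1,2)] by eventually_elim (simp add: e)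
  have cv: "continuous (at t) \<gamma>" "((snd (chart_at M (\<gamma> t)) \<circ> \<gamma>) has_vector_derivative \<xi>) (at t)"
    using v unfolding has_velocity_def I by auto
  have "((snd (chart_at M (\<gamma> t)) \<circ> \<gamma>') has_vector_derivative \<xi>) (at t)"
    by (rule has_vector_derivative_transform_within_open[OF cv(2) S(1,2)]) (simp add: e)
  moreover have "continuous (at t) \<gamma>'" by (rule continuous_transform_eventually[OF cv(1) ev et])
  ultimately show ?thesis unfolding has_velocity_def I(2) et[symmetric] by (intro conjI)
qed

section \<open>Lengths, and competitors for the distance\<close>

lemma curve_length_integrand:
  assumes "has_velocity M {0..1} \<gamma> t \<xi>" "t \<in> {0..1}"
  shows "gnorm M (\<gamma> t) (vector_derivative (snd (chart_at M (\<gamma> t)) \<circ> \<gamma>) (at t within {0..1})) = gnorm M (\<gamma> t) \<xi>"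
proof -
  have "vector_derivative (snd (chart_at M (\<gamma> t)) \<circ> \<gamma>) (at t within cbox 0 1) = \<xi>"
    by (rule vector_derivative_within_cbox) (use assms in \<open>simp_all add: has_velocity_def\<close>)
  then show ?thesis by simp
qed

text \<open>A speed that is not integrable has integral 0, so the sign is right for every curve;
  this bounds the infimum in \<open>rdist\<close> from below.\<close>

lemma curve_length_nonneg: "curve_length M \<gamma> \<ge> 0"
proof -
  have "0 \<le> integral {0..1} f" if "\<And>t. 0 \<le> f t" for f :: "real \<Rightarrow> real"
    by (cases "f integrable_on {0..1}") (simp_all add: integral_nonneg that not_integrable_integral)
  then show ?thesis unfolding curve_length_def by (simp add: gnorm_nonneg)
qed

text \<open>Velocities refer to the parametrization of the whole curve, so each half contributes its
  speed bound times its duration 1/2.\<close>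

lemma curve_length_two_pieces:
  assumes v: "\<And>t. t \<in> {0<..<1/2} \<Longrightarrow> has_velocity M {0..1} \<gamma> t (V t) \<and> gnorm M (\<gamma> t) (V t) \<le> A"
    and w: "\<And>t. t \<in> {1/2<..<1} \<Longrightarrow> has_velocity M {0..1} \<gamma> t (V t) \<and> gnorm M (\<gamma> t) (V t) \<le> B"
    and AB: "A \<ge> 0" "B \<ge> 0"
  shows "curve_length M \<gamma> \<le> (A + B) / 2"
proof -
  define f where "f t = gnorm M (\<gamma> t)
       (vector_derivative (snd (chart_at M (\<gamma> t)) \<circ> \<gamma>) (at t within {0..1}))" for t
  define h where "h t = (if t < 1/2 then A else B)" for t :: real
  have "(h has_integral A * (1/2)) {0..1/2}"
    by (rule has_integral_spike_finite[of "{1/2}" _ _ "\<lambda>_. A"])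
       (use has_integral_const_real[of A 0 "1/2"] in \<open>auto simp: h_def\<close>)
  moreover have "(h has_integral B * (1/2)) {1/2..1}"
    by (rule has_integral_eq[of _ "\<lambda>_. B"])
       (use has_integral_const_real[of B "1/2" 1] in \<open>auto simp: h_def\<close>)
  ultimately have h: "(h has_integral (A + B) / 2) {0..1}"
    using has_integral_combine[of 0 "1/2" 1 h] by (simp add: add_divide_distrib)
  show ?thesis
  proof (cases "f integrable_on {0..1}")
    case True
    \<comment> \<open>At the end points and at the corner the curve may lack a velocity, so the
      integrand is altered at these three times.\<close>
    define f' where "f' t = (if t \<in> {0, 1/2, 1} then 0 else f t)" for t
    have f': "(f' has_integral integral {0..1} f) {0..1}"
      by (rule has_integral_spike_finite[of "{0, 1/2, 1}" _ _ f])
         (use True in \<open>auto simp: f'_def integrable_integral\<close>)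
    have "integral {0..1} f \<le> (A + B) / 2"
    proof (rule has_integral_le[OF f' h])
      fix t :: real assume t: "t \<in> {0..1}"
      consider "t \<in> {0, 1/2, 1}" | "t \<in> {0<..<1/2}" | "t \<in> {1/2<..<1}" using t by force
      then show "f' t \<le> h t"
      proof cases
        case 1 then show ?thesis using AB by (auto simp: f'_def h_def)
      next
        case 2 then show ?thesis
          using v[OF 2] t curve_length_integrand[of \<gamma> t "V t"] by (auto simp: f'_def h_def f_def)
      next
        case 3 then show ?thesis
          using w[OF 3] t curve_length_integrand[of \<gamma> t "V t"] by (auto simp: f'_def h_def f_def)
      qed
    qed
    then show ?thesis unfolding curve_length_def f_def .
  next
    \<comment> \<open>The integral of a non-integrable function is 0, which respects the
      bound.\<close>
    case False
    then have "curve_length M \<gamma> = 0"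
      unfolding curve_length_def f_def by (rule not_integrable_integral)
    then show ?thesis using AB by simp
  qed
qed

text \<open>Distances are squared later, and monotonicity of the square needs the lower bound too.
  The given curve also shows that the infimum is over a nonempty set.\<close>

lemma rdist_curve_length:
  assumes "piecewise_C1_curve M \<gamma>" "\<gamma> 0 = x" "\<gamma> 1 = y"
  shows "rdist M x y \<in> {0..curve_length M \<gamma>}"
proof -
  let ?L = "{curve_length M \<gamma> |\<gamma>. piecewise_C1_curve M \<gamma> \<and> \<gamma> 0 = x \<and> \<gamma> 1 = y}"
  have L: "curve_length M \<gamma> \<in> ?L" using assms by blast
  have nn: "0 \<le> l" if "l \<in> ?L" for l using that curve_length_nonneg by auto
  have "Inf ?L \<le> curve_length M \<gamma>" by (rule cInf_lower[OF L bdd_belowI[OF nn]])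
  moreover have "0 \<le> Inf ?L" by (rule cInf_greatest[OF _ nn]) (use L in blast)
  ultimately show ?thesis unfolding rdist_def by simp
qed

lemma piecewise_C1_curveI:
  assumes "C1_curve M 0 (1/2) \<gamma>" "C1_curve M (1/2) 1 \<gamma>"
  shows "piecewise_C1_curve M \<gamma>"
  unfolding piecewise_C1_curve_def
  by (rule exI[of _ "{0, 1/2, 1}"]) (use assms in \<open>auto simp: disjoint_iff dest: spec[of _ "1/2"]\<close>)

lemma geodesic_length:
  assumes g: "geodesic_with \<gamma> V"
  shows "curve_length M \<gamma> = gnorm M (\<gamma> 0) (V 0)"
proof -
  have "curve_length M \<gamma> = integral {0..1} (\<lambda>t::real. gnorm M (\<gamma> 0) (V 0))"
    unfolding curve_length_def
  proof (rule integral_cong)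
    fix t :: real assume t: "t \<in> {0..1}"
    then show "gnorm M (\<gamma> t) (vector_derivative (snd (chart_at M (\<gamma> t)) \<circ> \<gamma>) (at t within {0..1}))
        = gnorm M (\<gamma> 0) (V 0)"
      using g curve_length_integrand[of \<gamma> t "V t"] geodesic_constant_speed[OF g t]
      unfolding geodesic_with_def by auto
  qed
  then show ?thesis by simp
qed

text \<open>The part of the geodesic after time \<open>s\<close>, stretched to
  \<open>{0..1}\<close>, competes for the distance; its speed is the constant speed times
  \<open>1 - s\<close>. The break at 1/2 is formal and allows the estimate for two pieces to be
  reused.\<close>

lemma rdist_geodesic_tail:
  assumes g: "geodesic_with \<gamma> V" and s: "s \<in> {0..1}"
  shows "rdist M (\<gamma> s) (\<gamma> 1) \<in> {0..(1 - s) * gnorm M (\<gamma> 0) (V 0)}"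
proof -
  let ?d = "\<lambda>\<tau>. \<gamma> (s + (1 - s) * \<tau>)"
  have I: "(\<lambda>\<tau>. s + (1 - s) * \<tau>) ` {0..1} \<subseteq> {0..1}"
  proof clarify
    fix \<tau> :: real assume "\<tau> \<in> {0..1}"
    then show "s + (1 - s) * \<tau> \<in> {0..1}"
      using s mult_left_le[of \<tau> "1 - s"] by auto
  qed
  have p: "piecewise_C1_curve M ?d"
    by (rule piecewise_C1_curveI; rule geodesic_affine_C1[OF g]; rule subset_trans[OF image_mono I]) auto
  have v: "has_velocity M {0..1} ?d \<tau> ((1 - s) *\<^sub>R V (s + (1 - s) * \<tau>)) \<and>
      gnorm M (?d \<tau>) ((1 - s) *\<^sub>R V (s + (1 - s) * \<tau>)) \<le> (1 - s) * gnorm M (\<gamma> 0) (V 0)"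
    if "\<tau> \<in> {0..1}" for \<tau>
  proof -
    have t: "s + (1 - s) * \<tau> \<in> {0..1}" using I that by blast
    then have "has_velocity M {0..1} \<gamma> (s + (1 - s) * \<tau>) (V (s + (1 - s) * \<tau>))"
      using g unfolding geodesic_with_def by blast
    from velocity_affine[OF this I] show ?thesis
      using geodesic_constant_speed[OF g t] s by (simp add: gnorm_scale)
  qed
  have "curve_length M ?d \<le>
      ((1 - s) * gnorm M (\<gamma> 0) (V 0) + (1 - s) * gnorm M (\<gamma> 0) (V 0)) / 2"
    by (rule curve_length_two_pieces[where V = "\<lambda>\<tau>. (1 - s) *\<^sub>R V (s + (1 - s) * \<tau>)"])
       (use v s gnorm_nonneg in auto)
  then show ?thesis using rdist_curve_length[OF p] by force
qed

text \<open>The competitor returns along the coordinate segment to \<open>\<gamma> 0\<close> and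
  then follows \<open>\<gamma>\<close>. As \<open>B\<close> bounds the metric norm of
  \<open>\<xi>\<close> all along the segment, the first half has length at most
  \<open>s * B\<close>.\<close>

lemma rdist_line_geodesic:
  assumes g: "geodesic_with \<gamma> V" and c: "c \<in> atlas M" "\<gamma> 0 \<in> fst c"
    and s: "s \<ge> 0" and B: "B \<ge> 0"
    and l: "\<And>\<tau>. \<tau> \<in> {0..s} \<Longrightarrow> snd c (\<gamma> 0) + \<tau> *\<^sub>R \<xi> \<in> snd c ` fst c \<and>
        G c (snd c (\<gamma> 0) + \<tau> *\<^sub>R \<xi>) \<xi> \<xi> \<le> B\<^sup>2"
  shows "rdist M (chart_inv c (snd c (\<gamma> 0) + s *\<^sub>R \<xi>)) (\<gamma> 1) \<in> {0..s * B + gnorm M (\<gamma> 0) (V 0)}"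
proof -
  define y where "y = snd c (\<gamma> 0)"
  \<comment> \<open>The segment runs backwards at double pace: \<open>z 0\<close> is the displaced
    point and \<open>z (1/2)\<close> is \<open>y\<close>.\<close>
  define z where "z \<tau> = y + (s * (1 - 2 * \<tau>)) *\<^sub>R \<xi>" for \<tau> :: real
  define p where "p \<tau> = chart_inv c (z \<tau>)" for \<tau>
  \<comment> \<open>The velocity has constant components in \<open>c\<close>; \<open>Jac\<close>
    converts them to the preferred chart, in which tangent vectors are represented.\<close>
  define W where "W \<tau> = Jac c (chart_at M (p \<tau>)) (p \<tau>) (- (2 * s) *\<^sub>R \<xi>)" for \<tau>
  define \<delta> where "\<delta> \<tau> = (if \<tau> \<le> 1/2 then p \<tau> else \<gamma> (-1 + 2 * \<tau>))" for \<tau>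
  have ts: "s * (1 - 2 * \<tau>) \<in> {0..s}" if "\<tau> \<in> {0..1/2}" for \<tau>
    using that s mult_left_le[of "1 - 2 * \<tau>" s] by auto
  have zc: "z \<tau> \<in> snd c ` fst c" "G c (z \<tau>) \<xi> \<xi> \<le> B\<^sup>2" if "\<tau> \<in> {0..1/2}" for \<tau>
    using l[OF ts[OF that]] unfolding z_def y_def by auto
  have pc: "p \<tau> \<in> fst c" "snd c (p \<tau>) = z \<tau>" if "\<tau> \<in> {0..1/2}" for \<tau>
    unfolding p_def using chart_inv_mem[OF c(1)] chart_inv_right[OF c(1)] zc(1)[OF that] by blast+
  have dz: "(z has_vector_derivative - (2 * s) *\<^sub>R \<xi>) (at \<tau> within J)" for \<tau> J
    unfolding z_def by (auto intro!: derivative_eq_intros simp: algebra_simps has_vector_derivative_def)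
  have vp: "has_velocity M {0..1/2} p \<tau> (W \<tau>)" if \<tau>: "\<tau> \<in> {0..1/2}" for \<tau>
    unfolding W_def
  proof (rule velocity_of_chart)
    show "\<tau> \<in> {0..1/2}" "c \<in> atlas M" "p \<tau> \<in> fst c" by (fact \<tau> c(1) pc(1)[OF \<tau>])+
    have "isCont (chart_inv c) (z \<tau>)"
      using chart_inv_continuous[OF c(1)] chart_image_open[OF c(1)] zc(1)[OF \<tau>]
        continuous_on_eq_continuous_at by blast
    then show "continuous (at \<tau> within {0..1/2}) p"
      unfolding p_def using has_vector_derivative_continuous[OF dz, of \<tau> "{0..1/2}"]
      by (simp add: continuous_within isCont_tendsto_compose)
    show "((snd c \<circ> p) has_vector_derivative - (2 * s) *\<^sub>R \<xi>) (at \<tau> within {0..1/2})"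
      by (rule has_vector_derivative_transform[OF \<tau> _ dz]) (simp add: pc(2))
  qed
  have tW: "tcoord M c (p \<tau>) (W \<tau>) = - (2 * s) *\<^sub>R \<xi>" if "\<tau> \<in> {0..1/2}" for \<tau>
    unfolding W_def tcoord_Jac by (rule Jac_inverse[OF c(1) chart_at(1) pc(1)[OF that] chart_at(2)])
  have nW: "gnorm M (p \<tau>) (W \<tau>) \<le> 2 * s * B" if \<tau>: "\<tau> \<in> {0..1/2}" for \<tau>
  proof (rule power2_le_imp_le)
    have "(gnorm M (p \<tau>) (W \<tau>))\<^sup>2 = (2 * s)\<^sup>2 * G c (z \<tau>) \<xi> \<xi>"
      unfolding gnorm_sq ginner_chart[OF c(1) pc(1)[OF \<tau>]] tW[OF \<tau>] pc(2)[OF \<tau>]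
        G_scale G_scale_right by (simp add: power2_eq_square)
    also have "\<dots> \<le> (2 * s)\<^sup>2 * B\<^sup>2" using zc(2)[OF \<tau>] by (intro mult_left_mono) auto
    finally show "(gnorm M (p \<tau>) (W \<tau>))\<^sup>2 \<le> (2 * s * B)\<^sup>2" by (simp add: power_mult_distrib)
  qed (use s B in simp)
  have C1: "C1_curve M 0 (1/2) \<delta>"
  proof (rule C1_curve_cong[of _ _ p])
    show "C1_curve M 0 (1/2) p"
    proof (rule C1_curveI[OF vp])
      fix t :: real assume t: "t \<in> {0..1/2}"
      have "continuous (at t within {0..1/2}) (\<lambda>s. tcoord M c (p s) (W s))"
        by (rule continuous_transform_eventually[of _ _ "\<lambda>_. - (2 * s) *\<^sub>R \<xi>"])
           (use t tW in \<open>auto simp: eventually_at intro!: exI[of _ 1]\<close>)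
      then show "\<exists>c\<in>atlas M. p t \<in> fst c \<and> continuous (at t within {0..1/2}) (\<lambda>s. tcoord M c (p s) (W s))"
        using c pc(1)[OF t] by blast
    qed
  qed (simp add: \<delta>_def)
  \<comment> \<open>The pieces agree at 1/2, where the case distinction in \<open>\<delta>\<close>
    takes the first one.\<close>
  have p12: "p (1/2) = \<gamma> 0" unfolding p_def z_def y_def using chart_inv_left[OF c] by simp
  have I2: "(\<lambda>\<tau>. -1 + 2 * \<tau>) ` {1/2..1} \<subseteq> {0..1::real}" by auto
  have C2: "C1_curve M (1/2) 1 \<delta>"
  proof (rule C1_curve_cong[OF geodesic_affine_C1[OF g I2]])
    fix t :: real assume "t \<in> {1/2..1}"
    then consider "t = 1/2" | "t > 1/2" by fastforce
    then show "\<delta> t = \<gamma> (-1 + 2 * t)"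
    proof cases
      case 1
      show ?thesis unfolding 1 \<delta>_def by (simp add: p12)
    qed (simp add: \<delta>_def)
  qed
  define U where "U \<tau> = (if \<tau> \<le> 1/2 then W \<tau> else 2 *\<^sub>R V (-1 + 2 * \<tau>))" for \<tau>
  have "curve_length M \<delta> \<le> (2 * s * B + 2 * gnorm M (\<gamma> 0) (V 0)) / 2"
  proof (rule curve_length_two_pieces[where V = U])
    fix t :: real assume t: "t \<in> {0<..<1/2}"
    have "has_velocity M {0..1} \<delta> t (W t)"
      by (rule has_velocity_local[OF vp, of t "{0<..<1/2}"]) (use t in \<open>auto simp: \<delta>_def\<close>)
    then show "has_velocity M {0..1} \<delta> t (U t) \<and> gnorm M (\<delta> t) (U t) \<le> 2 * s * B"
      using t nW[of t] by (auto simp: U_def \<delta>_def)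
  next
    fix t :: real assume t: "t \<in> {1/2<..<1}"
    have t': "-1 + 2 * t \<in> {0..1}" using t by auto
    have "has_velocity M {0..1} \<gamma> (-1 + 2 * t) (V (-1 + 2 * t))"
      using g t' unfolding geodesic_with_def by blast
    from velocity_affine[OF this I2]
    have "has_velocity M {0..1} \<delta> t (2 *\<^sub>R V (-1 + 2 * t))"
      by (rule has_velocity_local[of _ _ _ _ "{1/2<..<1}"]) (use t in \<open>auto simp: \<delta>_def\<close>)
    then show "has_velocity M {0..1} \<delta> t (U t) \<and> gnorm M (\<delta> t) (U t) \<le> 2 * gnorm M (\<gamma> 0) (V 0)"
      using t geodesic_constant_speed[OF g t'] by (auto simp: U_def \<delta>_def gnorm_scale)
  qed (use s B gnorm_nonneg in auto)
  moreover have "\<delta> 0 = chart_inv c (y + s *\<^sub>R \<xi>)" "\<delta> 1 = \<gamma> 1"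
    by (simp_all add: \<delta>_def p_def z_def)
  ultimately show ?thesis
    using rdist_curve_length[OF piecewise_C1_curveI[OF C1 C2]] unfolding y_def by force
qed

end

section \<open>The differential of the squared distance\<close>

text \<open>The difference quotients of \<open>h - f\<close> at \<open>a\<close> are nonnegative.
  This turns an upper bound for the distance that is attained at the starting point into a bound for
  the differential.\<close>

lemma vector_derivative_mono_at_left_end:
  fixes f h :: "real \<Rightarrow> real"
  assumes f: "(f has_vector_derivative D) (at a within {a..b})"
    and h: "(h has_vector_derivative E) (at a within {a..b})" and ab: "a < b"
    and le: "\<And>s. s \<in> {a..b} \<Longrightarrow> f s \<le> h s" and eq: "f a = h a"
  shows "D \<le> E"
proof -
  have "((\<lambda>s. h s - f s) has_vector_derivative (E - D)) (at a within {a..b})"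
    by (rule has_vector_derivative_diff[OF h f])
  then have "((\<lambda>s. ((h s - f s) - (h a - f a)) / (s - a)) \<longlongrightarrow> E - D) (at a within {a..b})"
    by (simp add: has_real_derivative_iff_has_vector_derivative[symmetric] has_field_derivative_iff)
  then have "0 \<le> E - D"
  proof (rule tendsto_lowerbound)
    show "\<forall>\<^sub>F s in at a within {a..b}. 0 \<le> ((h s - f s) - (h a - f a)) / (s - a)"
      unfolding eventually_at by (rule exI[of _ 1]) (auto simp: le eq)
    show "at a within {a..b} \<noteq> bot" using ab by (simp add: trivial_limit_within islimpt_Icc)
  qed
  then show ?thesis by simp
qed

lemma norm_increment_bound:
  fixes f :: "real \<Rightarrow> 'b::real_normed_vector"
  assumes "\<And>s. s \<in> {a..b} \<Longrightarrow> (f has_vector_derivative f' s) (at s within {a..b})"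
    and "\<And>s. s \<in> {a..b} \<Longrightarrow> norm (f' s) \<le> B" and "s \<in> {a..b}"
  shows "norm (f s - f a) \<le> B * (s - a)"
proof -
  have "norm (f s - f a) \<le> B * norm (s - a)"
  proof (rule differentiable_bound[of "{a..b}"])
    fix x assume x: "x \<in> {a..b}"
    show "(f has_derivative (\<lambda>h. h *\<^sub>R f' x)) (at x within {a..b})"
      using assms(1)[OF x] unfolding has_vector_derivative_def .
    show "onorm (\<lambda>h. h *\<^sub>R f' x) \<le> B"
      by (rule onorm_le, subst mult.commute) (use assms(2)[OF x] in \<open>simp add: mult_left_mono\<close>)
  qed (use assms(3) in auto)
  then show ?thesis using assms(3) by simp
qed

context riemann_mfd
begin

text \<open>The bound \<open>(1 - s) * len\<close> for the tail is attained at \<open>s = 0\<close>,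
  so the derivatives of the squares compare there. Taking squares also covers coinciding end points,
  where the distance itself has a kink.\<close>

lemma first_variation_forward:
  assumes g: "geodesic_with \<gamma> V" and c: "c \<in> atlas M" "\<gamma> 0 \<in> fst c"
    and l: "gnorm M (\<gamma> 0) (V 0) = rdist M (\<gamma> 0) (\<gamma> 1)"
    and F: "((\<lambda>y. (rdist M (chart_inv c y) (\<gamma> 1))\<^sup>2) has_derivative F') (at (snd c (\<gamma> 0)))"
  shows "F' (tcoord M c (\<gamma> 0) (V 0)) \<le> - 2 * (gnorm M (\<gamma> 0) (V 0))\<^sup>2"
proof -
  define len where "len = gnorm M (\<gamma> 0) (V 0)"
  have t0: "(0::real) \<in> {0..1}" by simp
  have ev: "\<forall>\<^sub>F s in at 0 within {0..1}. \<gamma> s \<in> fst c"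
    by (rule continuous_eventually_in_open[OF geodesic_continuous[OF g t0] chart_open[OF c(1)] c(2)])
  have "((\<lambda>s. (rdist M (chart_inv c ((snd c \<circ> \<gamma>) s)) (\<gamma> 1))\<^sup>2) has_vector_derivative
      F' (tcoord M c (\<gamma> 0) (V 0))) (at 0 within {0..1})"
    by (rule has_vector_derivative_chain[OF geodesic_equation(1)[OF g t0 c]])
       (use F in \<open>simp add: o_def\<close>)
  then have 1: "((\<lambda>s. (rdist M (\<gamma> s) (\<gamma> 1))\<^sup>2) has_vector_derivative
      F' (tcoord M c (\<gamma> 0) (V 0))) (at 0 within {0..1})"
  proof (rule has_vector_derivative_transform_eventually[OF _ t0])
    show "\<forall>\<^sub>F s in at 0 within {0..1}. (rdist M (chart_inv c ((snd c \<circ> \<gamma>) s)) (\<gamma> 1))\<^sup>2 =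
        (rdist M (\<gamma> s) (\<gamma> 1))\<^sup>2"
      using ev by eventually_elim (simp add: chart_inv_left[OF c(1)])
  qed (simp add: chart_inv_left[OF c])
  have 2: "((\<lambda>s. ((1 - s) * len)\<^sup>2) has_vector_derivative - 2 * len\<^sup>2) (at 0 within {0..1})"
    unfolding has_real_derivative_iff_has_vector_derivative[symmetric]
    by (auto intro!: derivative_eq_intros simp: power2_eq_square)
  have "F' (tcoord M c (\<gamma> 0) (V 0)) \<le> - 2 * len\<^sup>2"
  proof (rule vector_derivative_mono_at_left_end[OF 1 2])
    show "(rdist M (\<gamma> s) (\<gamma> 1))\<^sup>2 \<le> ((1 - s) * len)\<^sup>2" if "s \<in> {0..1}" for s
      using rdist_geodesic_tail[OF g that] unfolding len_def by (auto intro: power_mono)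
  qed (simp_all add: len_def l)
  then show ?thesis unfolding len_def .
qed

lemma first_variation_lipschitz:
  assumes g: "geodesic_with \<gamma> V" and c: "c \<in> atlas M" "\<gamma> 0 \<in> fst c"
    and l: "gnorm M (\<gamma> 0) (V 0) = rdist M (\<gamma> 0) (\<gamma> 1)"
    and F: "((\<lambda>y. (rdist M (chart_inv c y) (\<gamma> 1))\<^sup>2) has_derivative F') (at (snd c (\<gamma> 0)))"
  shows "F' (tcoord M c (\<gamma> 0) \<xi>) \<le> 2 * gnorm M (\<gamma> 0) (V 0) * gnorm M (\<gamma> 0) \<xi>"
proof -
  define len where "len = gnorm M (\<gamma> 0) (V 0)"
  define y where "y = snd c (\<gamma> 0)"
  define \<eta> where "\<eta> = tcoord M c (\<gamma> 0) \<xi>"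
  have len0: "len \<ge> 0" unfolding len_def by (rule gnorm_nonneg)
  have yc: "y \<in> snd c ` fst c" unfolding y_def using c by blast
  \<comment> \<open>The metric norm of the direction varies along the segment. With a slack
    \<open>B\<close> above its value at the start, the bound on the metric holds on a short segment
    by continuity.\<close>
  have B: "F' \<eta> \<le> 2 * B * len" if B: "gnorm M (\<gamma> 0) \<xi> < B" for B
  proof -
    have B0: "B \<ge> 0" using B gnorm_nonneg[of "\<gamma> 0" \<xi>] by linarith
    have dl: "((\<lambda>s. y + s *\<^sub>R \<eta>) has_vector_derivative \<eta>) (at s within J)" for s J
      by (auto intro!: derivative_eq_intros simp: has_vector_derivative_def)
    have "((\<lambda>s. G c (y + s *\<^sub>R \<eta>) \<eta> \<eta>) has_vector_derivative
        (DG c (y + 0 *\<^sub>R \<eta>) \<eta> \<eta> \<eta> + G c (y + 0 *\<^sub>R \<eta>) 0 \<eta> + G c (y + 0 *\<^sub>R \<eta>) \<eta> 0)) (at 0)"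
      by (rule has_vector_derivative_G[OF c(1) _ _ dl]) (use yc in auto)
    then have ct: "continuous (at 0) (\<lambda>s. G c (y + s *\<^sub>R \<eta>) \<eta> \<eta>)"
      by (rule has_vector_derivative_continuous)
    have "(gnorm M (\<gamma> 0) \<xi>)\<^sup>2 < B\<^sup>2" using B gnorm_nonneg by (intro power_strict_mono) auto
    then have "G c y \<eta> \<eta> < B\<^sup>2"
      unfolding gnorm_sq ginner_chart[OF c] \<eta>_def y_def .
    then have e1: "\<forall>\<^sub>F s in at 0. G c (y + s *\<^sub>R \<eta>) \<eta> \<eta> \<in> {..<B\<^sup>2}"
      by (intro continuous_eventually_in_open[OF ct]) auto
    have e2: "\<forall>\<^sub>F s in at 0. y + s *\<^sub>R \<eta> \<in> snd c ` fst c"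
      by (rule continuous_eventually_in_open[OF has_vector_derivative_continuous[OF dl] chart_image_open[OF c(1)]])
         (use yc in simp)
    obtain d where d: "d > 0" "\<And>s. s \<noteq> 0 \<Longrightarrow> \<bar>s\<bar> < d \<Longrightarrow>
        y + s *\<^sub>R \<eta> \<in> snd c ` fst c \<and> G c (y + s *\<^sub>R \<eta>) \<eta> \<eta> < B\<^sup>2"
      using eventually_conj[OF e1 e2] unfolding eventually_at by (auto simp: dist_real_def)
    define s0 where "s0 = d / 2"
    have s0: "s0 > 0" using d unfolding s0_def by simp
    have line: "y + s *\<^sub>R \<eta> \<in> snd c ` fst c \<and> G c (y + s *\<^sub>R \<eta>) \<eta> \<eta> \<le> B\<^sup>2" if "s \<in> {0..s0}" for s
      using d(2)[of s] that d(1) yc \<open>G c y \<eta> \<eta> < B\<^sup>2\<close> unfolding s0_def by (cases "s = 0") auto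
    have le: "(rdist M (chart_inv c (y + s *\<^sub>R \<eta>)) (\<gamma> 1))\<^sup>2 \<le> (s * B + len)\<^sup>2" if s: "s \<in> {0..s0}" for s
    proof -
      have "rdist M (chart_inv c (snd c (\<gamma> 0) + s *\<^sub>R \<eta>)) (\<gamma> 1) \<in> {0..s * B + gnorm M (\<gamma> 0) (V 0)}"
        by (rule rdist_line_geodesic[OF g c _ B0]) (use line s in \<open>auto simp: y_def\<close>)
      then show ?thesis unfolding y_def len_def by (auto intro: power_mono)
    qed
    have 1: "((\<lambda>s. (rdist M (chart_inv c (y + s *\<^sub>R \<eta>)) (\<gamma> 1))\<^sup>2) has_vector_derivative F' \<eta>)
        (at 0 within {0..s0})"
      by (rule has_vector_derivative_chain[OF dl]) (use F in \<open>simp add: y_def\<close>)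
    have 2: "((\<lambda>s. (s * B + len)\<^sup>2) has_vector_derivative 2 * B * len) (at 0 within {0..s0})"
      unfolding has_real_derivative_iff_has_vector_derivative[symmetric]
      by (auto intro!: derivative_eq_intros)
    show ?thesis
      by (rule vector_derivative_mono_at_left_end[OF 1 2 s0 le])
         (simp_all add: y_def len_def l chart_inv_left[OF c])
  qed
  \<comment> \<open>The slack is removed. For \<open>len = 0\<close> the bound with slack is already
    0; otherwise any \<open>w\<close> above the claimed bound is \<open>2 * B * len\<close> for an
    admissible \<open>B\<close>.\<close>
  have "F' \<eta> \<le> 2 * len * gnorm M (\<gamma> 0) \<xi>"
  proof (cases "len = 0")
    case True
    then show ?thesis using B[of "gnorm M (\<gamma> 0) \<xi> + 1"] by simp
  next
    case False
    then have len: "len > 0" using len0 by simp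
    show ?thesis
    proof (rule dense_ge)
      fix w assume "2 * len * gnorm M (\<gamma> 0) \<xi> < w"
      then show "F' \<eta> \<le> w" using B[of "w / (2 * len)"] len by (simp add: field_simps)
    qed
  qed
  then show ?thesis unfolding len_def \<eta>_def .
qed

text \<open>A covector of norm at most \<open>|r|\<close> which takes the value \<open>-|r|\<^sup>2\<close> at \<open>r\<close> has to be dual to \<open>-r\<close>;
  this replaces the first variation formula.\<close>

lemma first_variation:
  assumes g: "geodesic_with \<gamma> V" and c: "c \<in> atlas M" "\<gamma> 0 \<in> fst c"
    and l: "gnorm M (\<gamma> 0) (V 0) = rdist M (\<gamma> 0) (\<gamma> 1)"
    and F: "((\<lambda>y. (rdist M (chart_inv c y) (\<gamma> 1))\<^sup>2) has_derivative F') (at (snd c (\<gamma> 0)))"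
  shows "F' (tcoord M c (\<gamma> 0) \<xi>) \<le> - 2 * ginner M (\<gamma> 0) (V 0) \<xi>"
proof (rule ccontr)
  define x where "x = \<gamma> 0"
  define r where "r = V 0"
  define a where "a \<xi> = F' (tcoord M c x \<xi>)" for \<xi>
  assume "\<not> ?thesis"
  then have pos: "a \<xi> + 2 * ginner M x r \<xi> > 0" unfolding a_def x_def r_def by simp
  have "linear F'" using F has_derivative_linear by blast
  then have lin: "a (\<xi> - T *\<^sub>R r) = a \<xi> - T * a r" for T
    using tcoord_linear[OF c] unfolding a_def x_def by (simp add: linear_diff linear_cmul)
  have ar: "a r \<le> - 2 * (gnorm M x r)\<^sup>2"
    using first_variation_forward[OF g c l F] unfolding a_def x_def r_def .
  have lip: "a \<xi> \<le> 2 * gnorm M x r * gnorm M x \<xi>" for \<xi>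
    using first_variation_lipschitz[OF g c l F] unfolding a_def x_def r_def .
  define L where "L = (gnorm M x r)\<^sup>2"
  \<comment> \<open>For \<open>r = 0\<close> the norm bound makes \<open>a \<xi>\<close> nonpositive
    while the inner product vanishes, against \<open>pos\<close>.\<close>
  have r0: "r \<noteq> 0"
  proof
    assume "r = 0"
    then have "gnorm M x r = 0" "ginner M x r \<xi> = 0"
      using gnorm_eq_0 by (auto simp: ginner_G G_zero)
    then show False using pos lip[of \<xi>] by simp
  qed
  then have L: "L > 0" unfolding L_def using gnorm_eq_0 by simp
  define b where "b = a \<xi> / 2"
  define e where "e = b + ginner M x r \<xi>"
  have e: "e > 0" using pos unfolding e_def b_def by simp
  \<comment> \<open>The test vector is \<open>\<xi> - T *\<^sub>R r\<close>. The first summand makes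
    \<open>b + T * L\<close> nonnegative, so the inequality may be squared; the second makes
    \<open>2 * T * e\<close> exceed \<open>ginner M x \<xi> \<xi>\<close>.\<close>
  define T where "T = \<bar>b\<bar> / L + (ginner M x \<xi> \<xi> + 1) / (2 * e)"
  have T0: "T \<ge> 0" unfolding T_def using L e ginner_nonneg[of x \<xi>] by simp
  have "T \<ge> \<bar>b\<bar> / L" unfolding T_def using e ginner_nonneg[of x \<xi>] by simp
  then have bT: "b + T * L \<ge> 0" using L by (simp add: pos_divide_le_eq)
  have "2 * (b + T * L) \<le> a \<xi> - T * a r"
    using mult_left_mono[OF ar T0] unfolding b_def L_def by (simp add: algebra_simps)
  also have "\<dots> \<le> 2 * gnorm M x r * gnorm M x (\<xi> - T *\<^sub>R r)" using lip[of "\<xi> - T *\<^sub>R r"] lin by simp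
  finally have "b + T * L \<le> gnorm M x r * gnorm M x (\<xi> - T *\<^sub>R r)" by simp
  from power_mono[OF this bT, of 2]
  have "(b + T * L)\<^sup>2 \<le> L * ginner M x (\<xi> - T *\<^sub>R r) (\<xi> - T *\<^sub>R r)"
    by (simp add: power_mult_distrib gnorm_sq L_def)
  also have "ginner M x (\<xi> - T *\<^sub>R r) (\<xi> - T *\<^sub>R r) = ginner M x \<xi> \<xi> - 2 * T * ginner M x r \<xi> + T\<^sup>2 * L"
    unfolding L_def gnorm_sq
    by (simp add: ginner_diff ginner_sym[of x _ "\<xi> - T *\<^sub>R r"] ginner_scale ginner_sym[of x \<xi> r]
        power2_eq_square algebra_simps)
  \<comment> \<open>The terms quadratic in \<open>T\<close> cancel, because the norm bound is
    attained in the direction of \<open>r\<close>; what remains is linear in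
    \<open>T\<close>.\<close>
  finally have "b\<^sup>2 + L * (2 * T * e) \<le> L * ginner M x \<xi> \<xi>"
    unfolding e_def by (simp add: power2_eq_square algebra_simps)
  then have "L * (2 * T * e) \<le> L * ginner M x \<xi> \<xi>"
    using zero_le_power2[of b] by linarith
  then have "2 * T * e \<le> ginner M x \<xi> \<xi>" using L by simp
  moreover have "(ginner M x \<xi> \<xi> + 1) / (2 * e) \<le> T" unfolding T_def using L by simp
  then have "ginner M x \<xi> \<xi> + 1 \<le> 2 * T * e" using e by (simp add: field_simps)
  ultimately show False by simp
qed

section \<open>The chosen objects: logarithm, and exponential map and transport at trivial
  arguments\<close>

text \<open>Strong convexity gives the choice in \<open>Log\<close> a candidate. Uniqueness of
  velocities identifies the chosen vector with \<open>V 0\<close>, and by constant speed its norm is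
  the length, which is the distance.\<close>

lemma Log_geodesic:
  assumes "strongly_convex M U" "x \<in> U" "q \<in> U"
  obtains \<gamma> V where "geodesic_with \<gamma> V" "\<gamma> 0 = x" "\<gamma> 1 = q" "V 0 = Log M x q"
    "gnorm M x (Log M x q) = rdist M x q"
proof -
  obtain \<gamma>0 where "minimizing_geodesic M \<gamma>0 x q"
    using assms unfolding strongly_convex_def by blast
  then have "\<exists>\<xi> \<gamma>. minimizing_geodesic M \<gamma> x q \<and> has_velocity M {0..1} \<gamma> 0 \<xi>"
    unfolding minimizing_geodesic_def geodesic_def by fastforce
  from someI_ex[OF this] obtain \<gamma> where m: "minimizing_geodesic M \<gamma> x q"
    and v: "has_velocity M {0..1} \<gamma> 0 (Log M x q)" unfolding Log_def by blast
  obtain V where g: "geodesic_with \<gamma> V" and e: "\<gamma> 0 = x" "\<gamma> 1 = q"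
    and l: "curve_length M \<gamma> = rdist M x q"
    using m unfolding minimizing_geodesic_def geodesic_iff by blast
  have "V 0 = Log M x q"
    by (rule velocity_unique[OF _ v]) (use g in \<open>auto simp: geodesic_with_def\<close>)
  then show ?thesis using that[OF g e] geodesic_length[OF g] l e by simp
qed

text \<open>Constant speed makes the velocity vanish at all times; the curve is then constant in a
  chart near each time, and \<open>{0..1}\<close> is connected.\<close>

lemma geodesic_zero:
  assumes g: "geodesic_with \<gamma> V" and V0: "V 0 = 0" and s: "s \<in> {0..1}"
  shows "\<gamma> s = \<gamma> 0"
proof -
  have z: "gnorm M (\<gamma> 0) (V 0) = 0" by (simp add: gnorm_eq_0 V0)
  have V: "V t = 0" if "t \<in> {0..1}" for t
    using geodesic_constant_speed[OF g that] unfolding z gnorm_eq_0 .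
  have "\<gamma> constant_on {0..1}"
  proof (rule locally_constant_imp_constant)
    fix t :: real assume t: "t \<in> {0..1}"
    define c where "c = chart_at M (\<gamma> t)"
    have c: "c \<in> atlas M" "\<gamma> t \<in> fst c" unfolding c_def using chart_at by auto
    obtain d where d: "d > 0" "\<And>s. s \<in> {0..1} \<Longrightarrow> s \<noteq> t \<Longrightarrow> dist s t < d \<Longrightarrow> \<gamma> s \<in> fst c"
      using continuous_eventually_in_open[OF geodesic_continuous[OF g t] chart_open[OF c(1)] c(2)]
      unfolding eventually_at by blast
    define J where "J = {0..1} \<inter> ball t d"
    have Jc: "\<gamma> s \<in> fst c" if "s \<in> J" for s using that d(2)[of s] c(2)
      by (cases "s = t") (simp_all add: J_def dist_commute)
    have "((snd c \<circ> \<gamma>) has_derivative (\<lambda>h. 0)) (at s within J)" if sJ: "s \<in> J" for s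
    proof -
      have s: "s \<in> {0..1}" using sJ by (simp add: J_def)
      have "((snd c \<circ> \<gamma>) has_vector_derivative 0) (at s within {0..1})"
        using geodesic_equation(1)[OF g s c(1) Jc[OF sJ]] V[OF s]
          linear_0[OF tcoord_linear[OF c(1) Jc[OF sJ]]] by simp
      from has_vector_derivative_within_subset[OF this, of J] show ?thesis
        by (simp add: J_def has_vector_derivative_def)
    qed
    moreover have "convex J" unfolding J_def by (intro convex_Int convex_ball convex_real_interval)
    ultimately obtain k where k: "\<And>s. s \<in> J \<Longrightarrow> (snd c \<circ> \<gamma>) s = k"
      using has_derivative_zero_constant[of J "snd c \<circ> \<gamma>"] by blast
    have tJ: "t \<in> J" using t d by (simp add: J_def)
    have op: "openin (top_of_set {0..1}) J" unfolding J_def by (simp add: openin_open_Int)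
    have "\<gamma> s = \<gamma> t" if "s \<in> J" for s
      using k[OF that] k[OF tJ] chart_inv_left[OF c(1) Jc[OF that]] chart_inv_left[OF c] by simp
    then show "\<exists>T. openin (top_of_set {0..1}) T \<and> t \<in> T \<and> (\<forall>s\<in>T. \<gamma> s = \<gamma> t)"
      using op tJ by blast
  qed auto
  then show ?thesis using s unfolding constant_on_def by fastforce
qed

text \<open>The tail bound at \<open>s = 1\<close> gives distance 0 from a point to itself, and this
  distance is the norm of the logarithm.\<close>

lemma Log_self:
  assumes "strongly_convex M U" "x \<in> U"
  shows "Log M x x = 0"
proof -
  obtain \<gamma> V where g: "geodesic_with \<gamma> V" "\<gamma> 1 = x"
    and l: "gnorm M x (Log M x x) = rdist M x x"
    by (rule Log_geodesic[OF assms assms(2)])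
  have "rdist M x x = 0" using rdist_geodesic_tail[OF g(1), of 1] g(2) by simp
  then show ?thesis using l gnorm_eq_0 by simp
qed

text \<open>The geodesic behind \<open>Log M x x\<close> shows that the choice in \<open>Exp\<close>
  has a candidate; whichever is chosen has initial velocity 0 and is therefore constant.\<close>

lemma Exp_zero:
  assumes "strongly_convex M U" "x \<in> U"
  shows "Exp M x 0 = x"
proof -
  obtain \<gamma> V where g: "geodesic_with \<gamma> V" "\<gamma> 0 = x" "\<gamma> 1 = x" "V 0 = 0"
    by (rule Log_geodesic[OF assms assms(2), unfolded Log_self[OF assms]])
  have "geodesic_from M x 0 \<gamma>"
    using g unfolding geodesic_from_def geodesic_iff geodesic_with_def by force
  then have "\<exists>y. \<exists>\<gamma>. geodesic_from M x 0 \<gamma> \<and> \<gamma> 1 = y" by blast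
  from someI_ex[OF this] obtain \<gamma>' where g': "geodesic_from M x 0 \<gamma>'" "\<gamma>' 1 = Exp M x 0"
    unfolding Exp_def by blast
  then obtain V' where V': "geodesic_with \<gamma>' V'" "\<gamma>' 0 = x" "has_velocity M {0..1} \<gamma>' 0 0"
    unfolding geodesic_from_def geodesic_iff by blast
  have "V' 0 = 0"
    by (rule velocity_unique[OF _ V'(3)]) (use V'(1) in \<open>auto simp: geodesic_with_def\<close>)
  then show ?thesis using geodesic_zero[OF V'(1), of 1] g'(2) V'(2) by simp
qed

text \<open>A constant curve has velocity 0, so the Christoffel term drops out and parallel fields
  have derivative 0 in the preferred chart.\<close>

lemma parallel_transport_along_const:
  "parallel_transport_along M (\<lambda>s. x) u = u"
proof -
  have v: "has_velocity M {0..1} (\<lambda>s. x) s 0" for s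
    unfolding has_velocity_def by (simp add: o_def)
  have "has_covariant_derivative M {0..1} (\<lambda>s. x) (\<lambda>s. u) s 0" for s
    unfolding has_covariant_derivative_def Let_def
    by (rule exI[of _ 0], rule exI[of _ 0]) (use v in \<open>auto simp: vec_eq_iff\<close>)
  then have "\<exists>\<eta>. \<exists>V. V 0 = u \<and> V 1 = \<eta> \<and>
      (\<forall>s\<in>{0..1}. has_covariant_derivative M {0..1} (\<lambda>s. x) V s 0)"
    by (intro exI[of _ u] exI[of _ "\<lambda>s. u"]) auto
  from someI_ex[OF this] obtain V where V: "V 0 = u" "V 1 = parallel_transport_along M (\<lambda>s. x) u"
    and cov: "\<And>s. s \<in> {0..1} \<Longrightarrow> has_covariant_derivative M {0..1} (\<lambda>s. x) V s 0"
    unfolding parallel_transport_along_def by blast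
  have "(V has_vector_derivative 0) (at s within {0..1})" if s: "s \<in> {0..1}" for s
  proof -
    obtain \<xi> D where xi: "has_velocity M {0..1} (\<lambda>s. x) s \<xi>"
      and D: "((\<lambda>t. tcoord M (chart_at M x) x (V t)) has_vector_derivative D) (at s within {0..1})"
      and e: "0 = D + (\<chi> l. \<Sum>i\<in>UNIV. \<Sum>j\<in>UNIV.
          christoffel M (chart_at M x) l i j (snd (chart_at M x) x) * \<xi> $ i * V s $ j)"
      using cov[OF s] unfolding has_covariant_derivative_def Let_def by blast
    have "\<xi> = 0" by (rule velocity_unique[OF xi v]) (use s in auto)
    with e have "0 = D + 0" by (simp add: vec_eq_iff)
    with D show ?thesis by (simp add: tcoord_self)
  qed
  then have "V 1 = V 0"
    using norm_increment_bound[of 0 1 V "\<lambda>_. 0" 0 1] by simp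
  then show ?thesis using V by simp
qed

text \<open>Lets the local bound on the transported control be read at the initial time as a bound
  on the control itself.\<close>

lemma parallel_transport_self:
  assumes "strongly_convex M U" "x \<in> U"
  shows "parallel_transport M x x u = u"
  unfolding parallel_transport_def Log_self[OF assms] scaleR_zero_right Exp_zero[OF assms]
  by (rule parallel_transport_along_const)

end

section \<open>Second-order estimate along short geodesics\<close>

text \<open>The mean value inequality is used twice, for \<open>f'\<close> and for
  \<open>\<lambda>s. f s - s * f' 0\<close>; this yields \<open>B\<close> instead of
  \<open>B / 2\<close>, which only affects constants.\<close>

lemma taylor_first_order_bound:
  fixes f :: "real \<Rightarrow> real"
  assumes f: "\<And>s. s \<in> {0..1} \<Longrightarrow> (f has_vector_derivative f' s) (at s within {0..1})"
    and f': "\<And>s. s \<in> {0..1} \<Longrightarrow> (f' has_vector_derivative f'' s) (at s within {0..1})"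
    and B: "\<And>s. s \<in> {0..1} \<Longrightarrow> \<bar>f'' s\<bar> \<le> B"
  shows "f 1 \<le> f 0 + f' 0 + B"
proof -
  have B0: "B \<ge> 0" using B[of 0] by simp
  have d: "norm (f' s - f' 0) \<le> B" if s: "s \<in> {0..1}" for s
  proof -
    have "norm (f' s - f' 0) \<le> B * (s - 0)"
      by (rule norm_increment_bound[OF f' _ s]) (use B in auto)
    also have "\<dots> \<le> B * 1" using s B0 by (intro mult_left_mono) auto
    finally show ?thesis by simp
  qed
  have "norm ((f 1 - 1 * f' 0) - (f 0 - 0 * f' 0)) \<le> B * (1 - 0)"
  proof (rule norm_increment_bound[where f' = "\<lambda>s. f' s - f' 0"])
    fix s :: real assume s: "s \<in> {0..1}"
    show "((\<lambda>s. f s - s * f' 0) has_vector_derivative f' s - f' 0) (at s within {0..1})"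
      using f[OF s] unfolding has_real_derivative_iff_has_vector_derivative[symmetric]
      by (auto intro!: derivative_eq_intros)
  qed (use d in auto)
  then show ?thesis by simp
qed

context riemann_mfd
begin

text \<open>The lower bound is the minimum of the metric over \<open>C\<close> times the unit
  sphere, extended by homogeneity. Together with the Koszul formula it bounds the Christoffel
  term.\<close>

lemma metric_bounds_compact:
  assumes c: "c \<in> atlas M" and C: "compact C" "C \<subseteq> snd c ` fst c" "C \<noteq> {}"
  obtains \<mu> K where "\<mu> > 0" "K \<ge> 0"
    "\<And>y \<xi>. y \<in> C \<Longrightarrow> (\<mu> * norm \<xi>)\<^sup>2 \<le> G c y \<xi> \<xi>"
    "\<And>y \<xi>. y \<in> C \<Longrightarrow> norm (Chr c y \<xi> \<xi>) \<le> K * (norm \<xi>)\<^sup>2"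
proof -
  let ?S = "C \<times> sphere (0::real^'d) 1"
  have cm: "continuous_on ?S (\<lambda>p. metric M c (fst p))"
    by (rule continuous_on_compose2[OF smooth_on_continuous[OF metric_smooth[OF c]]])
       (use C in \<open>auto intro!: continuous_intros\<close>)
  have cG: "continuous_on ?S (\<lambda>p. G c (fst p) (snd p) (snd p))"
    unfolding G_def
    by (intro continuous_on_inner bounded_bilinear.continuous_on[OF bounded_bilinear_matrix_vector_mult]
        cm continuous_on_snd continuous_on_id)
  have "axis undefined 1 \<in> sphere (0::real^'d) 1" by (simp add: norm_axis_1)
  then have "?S \<noteq> {}" using C(3) by blast
  then obtain p where p: "p \<in> ?S" "\<And>p'. p' \<in> ?S \<Longrightarrow> G c (fst p) (snd p) (snd p) \<le> G c (fst p') (snd p') (snd p')"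
    using continuous_attains_inf[OF compact_Times[OF C(1) compact_sphere] _ cG] by blast
  define m where "m = G c (fst p) (snd p) (snd p)"
  have "snd p \<noteq> 0" using p(1) by auto
  then have m: "m > 0" unfolding m_def using p(1) C(2) by (intro G_pos[OF c]) auto
  define \<mu> where "\<mu> = sqrt m"
  have \<mu>: "\<mu> > 0" "\<mu>\<^sup>2 = m" unfolding \<mu>_def using m by auto
  have low: "(\<mu> * norm \<xi>)\<^sup>2 \<le> G c y \<xi> \<xi>" if y: "y \<in> C" for y \<xi>
  proof (cases "\<xi> = 0")
    case True
    then show ?thesis by (simp add: G_zero)
  next
    case False
    define u where "u = (1 / norm \<xi>) *\<^sub>R \<xi>"
    have "norm u = 1" using False by (simp add: u_def)
    then have "m \<le> G c y u u" using p(2)[of "(y, u)"] y unfolding m_def by simp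
    then have "(norm \<xi>)\<^sup>2 * m \<le> (norm \<xi>)\<^sup>2 * G c y u u" by (rule mult_left_mono) simp
    also have "\<dots> = G c y (norm \<xi> *\<^sub>R u) (norm \<xi> *\<^sub>R u)"
      by (simp add: G_scale G_scale_right power2_eq_square)
    also have "norm \<xi> *\<^sub>R u = \<xi>" using False by (simp add: u_def)
    finally show ?thesis by (simp add: power_mult_distrib \<mu> mult.commute)
  qed
  obtain K where K: "K \<ge> 0"
    "\<And>y h. y \<in> C \<Longrightarrow> norm (frechet_derivative (metric M c) (at y) h) \<le> K * norm h"
    by (rule smooth_on_bound_compact[OF metric_smooth[OF c] chart_image_open[OF c] C(1,2)]) blast
  obtain b where b: "b > 0" "\<And>(A :: real^'d^'d) v. norm (A *v v) \<le> norm A * norm v * b"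
    using bounded_bilinear.pos_bounded[OF bounded_bilinear_matrix_vector_mult] by blast
  have DG: "\<bar>DG c y \<zeta> \<xi> \<eta>\<bar> \<le> K * b * norm \<zeta> * norm \<xi> * norm \<eta>" if y: "y \<in> C" for y \<zeta> \<xi> \<eta>
  proof -
    have "\<bar>DG c y \<zeta> \<xi> \<eta>\<bar> \<le> norm \<xi> * norm (frechet_derivative (metric M c) (at y) \<zeta> *v \<eta>)"
      unfolding DG_def by (rule Cauchy_Schwarz_ineq2)
    also have "\<dots> \<le> norm \<xi> * (norm (frechet_derivative (metric M c) (at y) \<zeta>) * norm \<eta> * b)"
      by (intro mult_left_mono b) auto
    also have "\<dots> \<le> norm \<xi> * (K * norm \<zeta> * norm \<eta> * b)"
      using K(2)[OF y] b(1) by (intro mult_left_mono mult_right_mono) auto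
    finally show ?thesis by (simp add: mult_ac)
  qed
  define K' where "K' = 2 * K * b / m"
  have Chr: "norm (Chr c y \<xi> \<xi>) \<le> K' * (norm \<xi>)\<^sup>2" if y: "y \<in> C" for y \<xi>
  proof -
    let ?x = "Chr c y \<xi> \<xi>"
    have yc: "y \<in> snd c ` fst c" using y C by blast
    \<comment> \<open>The Koszul formula is tested with \<open>?x\<close> itself; one factor
      \<open>norm ?x\<close> cancels afterwards.\<close>
    have "m * (norm ?x)\<^sup>2 \<le> G c y ?x ?x"
      using low[OF y, of ?x] by (simp add: power_mult_distrib \<mu>)
    also have "\<dots> \<le> \<bar>DG c y \<xi> \<xi> ?x\<bar> + \<bar>DG c y ?x \<xi> \<xi>\<bar>"
      unfolding Chr_koszul[OF c yc] by linarith
    also have "\<dots> \<le> 2 * (K * b * (norm \<xi>)\<^sup>2 * norm ?x)"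
      using DG[OF y, of \<xi> \<xi> ?x] DG[OF y, of ?x \<xi> \<xi>] by (simp add: power2_eq_square mult_ac)
    finally have "norm ?x * (m * norm ?x) \<le> norm ?x * (2 * K * b * (norm \<xi>)\<^sup>2)"
      by (simp add: power2_eq_square mult_ac)
    then have "m * norm ?x \<le> 2 * K * b * (norm \<xi>)\<^sup>2"
      using K(1) b(1) by (cases "?x = 0") auto
    then show ?thesis unfolding K'_def using m by (simp add: field_simps)
  qed
  have "K' \<ge> 0" unfolding K'_def using K b m by simp
  then show ?thesis using that \<mu>(1) low Chr by blast
qed

text \<open>Inside the closed ball the coordinate speed is at most the initial speed over
  \<open>\<mu>\<close>, hence less than \<open>e\<close>. A curve starting within \<open>e\<close>
  of \<open>y0\<close> thus cannot get as far as \<open>2 * e\<close> by time 1; the argument is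
  carried out at the first exit time.\<close>

lemma geodesic_stays_in_chart:
  assumes g: "geodesic_with \<gamma> V" and c: "c \<in> atlas M" "\<gamma> 0 \<in> fst c"
    and C: "cball y0 (2 * e) \<subseteq> snd c ` fst c" and y0: "snd c (\<gamma> 0) \<in> ball y0 e"
    and low: "\<And>y \<xi>. y \<in> cball y0 (2 * e) \<Longrightarrow> (\<mu> * norm \<xi>)\<^sup>2 \<le> G c y \<xi> \<xi>" and \<mu>: "\<mu> > 0"
    and n: "gnorm M (\<gamma> 0) (V 0) < e * \<mu>" and s: "s \<in> {0..1}"
  shows "\<gamma> s \<in> fst c" "snd c (\<gamma> s) \<in> cball y0 (2 * e)"
    "norm (tcoord M c (\<gamma> s) (V s)) \<le> gnorm M (\<gamma> 0) (V 0) / \<mu>"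
proof -
  let ?K = "chart_inv c ` cball y0 (2 * e)" and ?O = "chart_inv c ` ball y0 (2 * e)"
  define n where "n = gnorm M (\<gamma> 0) (V 0)"
  have e: "e > 0"
    using y0 zero_le_dist[of y0 "snd c (\<gamma> 0)"] unfolding mem_ball by linarith
  have Kc: "\<gamma> s \<in> fst c \<and> snd c (\<gamma> s) \<in> cball y0 (2 * e)" if "\<gamma> s \<in> ?K" for s
    using that C chart_inv_mem[OF c(1)] chart_inv_right[OF c(1)] by force
  have W: "norm (tcoord M c (\<gamma> s) (V s)) \<le> n / \<mu>" if s: "s \<in> {0..1}" and K: "\<gamma> s \<in> ?K" for s
  proof -
    have "(\<mu> * norm (tcoord M c (\<gamma> s) (V s)))\<^sup>2 \<le> n\<^sup>2"
      using low[of "snd c (\<gamma> s)" "tcoord M c (\<gamma> s) (V s)"] Kc[OF K]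
      unfolding n_def geodesic_constant_speed[OF g s, symmetric] gnorm_sq
      by (simp add: ginner_chart[OF c(1)])
    then have "\<mu> * norm (tcoord M c (\<gamma> s) (V s)) \<le> n"
      by (rule power2_le_imp_le) (simp add: n_def gnorm_nonneg)
    then show ?thesis using \<mu> by (simp add: field_simps)
  qed
  have cont: "continuous_on {0..1} \<gamma>"
    using geodesic_continuous[OF g] continuous_on_eq_continuous_within by blast
  \<comment> \<open>A compact set in a Hausdorff space is closed. So the limit at the exit time
    still lies in the chart: the curve cannot leave the chart domain while its coordinates stay in
    the ball.\<close>
  have clK: "closed ?K"
    by (intro compact_imp_closed compact_continuous_image compact_cball
        continuous_on_subset[OF chart_inv_continuous[OF c(1)] C])
  have opO: "open ?O"
  proof -
    have OC: "ball y0 (2 * e) \<subseteq> snd c ` fst c" using C ball_subset_cball by blast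
    have "?O = fst c \<inter> snd c -` ball y0 (2 * e)"
    proof (intro equalityI subsetI)
      fix z assume "z \<in> ?O"
      then show "z \<in> fst c \<inter> snd c -` ball y0 (2 * e)"
        using OC chart_inv_mem[OF c(1)] chart_inv_right[OF c(1)] by force
    next
      fix z assume "z \<in> fst c \<inter> snd c -` ball y0 (2 * e)"
      then show "z \<in> ?O" using chart_inv_left[OF c(1), of z] by (metis IntE imageI vimageE)
    qed
    then show ?thesis
      using continuous_open_preimage[OF chart_continuous[OF c(1)] chart_open[OF c(1)] open_ball] by simp
  qed
  have OK: "?O \<subseteq> ?K" by (intro image_mono ball_subset_cball)
  have inO: "\<gamma> s \<in> ?O" if s: "s \<in> {0..1}" for s
  proof (rule ccontr)
    assume ns: "\<gamma> s \<notin> ?O"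
    define B where "B = {0..1} \<inter> \<gamma> -` (- ?O)"
    have "closed B" unfolding B_def
      by (rule continuous_closed_preimage[OF cont closed_atLeastAtMost]) (use opO in \<open>simp add: closed_Compl\<close>)
    moreover have "B \<noteq> {}" using s ns unfolding B_def by blast
    moreover have bb: "bdd_below B" unfolding B_def by (rule bdd_belowI[of _ 0]) auto
    ultimately have inf: "Inf B \<in> B" using closed_contains_Inf by blast
    \<comment> \<open>The first time at which the curve is outside the image of the open
      ball.\<close>
    define \<tau> where "\<tau> = Inf B"
    have \<tau>: "\<tau> \<in> {0..1}" "\<gamma> \<tau> \<notin> ?O" using inf unfolding B_def \<tau>_def by auto
    have lt: "\<gamma> t \<in> ?O" if "0 \<le> t" "t < \<tau>" for t
      using cInf_lower[OF _ bb, of t] that \<tau>(1) unfolding \<tau>_def B_def by fastforce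
    have g0: "\<gamma> 0 \<in> ?O"
      using y0 e chart_inv_left[OF c] by (intro image_eqI[of _ _ "snd c (\<gamma> 0)"]) (auto simp: dist_norm)
    then have \<tau>0: "\<tau> > 0" using \<tau> by (cases "\<tau> = 0") auto
    have tK: "\<gamma> \<tau> \<in> ?K"
    proof -
      have "(\<gamma> \<longlongrightarrow> \<gamma> \<tau>) (at \<tau> within {0..1})"
        using geodesic_continuous[OF g \<tau>(1)] by (simp add: continuous_within)
      then have "(\<gamma> \<longlongrightarrow> \<gamma> \<tau>) (at \<tau> within {0..<\<tau>})"
        by (rule tendsto_within_subset) (use \<tau>(1) in auto)
      moreover have "\<forall>\<^sub>F t in at \<tau> within {0..<\<tau>}. \<gamma> t \<in> ?K"
        unfolding eventually_at using lt OK by (intro exI[of _ 1]) auto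
      moreover have "at \<tau> within {0..<\<tau>} \<noteq> bot"
        using \<tau>0 by (simp add: trivial_limit_within islimpt_Ico)
      ultimately show ?thesis using Lim_in_closed_set[OF clK] by blast
    qed
    have K: "\<gamma> t \<in> ?K" if "t \<in> {0..\<tau>}" for t
      using that tK lt[of t] OK by (cases "t = \<tau>") auto
    have "norm ((snd c \<circ> \<gamma>) \<tau> - (snd c \<circ> \<gamma>) 0) \<le> n / \<mu> * (\<tau> - 0)"
    proof (rule norm_increment_bound[where f' = "\<lambda>t. tcoord M c (\<gamma> t) (V t)"])
      fix t assume t: "t \<in> {0..\<tau>}"
      then have t1: "t \<in> {0..1}" using \<tau>(1) by auto
      show "norm (tcoord M c (\<gamma> t) (V t)) \<le> n / \<mu>" by (rule W[OF t1 K[OF t]])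
      show "((snd c \<circ> \<gamma>) has_vector_derivative tcoord M c (\<gamma> t) (V t)) (at t within {0..\<tau>})"
        by (rule has_vector_derivative_within_subset[OF geodesic_equation(1)[OF g t1 c(1)]])
           (use Kc[OF K[OF t]] \<tau>(1) in auto)
    qed (use \<tau>0 in auto)
    also have "\<dots> \<le> n / \<mu> * 1"
      using \<tau>(1) \<mu> by (intro mult_left_mono) (auto simp: n_def gnorm_nonneg)
    also have "\<dots> < e" using n \<mu> by (simp add: n_def field_simps)
    finally have "dist (snd c (\<gamma> 0)) (snd c (\<gamma> \<tau>)) < e" by (simp add: dist_norm norm_minus_commute)
    moreover have "dist y0 (snd c (\<gamma> 0)) < e" using y0 by simp
    ultimately have "snd c (\<gamma> \<tau>) \<in> ball y0 (2 * e)"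
      using dist_triangle[of y0 "snd c (\<gamma> \<tau>)" "snd c (\<gamma> 0)"] by simp
    then have "\<gamma> \<tau> \<in> ?O" using chart_inv_left[OF c(1)] Kc[OF tK] by (metis imageI)
    then show False using \<tau>(2) by blast
  qed
  have "\<gamma> s \<in> ?K" using inO[OF s] OK by blast
  then show "\<gamma> s \<in> fst c" "snd c (\<gamma> s) \<in> cball y0 (2 * e)"
    "norm (tcoord M c (\<gamma> s) (V s)) \<le> gnorm M (\<gamma> 0) (V 0) / \<mu>"
    using Kc W[OF s] unfolding n_def by blast+
qed

text \<open>\<open>K\<close> is the second-order constant and \<open>\<delta>\<close> limits the
  initial speed. All geodesics with the given start are covered, wherever they run, hence also the
  one selected by \<open>Exp\<close>.\<close>

definition descent_at :: "real \<Rightarrow> real \<Rightarrow> 'm \<Rightarrow> 'm \<Rightarrow> bool" where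
  "descent_at K \<delta> x q \<longleftrightarrow> (\<forall>\<gamma> V. geodesic_with \<gamma> V \<and> \<gamma> 0 = x \<and> gnorm M x (V 0) < \<delta> \<longrightarrow>
     (rdist M (\<gamma> 1) q)\<^sup>2 \<le>
       (rdist M x q)\<^sup>2 - 2 * ginner M x (Log M x q) (V 0) + K * (gnorm M x (V 0))\<^sup>2)"

text \<open>The second derivative of \<open>F\<close> along a geodesic is its second differential on
  the coordinate velocity plus its differential on the acceleration, which the geodesic equation
  expresses by \<open>Chr\<close>. Both are quadratic in the velocity, with constants that depend
  only on balls around \<open>x0\<close> and \<open>q0\<close>.\<close>

lemma descent_locally:
  assumes U: "strongly_convex M U" "Log_dist_smooth M U" and x0: "x0 \<in> U" and q0: "q0 \<in> U"
  shows "\<exists>N K \<delta>. open N \<and> (x0, q0) \<in> N \<and> K \<ge> 0 \<and> \<delta> > 0 \<and>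
    (\<forall>x\<in>U. \<forall>q\<in>U. (x, q) \<in> N \<longrightarrow> descent_at K \<delta> x q)"
proof -
  define c where "c = chart_at M x0"
  define c' where "c' = chart_at M q0"
  have c: "c \<in> atlas M" "x0 \<in> fst c" and c': "c' \<in> atlas M" "q0 \<in> fst c'"
    unfolding c_def c'_def using chart_at by auto
  define F where "F = (\<lambda>(y, z). (rdist M (chart_inv c y) (chart_inv c' z))\<^sup>2)"
  obtain W where W: "open W" "U \<subseteq> W"
    and F: "smooth_on ((snd c ` (fst c \<inter> W)) \<times> (snd c' ` (fst c' \<inter> W))) F"
    using U(2) c(1) c'(1) unfolding Log_dist_smooth_def Let_def F_def by blast
  define A where "A = snd c ` (fst c \<inter> W)"
  define A' where "A' = snd c' ` (fst c' \<inter> W)"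
  have oA: "open A" "open A'" unfolding A_def A'_def using chart_open_image W c c' by blast+
  have Ac: "A \<subseteq> snd c ` fst c" "A' \<subseteq> snd c' ` fst c'" unfolding A_def A'_def by auto
  have oD: "open (A \<times> A')" using oA by (rule open_Times)
  have yA: "snd c x0 \<in> A" "snd c' q0 \<in> A'" unfolding A_def A'_def using c c' x0 q0 W by auto
  obtain e2 where e2: "e2 > 0" "cball (snd c x0) e2 \<subseteq> A"
    using oA(1) yA(1) open_contains_cball by blast
  obtain e' where e': "e' > 0" "cball (snd c' q0) e' \<subseteq> A'"
    using oA(2) yA(2) open_contains_cball by blast
  \<comment> \<open>Half the radius: geodesics start within \<open>e\<close> and stay within
    \<open>2 * e\<close>.\<close>
  define e where "e = e2 / 2"
  have e: "e > 0" "cball (snd c x0) (2 * e) \<subseteq> A" using e2 unfolding e_def by auto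
  let ?C = "cball (snd c x0) (2 * e)" and ?C' = "cball (snd c' q0) e'"
  have Csub: "?C \<subseteq> snd c ` fst c" using e(2) Ac(1) by blast
  obtain \<mu> K\<^sub>\<Gamma> where \<mu>: "\<mu> > 0" and K\<^sub>\<Gamma>0: "K\<^sub>\<Gamma> \<ge> 0"
    and low: "\<And>y \<xi>. y \<in> ?C \<Longrightarrow> (\<mu> * norm \<xi>)\<^sup>2 \<le> G c y \<xi> \<xi>"
    and K\<^sub>\<Gamma>: "\<And>y \<xi>. y \<in> ?C \<Longrightarrow> norm (Chr c y \<xi> \<xi>) \<le> K\<^sub>\<Gamma> * (norm \<xi>)\<^sup>2"
    by (rule metric_bounds_compact[OF c(1) compact_cball Csub]) (use e(1) in auto)
  obtain K\<^sub>F where K\<^sub>F0: "K\<^sub>F \<ge> 0"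
    and K\<^sub>F1: "\<And>p h. p \<in> ?C \<times> ?C' \<Longrightarrow> norm (frechet_derivative F (at p) h) \<le> K\<^sub>F * norm h"
    and K\<^sub>F2: "\<And>p h k. p \<in> ?C \<times> ?C' \<Longrightarrow> norm (D2 F p h k) \<le> K\<^sub>F * norm h * norm k"
    by (rule smooth_on_bound_compact[OF F[folded A_def A'_def] oD compact_Times[OF compact_cball compact_cball]])
       (use e e' in auto)
  \<comment> \<open>\<open>K\<^sub>F\<close> bounds the second differential,
    \<open>K\<^sub>F * K\<^sub>\<Gamma>\<close> the acceleration term, and \<open>\<mu>\<close>
    converts coordinate norms into metric norms.\<close>
  define K where "K = K\<^sub>F * (1 + K\<^sub>\<Gamma>) / \<mu>\<^sup>2"
  have K0: "K \<ge> 0" unfolding K_def using K\<^sub>F0 K\<^sub>\<Gamma>0 by simp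
  define N where "N = (fst c \<inter> snd c -` ball (snd c x0) e) \<times> (fst c' \<inter> snd c' -` ball (snd c' q0) e')"
  have oN: "open N" unfolding N_def
    by (intro open_Times continuous_open_preimage chart_continuous chart_open c c' open_ball)
  have memN: "(x0, q0) \<in> N" unfolding N_def using c c' e e' by simp
  have "descent_at K (e * \<mu>) x q" if x: "x \<in> U" and q: "q \<in> U" and N: "(x, q) \<in> N" for x q
    unfolding descent_at_def
  proof (intro allI impI, elim conjE)
    fix \<gamma> V assume g: "geodesic_with \<gamma> V" and g0: "\<gamma> 0 = x" and small: "gnorm M x (V 0) < e * \<mu>"
    define z where "z = snd c' q"
    define \<sigma> where "\<sigma> = snd c \<circ> \<gamma>"
    define w where "w s = tcoord M c (\<gamma> s) (V s)" for s
    define n where "n = gnorm M x (V 0)"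
    have xc: "\<gamma> 0 \<in> fst c" "snd c (\<gamma> 0) \<in> ball (snd c x0) e" using N g0 unfolding N_def by auto
    have qc: "q \<in> fst c'" "z \<in> ?C'" using N unfolding N_def z_def by auto
    have cz: "chart_inv c' z = q" unfolding z_def by (rule chart_inv_left[OF c'(1) qc(1)])
    note stay = geodesic_stays_in_chart[OF g c(1) xc(1) Csub xc(2) low \<mu> small[folded g0]]
    have in1: "\<gamma> s \<in> fst c" and in2: "\<sigma> s \<in> ?C" and wn: "norm (w s) \<le> n / \<mu>" if "s \<in> {0..1}" for s
      using stay[OF _ that] unfolding \<sigma>_def w_def n_def g0 by auto
    have inD: "(\<sigma> s, z) \<in> A \<times> A'" "(\<sigma> s, z) \<in> ?C \<times> ?C'" if "s \<in> {0..1}" for s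
      using in2[OF that] qc e e' by auto
    define X where "X s = - Chr c (\<sigma> s) (w s) (w s)" for s
    have d\<sigma>: "((\<lambda>s. (\<sigma> s, z)) has_vector_derivative (w s, 0)) (at s within {0..1})" if s: "s \<in> {0..1}" for s
      using geodesic_equation(1)[OF g s c(1) in1[OF s]] unfolding \<sigma>_def w_def
      by (intro has_vector_derivative_Pair has_vector_derivative_const) 
    have dw: "((\<lambda>s. (w s, 0)) has_vector_derivative (X s, 0::real^'d)) (at s within {0..1})" if s: "s \<in> {0..1}" for s
      using geodesic_equation(2)[OF g s c(1) in1[OF s]] unfolding \<sigma>_def w_def X_def o_def
      by (intro has_vector_derivative_Pair has_vector_derivative_const)
    note FD = F[folded A_def A'_def]
    have "F (\<sigma> 1, z) \<le> F (\<sigma> 0, z) + frechet_derivative F (at (\<sigma> 0, z)) (w 0, 0) + K * n\<^sup>2"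
    proof (rule taylor_first_order_bound)
      fix s :: real assume s: "s \<in> {0..1}"
      show "((\<lambda>s. F (\<sigma> s, z)) has_vector_derivative frechet_derivative F (at (\<sigma> s, z)) (w s, 0)) (at s within {0..1})"
        by (rule has_vector_derivative_chain[OF d\<sigma>[OF s] smooth_on_derivative[OF FD inD(1)[OF s]]])
      show "((\<lambda>s. frechet_derivative F (at (\<sigma> s, z)) (w s, 0)) has_vector_derivative
          D2 F (\<sigma> s, z) (w s, 0) (w s, 0) + frechet_derivative F (at (\<sigma> s, z)) (X s, 0)) (at s within {0..1})"
        by (rule has_vector_derivative_frechet[OF FD oD inD(1)[OF s] d\<sigma>[OF s] dw[OF s] s])
      have "\<bar>D2 F (\<sigma> s, z) (w s, 0) (w s, 0) + frechet_derivative F (at (\<sigma> s, z)) (X s, 0)\<bar>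
          \<le> K\<^sub>F * norm (w s) * norm (w s) + K\<^sub>F * norm (X s)"
        using K\<^sub>F2[OF inD(2)[OF s], of "(w s, 0)" "(w s, 0)"] K\<^sub>F1[OF inD(2)[OF s], of "(X s, 0)"]
        by (simp add: norm_Pair)
      also have "\<dots> \<le> K\<^sub>F * (norm (w s))\<^sup>2 + K\<^sub>F * (K\<^sub>\<Gamma> * (norm (w s))\<^sup>2)"
        using K\<^sub>\<Gamma>[OF in2[OF s], of "w s"] K\<^sub>F0 unfolding X_def
        by (intro add_mono mult_left_mono) (auto simp: power2_eq_square)
      also have "\<dots> = K\<^sub>F * (1 + K\<^sub>\<Gamma>) * (norm (w s))\<^sup>2" by (simp add: algebra_simps)
      also have "\<dots> \<le> K\<^sub>F * (1 + K\<^sub>\<Gamma>) * (n / \<mu>)\<^sup>2"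
        using power_mono[OF wn[OF s], of 2] K\<^sub>F0 K\<^sub>\<Gamma>0 by (intro mult_left_mono) auto
      also have "\<dots> = K * n\<^sup>2" by (simp add: K_def power_divide)
      finally show "\<bar>D2 F (\<sigma> s, z) (w s, 0) (w s, 0) + frechet_derivative F (at (\<sigma> s, z)) (X s, 0)\<bar> \<le> K * n\<^sup>2" .
    qed
    moreover have "F (\<sigma> s, z) = (rdist M (\<gamma> s) q)\<^sup>2" if "s \<in> {0..1}" for s
      unfolding F_def \<sigma>_def using chart_inv_left[OF c(1) in1[OF that]] cz by simp
    \<comment> \<open>The linear term is evaluated with the geodesic from \<open>x\<close> to
      \<open>q\<close> behind \<open>Log M x q\<close>, not with the geodesic
      \<open>\<gamma>\<close> being followed.\<close>
    moreover have "frechet_derivative F (at (\<sigma> 0, z)) (w 0, 0) \<le> - 2 * ginner M x (Log M x q) (V 0)"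
    proof -
      obtain \<gamma>' V' where g': "geodesic_with \<gamma>' V'" "\<gamma>' 0 = x" "\<gamma>' 1 = q" "V' 0 = Log M x q"
        and l: "gnorm M x (Log M x q) = rdist M x q" by (rule Log_geodesic[OF U(1) x q])
      have xc': "\<gamma>' 0 \<in> fst c" using xc g0 g'(2) by simp
      have l': "gnorm M (\<gamma>' 0) (V' 0) = rdist M (\<gamma>' 0) (\<gamma>' 1)" using l g' by simp
      have \<sigma>0: "\<sigma> 0 = snd c (\<gamma>' 0)" unfolding \<sigma>_def using g0 g' by simp
      have "((\<lambda>y. (y, z)) has_derivative (\<lambda>h. (h, 0))) (at (\<sigma> 0))"
        by (intro has_derivative_Pair has_derivative_ident has_derivative_const)
      from has_derivative_compose[OF this smooth_on_derivative[OF FD inD(1)[of 0]]]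
      have "((\<lambda>y. F (y, z)) has_derivative (\<lambda>h. frechet_derivative F (at (\<sigma> 0, z)) (h, 0))) (at (\<sigma> 0))"
        by simp
      then have "((\<lambda>y. (rdist M (chart_inv c y) (\<gamma>' 1))\<^sup>2) has_derivative
          (\<lambda>h. frechet_derivative F (at (\<sigma> 0, z)) (h, 0))) (at (snd c (\<gamma>' 0)))"
        unfolding F_def by (simp add: cz g'(3) \<sigma>0)
      from first_variation[OF g'(1) c(1) xc' l' this, of "V 0"]
      show ?thesis unfolding w_def g0 g'(2,4) .
    qed
    ultimately show "(rdist M (\<gamma> 1) q)\<^sup>2 \<le>
       (rdist M x q)\<^sup>2 - 2 * ginner M x (Log M x q) (V 0) + K * (gnorm M x (V 0))\<^sup>2"
      using g0 by (simp add: n_def)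
  qed
  then show ?thesis using oN memN K0 e(1) \<mu> by (intro exI[of _ N] exI[of _ K] exI[of _ "e * \<mu>"]) auto
qed

lemma descent_at_mono:
  assumes "descent_at K \<delta> x q" "K \<le> K'" "\<delta>' \<le> \<delta>"
  shows "descent_at K' \<delta>' x q"
  unfolding descent_at_def
proof (intro allI impI, elim conjE)
  fix \<gamma> V assume "geodesic_with \<gamma> V" "\<gamma> 0 = x" "gnorm M x (V 0) < \<delta>'"
  with assms(1,3) have "(rdist M (\<gamma> 1) q)\<^sup>2 \<le>
      (rdist M x q)\<^sup>2 - 2 * ginner M x (Log M x q) (V 0) + K * (gnorm M x (V 0))\<^sup>2"
    unfolding descent_at_def by force
  also have "\<dots> \<le> (rdist M x q)\<^sup>2 - 2 * ginner M x (Log M x q) (V 0) + K' * (gnorm M x (V 0))\<^sup>2"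
    using assms(2) by (simp add: mult_right_mono)
  finally show "(rdist M (\<gamma> 1) q)\<^sup>2 \<le>
      (rdist M x q)\<^sup>2 - 2 * ginner M x (Log M x q) (V 0) + K' * (gnorm M x (V 0))\<^sup>2" .
qed

lemma descent_uniform:
  assumes U: "strongly_convex M U" "Log_dist_smooth M U" "compact U"
  obtains K \<delta> where "K \<ge> 0" "\<delta> > 0" "\<And>x q. x \<in> U \<Longrightarrow> q \<in> U \<Longrightarrow> descent_at K \<delta> x q"
proof -
  have "\<forall>p\<in>U \<times> U. \<exists>N K \<delta>. open N \<and> p \<in> N \<and> K \<ge> 0 \<and> \<delta> > 0 \<and>
      (\<forall>x\<in>U. \<forall>q\<in>U. (x, q) \<in> N \<longrightarrow> descent_at K \<delta> x q)"
    using descent_locally[OF U(1,2)] by auto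
  then obtain N K \<delta> where N: "\<And>p. p \<in> U \<times> U \<Longrightarrow> open (N p) \<and> p \<in> N p \<and> (K p :: real) \<ge> 0 \<and> (\<delta> p :: real) > 0 \<and>
      (\<forall>x\<in>U. \<forall>q\<in>U. (x, q) \<in> N p \<longrightarrow> descent_at (K p) (\<delta> p) x q)"
    by metis
  have cov: "U \<times> U \<subseteq> (\<Union>p\<in>U \<times> U. N p)" using N by blast
  obtain C where C: "C \<subseteq> U \<times> U" "finite C" "U \<times> U \<subseteq> (\<Union>p\<in>C. N p)"
    using compactE_image[OF compact_Times[OF U(3,3)] _ cov] N by blast
  \<comment> \<open>The sum dominates each \<open>K p\<close> because all are nonnegative; in the
    minimum below, the inserted 1 takes care of an empty \<open>C\<close>.\<close>
  define K' where "K' = (\<Sum>p\<in>C. K p)"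
  define \<delta>' where "\<delta>' = Min (insert 1 (\<delta> ` C))"
  have K: "K p \<ge> 0" if "p \<in> C" for p using N C(1) that by blast
  have "K' \<ge> 0" unfolding K'_def using K by (rule sum_nonneg)
  moreover have "\<delta>' > 0" unfolding \<delta>'_def using C N by (subst Min_gr_iff) auto
  moreover have "descent_at K' \<delta>' x q" if x: "x \<in> U" and q: "q \<in> U" for x q
  proof -
    obtain p where p: "p \<in> C" "(x, q) \<in> N p" using C(3) x q by blast
    then have "descent_at (K p) (\<delta> p) x q" using N C(1) x q by blast
    moreover have "K p \<le> K'" unfolding K'_def using p(1) K C(2) by (intro member_le_sum) auto
    moreover have "\<delta>' \<le> \<delta> p" unfolding \<delta>'_def using p(1) C(2) by simp
    ultimately show ?thesis by (rule descent_at_mono)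
  qed
  ultimately show ?thesis by (rule that)
qed

section \<open>One replanning step\<close>

lemma Exp_geodesic:
  assumes "Exp_defined M x w"
  obtains \<gamma> V where "geodesic_with \<gamma> V" "\<gamma> 0 = x" "V 0 = w" "\<gamma> 1 = Exp M x w"
proof -
  have "\<exists>y. \<exists>\<gamma>. geodesic_from M x w \<gamma> \<and> \<gamma> 1 = y" using assms unfolding Exp_defined_def by blast
  from someI_ex[OF this] obtain \<gamma> where g: "geodesic_from M x w \<gamma>" and e: "\<gamma> 1 = Exp M x w"
    unfolding Exp_def by blast
  obtain V where V: "geodesic_with \<gamma> V" "\<gamma> 0 = x" and v: "has_velocity M {0..1} \<gamma> 0 w"
    using g unfolding geodesic_from_def geodesic_iff by blast
  have "V 0 = w"
    by (rule velocity_unique[OF _ v]) (use V in \<open>auto simp: geodesic_with_def\<close>)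
  then show ?thesis using that V e by blast
qed

text \<open>From the square of \<open>\<xi> + \<eta>\<close>; it splits the control term into
  squares that can be absorbed.\<close>

lemma ginner_lower: "- ((gnorm M x \<xi>)\<^sup>2 + (gnorm M x \<eta>)\<^sup>2) / 2 \<le> ginner M x \<xi> \<eta>"
  using ginner_nonneg[of x "\<xi> + \<eta>"] unfolding gnorm_sq
  by (simp add: ginner_add ginner_add_right ginner_sym[of x \<eta> \<xi>])

lemma gnorm_add_sq: "(gnorm M x (\<xi> + \<eta>))\<^sup>2 \<le> 2 * (gnorm M x \<xi>)\<^sup>2 + 2 * (gnorm M x \<eta>)\<^sup>2"
  using ginner_nonneg[of x "\<xi> - \<eta>"] unfolding gnorm_sq
  by (simp add: ginner_diff ginner_sym[of x _ "\<xi> - \<eta>"] ginner_add ginner_add_right ginner_sym[of x \<eta> \<xi>])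

text \<open>All errors are compared with the gain \<open>c * \<Delta> * R\<^sup>2\<close>, using
  \<open>\<rho> \<le> g * R\<close>. The cubic alignment error and the terms of second order in
  \<open>\<Delta>\<close> take at most a quarter of it each.\<close>

lemma step_descent:
  fixes \<Delta> \<rho> R K L\<^sub>v L\<^sub>u g b c :: real
  defines "Q \<equiv> 2 * L\<^sub>v\<^sup>2 + L\<^sub>u\<^sup>2"
  assumes d: "descent_at K \<delta> x q" and K: "K \<ge> 0"
    and w: "w = \<Delta> *\<^sub>R v + (\<Delta>\<^sup>2 / 2) *\<^sub>R u" "Exp_defined M x w"
    and rv: "ginner M x (Log M x q) v \<ge> c * R\<^sup>2 - b * \<rho> ^ 3" and R: "R = gnorm M x (Log M x q)"
    and \<rho>: "0 \<le> \<rho>" "\<rho> \<le> g * R" "\<rho> \<le> \<rho>\<^sub>0" "\<rho>\<^sub>0 \<le> 1" and b: "b \<ge> 0" "4 * (b * g\<^sup>2 * \<rho>\<^sub>0) \<le> c"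
    and v: "gnorm M x v \<le> L\<^sub>v * \<rho>" and u: "gnorm M x u \<le> L\<^sub>u * \<rho>"
    and \<Delta>: "0 < \<Delta>" "\<Delta> \<le> 1" "\<Delta> * (Q + 1) \<le> \<delta>" "4 * (\<Delta> * (1 + L\<^sub>u\<^sup>2 * g\<^sup>2 + K * Q * g\<^sup>2)) \<le> c"
  shows "(rdist M (Exp M x w) q)\<^sup>2 / 2 - (rdist M x q)\<^sup>2 / 2 \<le> - (c / 2) * \<Delta> * R\<^sup>2"
proof -
  define r where "r = Log M x q"
  have Q0: "Q \<ge> 0" unfolding Q_def by simp
  have \<rho>2: "\<rho>\<^sup>2 \<le> g\<^sup>2 * R\<^sup>2" using power_mono[OF \<rho>(2,1), of 2] by (simp add: power_mult_distrib)
  have v2: "(gnorm M x v)\<^sup>2 \<le> L\<^sub>v\<^sup>2 * \<rho>\<^sup>2" using power_mono[OF v gnorm_nonneg, of 2] by (simp add: power_mult_distrib)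
  have u2: "(gnorm M x u)\<^sup>2 \<le> L\<^sub>u\<^sup>2 * \<rho>\<^sup>2" using power_mono[OF u gnorm_nonneg, of 2] by (simp add: power_mult_distrib)
  \<comment> \<open>\<open>\<Delta> \<le> 1\<close> allows the fourth-order term from the control to
    be counted as second order; this gives \<open>Q\<close>.\<close>
  have w2: "(gnorm M x w)\<^sup>2 \<le> \<Delta>\<^sup>2 * (Q * \<rho>\<^sup>2)"
  proof -
    have "(gnorm M x w)\<^sup>2 \<le> 2 * (\<Delta>\<^sup>2 * (gnorm M x v)\<^sup>2) + 2 * ((\<Delta>\<^sup>2 / 2)\<^sup>2 * (gnorm M x u)\<^sup>2)"
      using gnorm_add_sq[of x "\<Delta> *\<^sub>R v" "(\<Delta>\<^sup>2 / 2) *\<^sub>R u"] unfolding w(1) gnorm_scale power_mult_distrib power2_abs .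
    also have "\<dots> \<le> 2 * (\<Delta>\<^sup>2 * (L\<^sub>v\<^sup>2 * \<rho>\<^sup>2)) + 2 * (\<Delta>\<^sup>2 / 2 * (L\<^sub>u\<^sup>2 * \<rho>\<^sup>2))"
    proof (intro add_mono mult_left_mono mult_mono v2 u2)
      have "\<Delta>\<^sup>2 \<le> 1" using \<Delta>(1,2) by (simp add: power_le_one)
      then have "(\<Delta>\<^sup>2 / 2) * (\<Delta>\<^sup>2 / 2) \<le> (\<Delta>\<^sup>2 / 2) * 1" by (intro mult_left_mono) auto
      then show "(\<Delta>\<^sup>2 / 2)\<^sup>2 \<le> \<Delta>\<^sup>2 / 2" by (simp add: power2_eq_square)
    qed auto
    finally show ?thesis unfolding Q_def by (simp add: algebra_simps)
  qed
  \<comment> \<open>\<open>Q < (Q + 1)\<^sup>2\<close> avoids a square root in the condition on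
    \<open>\<Delta>\<close>.\<close>
  have small: "gnorm M x w < \<delta>"
  proof -
    have "\<rho>\<^sup>2 \<le> 1" using \<rho> by (simp add: power_le_one)
    then have "Q * \<rho>\<^sup>2 \<le> Q * 1" by (rule mult_left_mono[OF _ Q0])
    also have "\<dots> < (Q + 1)\<^sup>2"
      unfolding power2_eq_square distrib_left distrib_right using Q0 zero_le_square[of Q] by linarith
    finally have "\<Delta>\<^sup>2 * (Q * \<rho>\<^sup>2) < \<Delta>\<^sup>2 * (Q + 1)\<^sup>2" using \<Delta>(1) by simp
    then have "(gnorm M x w)\<^sup>2 < (\<Delta> * (Q + 1))\<^sup>2" using w2 by (simp add: power_mult_distrib)
    then have "gnorm M x w < \<Delta> * (Q + 1)" by (rule power2_less_imp_less) (use \<Delta> Q0 in simp)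
    then show ?thesis using \<Delta>(3) by linarith
  qed
  obtain \<gamma> V where g: "geodesic_with \<gamma> V" "\<gamma> 0 = x" "V 0 = w" "\<gamma> 1 = Exp M x w"
    by (rule Exp_geodesic[OF w(2)])
  have 1: "(rdist M (Exp M x w) q)\<^sup>2 \<le> (rdist M x q)\<^sup>2 - 2 * ginner M x r w + K * (gnorm M x w)\<^sup>2"
    using d[unfolded descent_at_def, rule_format, of \<gamma> V] g small unfolding r_def by simp
  have rw: "ginner M x r w = \<Delta> * ginner M x r v + \<Delta>\<^sup>2 / 2 * ginner M x r u"
    unfolding w(1) by (simp add: ginner_add_right ginner_scale_right)
  \<comment> \<open>One factor of the cube is bounded by \<open>\<rho>\<^sub>0\<close>, the other
    two by \<open>g * R\<close>: the error becomes quadratic in \<open>R\<close> with a small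
    constant.\<close>
  have rv': "c * R\<^sup>2 - b * (\<rho>\<^sub>0 * (g\<^sup>2 * R\<^sup>2)) \<le> ginner M x r v"
  proof -
    have "\<rho> ^ 3 = \<rho> * \<rho>\<^sup>2" by (simp add: power3_eq_cube power2_eq_square)
    also have "\<dots> \<le> \<rho>\<^sub>0 * (g\<^sup>2 * R\<^sup>2)" using \<rho> \<rho>2 by (intro mult_mono) auto
    finally have "b * \<rho> ^ 3 \<le> b * (\<rho>\<^sub>0 * (g\<^sup>2 * R\<^sup>2))" by (rule mult_left_mono[OF _ b(1)])
    then show ?thesis using rv unfolding r_def by linarith
  qed
  have ru: "- (R\<^sup>2 + L\<^sub>u\<^sup>2 * (g\<^sup>2 * R\<^sup>2)) / 2 \<le> ginner M x r u"
    using ginner_lower[of x r u] u2 mult_left_mono[OF \<rho>2, of "L\<^sub>u\<^sup>2"] unfolding r_def R by simp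
  have "Q * \<rho>\<^sup>2 \<le> Q * (g\<^sup>2 * R\<^sup>2)" by (rule mult_left_mono[OF \<rho>2 Q0])
  then have "\<Delta>\<^sup>2 * (Q * \<rho>\<^sup>2) \<le> \<Delta>\<^sup>2 * (Q * (g\<^sup>2 * R\<^sup>2))" by (rule mult_left_mono) simp
  with w2 have "(gnorm M x w)\<^sup>2 \<le> \<Delta>\<^sup>2 * (Q * (g\<^sup>2 * R\<^sup>2))" by linarith
  then have Kw: "K * (gnorm M x w)\<^sup>2 \<le> K * (\<Delta>\<^sup>2 * (Q * (g\<^sup>2 * R\<^sup>2)))" by (rule mult_left_mono[OF _ K])
  have "\<Delta> * (c * R\<^sup>2 - b * (\<rho>\<^sub>0 * (g\<^sup>2 * R\<^sup>2))) \<le> \<Delta> * ginner M x r v"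
    using rv' \<Delta>(1) by simp
  moreover have "\<Delta>\<^sup>2 / 2 * (- (R\<^sup>2 + L\<^sub>u\<^sup>2 * (g\<^sup>2 * R\<^sup>2)) / 2) \<le> \<Delta>\<^sup>2 / 2 * ginner M x r u"
    by (rule mult_left_mono[OF ru]) simp
  moreover have "a' / 2 - a / 2 \<le> - A - B + E / 2"
    if "A \<le> P" "B \<le> S" "a' \<le> a - 2 * (P + S) + k" "k \<le> E" for a a' A B P S k E :: real
    using that by (simp add: field_simps)
  ultimately have "(rdist M (Exp M x w) q)\<^sup>2 / 2 - (rdist M x q)\<^sup>2 / 2 \<le>
      - (\<Delta> * (c * R\<^sup>2 - b * (\<rho>\<^sub>0 * (g\<^sup>2 * R\<^sup>2)))) - \<Delta>\<^sup>2 / 2 * (- (R\<^sup>2 + L\<^sub>u\<^sup>2 * (g\<^sup>2 * R\<^sup>2)) / 2)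
      + K * (\<Delta>\<^sup>2 * (Q * (g\<^sup>2 * R\<^sup>2))) / 2"
    using 1[unfolded rw] Kw by blast
  also have "\<dots> = (\<Delta> * R\<^sup>2) * (- c + b * g\<^sup>2 * \<rho>\<^sub>0 +
      \<Delta> * ((1 + L\<^sub>u\<^sup>2 * g\<^sup>2) / 4 + K * Q * g\<^sup>2 / 2))"
    by (simp add: field_simps power2_eq_square)
  also have "\<dots> \<le> (\<Delta> * R\<^sup>2) * (- (c / 2))"
  proof (rule mult_left_mono)
    have "\<Delta> * ((1 + L\<^sub>u\<^sup>2 * g\<^sup>2) / 4 + K * Q * g\<^sup>2 / 2) \<le> \<Delta> * (1 + L\<^sub>u\<^sup>2 * g\<^sup>2 + K * Q * g\<^sup>2)"
    proof (rule mult_left_mono)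
      have "(1 + p) / 4 + p' / 2 \<le> 1 + p + p'" if "0 \<le> p" "0 \<le> p'" for p p' :: real
        using that by (simp add: field_simps)
      then show "(1 + L\<^sub>u\<^sup>2 * g\<^sup>2) / 4 + K * Q * g\<^sup>2 / 2 \<le> 1 + L\<^sub>u\<^sup>2 * g\<^sup>2 + K * Q * g\<^sup>2"
        using K Q0 by simp
    qed (use \<Delta> in simp)
    moreover have "- c + p + s \<le> - (c / 2)" if "s \<le> s'" "4 * p \<le> c" "4 * s' \<le> c" for p s s' :: real
      using that by (simp add: field_simps)
    ultimately show "- c + b * g\<^sup>2 * \<rho>\<^sub>0 + \<Delta> * ((1 + L\<^sub>u\<^sup>2 * g\<^sup>2) / 4 + K * Q * g\<^sup>2 / 2) \<le> - (c / 2)"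
      using b(2) \<Delta>(4) by blast
  qed (use \<Delta> in simp)
  finally show ?thesis by (simp add: mult_ac)
qed

end
theorem theorem2:
  fixes M :: "('m::{t2_space,second_countable_topology}, 'd::finite) riemannian"
    and U :: "'m set"
    and \<kappa> c\<^sub>1 c\<^sub>2 \<Gamma> L\<^sub>v L\<^sub>u C\<^sub>H :: real
  assumes "riemannian_manifold M"
    and "compact U" and "interior U \<noteq> {}" and "strongly_convex M U"
    and "Log_dist_smooth M U"
    and "\<kappa> \<ge> 0" and "sectional_bounded M U \<kappa>"
    and "c\<^sub>1 > 0" and "c\<^sub>2 > 0" and "\<Gamma> > 0" and "L\<^sub>v > 0" and "L\<^sub>u > 0" and "C\<^sub>H > 0"
  shows "\<exists>\<rho>max>0. \<exists>\<Delta>max>0. \<exists>C\<^sub>7>0.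
    \<forall>\<Delta>t T w\<^sub>f N n q \<pi> e t x v u X V.
      tangent_lqr_run M \<Delta>t T w\<^sub>f N n q \<pi> e t x v u X V \<and> run_in U \<Delta>t N n q t x X \<longrightarrow>
      (\<forall>k<N. \<forall>qbar.
        let \<Psi> = (\<lambda>p. (rdist M p qbar)\<^sup>2 / 2);
            r = Log M (x k) qbar;
            \<sigma> = Max ((\<lambda>j. gnorm M (x k) (Log M (x k) (q k j))) ` {..<n k});
            \<rho> = max (gnorm M (x k) r) \<sigma>
        in qbar \<in> U \<and>
           hessian_bounded M \<Psi> U C\<^sub>H \<and>
           ginner M (x k) r (v k) \<ge> c\<^sub>1 * (gnorm M (x k) r)\<^sup>2 - c\<^sub>2 * \<kappa> * \<rho> ^ 3 \<and>
           \<sigma> \<le> \<Gamma> * gnorm M (x k) r \<and>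
           (\<forall>s\<in>{t k..t k + \<Delta>t}.
              gnorm M (X k s) (V k s) \<le> L\<^sub>v * \<rho> \<and>
              gnorm M (X k s) (parallel_transport M (x k) (X k s) (u k)) \<le> L\<^sub>u * \<rho>) \<and>
           \<rho> \<le> \<rho>max \<and> 0 < \<Delta>t \<and> \<Delta>t \<le> \<Delta>max
           \<longrightarrow> \<Psi> (x (Suc k)) - \<Psi> (x k) \<le> - C\<^sub>7 * \<Delta>t * (gnorm M (x k) r)\<^sup>2)"
proof -
  interpret riemann_mfd M by (rule riemann_mfd.intro) (rule assms(1))
  note U = \<open>strongly_convex M U\<close> \<open>Log_dist_smooth M U\<close> \<open>compact U\<close>
  obtain K \<delta> where K: "K \<ge> 0" and \<delta>: "\<delta> > 0"
    and desc: "\<And>x q. x \<in> U \<Longrightarrow> q \<in> U \<Longrightarrow> descent_at K \<delta> x q"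
    using descent_uniform[OF U] by blast
  \<comment> \<open>The spread hypothesis and \<open>?\<rho> = max ?R ?\<sigma>\<close> give
    \<open>?\<rho> \<le> g * ?R\<close>.\<close>
  define g where "g = max 1 \<Gamma>"
  define Q where "Q = 2 * L\<^sub>v\<^sup>2 + L\<^sub>u\<^sup>2"
  define b where "b = c\<^sub>2 * \<kappa>"
  define H where "H = 1 + L\<^sub>u\<^sup>2 * g\<^sup>2 + K * Q * g\<^sup>2"
  \<comment> \<open>Ensures \<open>4 * (b * g\<^sup>2 * \<rho>\<^sub>0) \<le> c\<^sub>1\<close>; the
    added 1 keeps the denominator positive when \<open>\<kappa> = 0\<close>.\<close>
  define \<rho>\<^sub>0 where "\<rho>\<^sub>0 = min 1 (c\<^sub>1 / (4 * (b * g\<^sup>2 + 1)))"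
  \<comment> \<open>The entries serve the three upper bounds on the step in
    \<open>step_descent\<close>.\<close>
  define \<Delta>\<^sub>0 where "\<Delta>\<^sub>0 = min 1 (min (\<delta> / (Q + 1)) (c\<^sub>1 / (4 * H)))"
  have b0: "b \<ge> 0" unfolding b_def using assms(6,9) by simp
  have Q0: "Q \<ge> 0" unfolding Q_def by simp
  have H0: "H > 0" unfolding H_def using K Q0 by (simp add: add_pos_nonneg)
  have bg: "b * g\<^sup>2 \<ge> 0" using b0 by simp
  have \<rho>0: "\<rho>\<^sub>0 > 0" "\<rho>\<^sub>0 \<le> 1" unfolding \<rho>\<^sub>0_def using bg \<open>c\<^sub>1 > 0\<close> by (auto simp: add_nonneg_pos)
  have b\<rho>: "4 * (b * g\<^sup>2 * \<rho>\<^sub>0) \<le> c\<^sub>1"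
  proof -
    have "\<rho>\<^sub>0 \<le> c\<^sub>1 / (4 * (b * g\<^sup>2 + 1))" unfolding \<rho>\<^sub>0_def by simp
    then have "\<rho>\<^sub>0 * (4 * (b * g\<^sup>2 + 1)) \<le> c\<^sub>1" using bg by (simp add: pos_le_divide_eq)
    then show ?thesis using \<rho>0 by (simp add: algebra_simps)
  qed
  have \<Delta>0: "\<Delta>\<^sub>0 > 0" unfolding \<Delta>\<^sub>0_def using \<delta> Q0 H0 \<open>c\<^sub>1 > 0\<close> by (auto simp: add_nonneg_pos)
  have \<Delta>b: "\<Delta> \<le> 1" "\<Delta> * (Q + 1) \<le> \<delta>" "4 * (\<Delta> * H) \<le> c\<^sub>1" if "\<Delta> \<le> \<Delta>\<^sub>0" for \<Delta>
  proof -
    have "\<Delta> \<le> 1" "\<Delta> \<le> \<delta> / (Q + 1)" "\<Delta> \<le> c\<^sub>1 / (4 * H)" using that unfolding \<Delta>\<^sub>0_def by auto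
    then show "\<Delta> \<le> 1" "\<Delta> * (Q + 1) \<le> \<delta>" "4 * (\<Delta> * H) \<le> c\<^sub>1"
      using Q0 H0 by (auto simp: pos_le_divide_eq mult_ac)
  qed
  \<comment> \<open>The witnesses depend only on the manifold, \<open>U\<close> and the given
    constants; the data of the run are introduced after them.\<close>
  show ?thesis
    unfolding Let_def
  proof (rule exI[of _ \<rho>\<^sub>0], intro conjI \<rho>0(1), rule exI[of _ \<Delta>\<^sub>0], intro conjI \<Delta>0,
      rule exI[of _ "c\<^sub>1 / 2"], intro conjI allI impI; (elim conjE)?)
    show "c\<^sub>1 / 2 > 0" using \<open>c\<^sub>1 > 0\<close> by simp
  next
    fix \<Delta>t w\<^sub>f :: real and T N k :: nat and n :: "nat \<Rightarrow> nat" and q :: "nat \<Rightarrow> nat \<Rightarrow> 'm"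
      and \<pi> :: "nat \<Rightarrow> nat \<Rightarrow> real" and e :: "nat \<Rightarrow> 'd \<Rightarrow> real^'d" and t :: "nat \<Rightarrow> real"
      and x :: "nat \<Rightarrow> 'm" and v u :: "nat \<Rightarrow> real^'d" and X :: "nat \<Rightarrow> real \<Rightarrow> 'm"
      and V :: "nat \<Rightarrow> real \<Rightarrow> real^'d" and qbar :: 'm
    let ?R = "gnorm M (x k) (Log M (x k) qbar)"
    let ?\<sigma> = "Max ((\<lambda>j. gnorm M (x k) (Log M (x k) (q k j))) ` {..<n k})"
    let ?\<rho> = "max ?R ?\<sigma>"
    assume run: "tangent_lqr_run M \<Delta>t T w\<^sub>f N n q \<pi> e t x v u X V"
      and inU: "run_in U \<Delta>t N n q t x X" and k: "k < N" and qU: "qbar \<in> U"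
      and al: "c\<^sub>1 * ?R\<^sup>2 - c\<^sub>2 * \<kappa> * ?\<rho> ^ 3 \<le> ginner M (x k) (Log M (x k) qbar) (v k)"
      and sp: "?\<sigma> \<le> \<Gamma> * ?R"
      and lb: "\<forall>s\<in>{t k..t k + \<Delta>t}. gnorm M (X k s) (V k s) \<le> L\<^sub>v * ?\<rho> \<and>
              gnorm M (X k s) (parallel_transport M (x k) (X k s) (u k)) \<le> L\<^sub>u * ?\<rho>"
      and \<rho>m: "?\<rho> \<le> \<rho>\<^sub>0" and \<Delta>: "0 < \<Delta>t" "\<Delta>t \<le> \<Delta>\<^sub>0"
    have xU: "x k \<in> U" using inU k unfolding run_in_def by blast
    have cl: "X k (t k) = x k" "V k (t k) = v k"
      using run k unfolding tangent_lqr_run_def closed_loop_segment_def by blast+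
    define w where "w = \<Delta>t *\<^sub>R v k + (\<Delta>t\<^sup>2 / 2) *\<^sub>R u k"
    have ex: "Exp_defined M (x k) w" "x (Suc k) = Exp M (x k) w"
      using run k unfolding tangent_lqr_run_def Let_def w_def by blast+
    have R0: "?R \<ge> 0" by (rule gnorm_nonneg)
    have "1 * ?R \<le> g * ?R" "\<Gamma> * ?R \<le> g * ?R"
      unfolding g_def by (intro mult_right_mono[OF _ R0]; simp)+
    then have \<rho>g: "?\<rho> \<le> g * ?R" using sp by simp
    \<comment> \<open>At the initial time the closed-loop state is \<open>(x k, v k)\<close> and the
      transported control is \<open>u k\<close>, so the local bounds become bounds for
      \<open>v k\<close> and \<open>u k\<close>.\<close>
    have tk: "t k \<in> {t k..t k + \<Delta>t}" using \<Delta>(1) by simp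
    have vb: "gnorm M (x k) (v k) \<le> L\<^sub>v * ?\<rho>" and ub: "gnorm M (x k) (u k) \<le> L\<^sub>u * ?\<rho>"
      using bspec[OF lb tk] unfolding cl parallel_transport_self[OF U(1) xU] by auto
    have "(rdist M (Exp M (x k) w) qbar)\<^sup>2 / 2 - (rdist M (x k) qbar)\<^sup>2 / 2 \<le> - (c\<^sub>1 / 2) * \<Delta>t * ?R\<^sup>2"
    proof (rule step_descent[OF desc[OF xU qU] K w_def ex(1) al[folded b_def] refl _ \<rho>g \<rho>m \<rho>0(2) b0 b\<rho> vb ub \<Delta>(1)])
      show "0 \<le> ?\<rho>" using R0 by simp
    qed (use \<Delta>b[OF \<Delta>(2)] in \<open>simp_all add: Q_def H_def\<close>)
    then show "(rdist M (x (Suc k)) qbar)\<^sup>2 / 2 - (rdist M (x k) qbar)\<^sup>2 / 2 \<le> - (c\<^sub>1 / 2) * \<Delta>t * ?R\<^sup>2"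
      unfolding ex(2) .
  qed
qed

end
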